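(* If $\phi$ is a function of type-II, then for $\alpha>0$ $$\lim_{\gamma\to\infty}M_{\phi_\gamma,1/\alpha}=\frac{\alpha^2}{4}.$$ Consequently, if $\alpha,\beta>0$ and $\alpha\beta<1$, then there exists a $\gamma>0$ depending on $\alpha\beta$ such that $\mathcal{G}(\phi_\gamma,\alpha,\beta)$ forms a frame for $L^2(\mathbb{R})$.
   Context: The Fourier transform is $\widehat f(w)=\int_{-\infty}^{\infty}f(x)e^{-2\pi i wx}\,dx$. A function $\phi\in L^1(\mathbb{R})$ is of type-II if its Fourier transform has the form $$\widehat\phi(w)=e^{-|w|}\prod_{j=1}^{\infty}(1+2\pi i v_jw)^{-1}e^{2\pi i v_jw},\qquad v_j\in\mathbb{R},\quad 0\le\sum_j v_j^2<\infty.$$ For $\gamma>0$, $\phi_\gamma(x)=\sqrt{\gamma}\,\phi(\gamma x)$. For $h>0$, $$M_{\phi,h}:=\operatorname*{ess\,sup}_{w\in[0,1/h]}\frac{\sum_{l\in\mathbb{Z}}(w+\frac{l}{h})^2|\widehat\phi(w+\frac{l}{h})|^2}{\sum_{l\in\mathbb{Z}}|\widehat\phi(w+\frac{l}{h})|^2}.$$ For $\phi\in L^2(\mathbb{R})$ and $\alpha,\beta>0$, $\mathcal{G}(\phi,\alpha,\beta)=\{e^{2\pi i\beta m\cdot}\phi(\cdot-\alpha k):k,m\in\mathbb{Z}\}$; it is a frame for $L^2(\mathbb{R})$ if there are constants $A,B>0$ with $A\|f\|^2\le\sum_{k,m\in\mathbb{Z}}|\langle f,e^{2\pi i\beta m\cdot}\phi(\cdot-\alpha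 k)\rangle|^2\le B\|f\|^2$ for all $f\in L^2(\mathbb{R})$.
   Formalization: The limit is proved as γ→0+ instead of γ→∞: with φ_γ(x)=√γ φ(γx) the printed limit is infinite for every type-II φ (e.g. φ̂(w)=e^{-|w|}); the frame claim is proved as printed, with γ chosen after α and β. *)

theory Defs
  imports "HOL-Analysis.Analysis" "HOL-Probability.Essential_Supremum"
begin

definition fourier :: "(real \<Rightarrow> complex) \<Rightarrow> real \<Rightarrow> complex" where
  "fourier f w = (LINT x|lebesgue. f x * exp (- 2 * of_real pi * \<i> * of_real w * of_real x))"

(* The sequence v is indexed from 0 instead of 1.  Square-summability makes the product
   converge absolutely, and no factor vanishes for real w. *)
definition type_II :: "(real \<Rightarrow> complex) \<Rightarrow> bool" where
  "type_II \<phi> \<longleftrightarrow> integrable lebesgue \<phi> \<and>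
     (\<exists>v :: nat \<Rightarrow> real. summable (\<lambda>j. (v j)\<^sup>2) \<and>
        (\<forall>w. fourier \<phi> w =
           of_real (exp (- \<bar>w\<bar>)) *
           (\<Prod>j. inverse (1 + 2 * of_real pi * \<i> * of_real (v j) * of_real w) *
                exp (2 * of_real pi * \<i> * of_real (v j) * of_real w))))"

(* For g > 0, fourier (dilate g \<phi>) w = fourier \<phi> (w / g) / sqrt g: the Fourier transform
   spreads out as g tends to infinity and concentrates at 0 as g tends to 0. *)
definition dilate :: "real \<Rightarrow> (real \<Rightarrow> complex) \<Rightarrow> real \<Rightarrow> complex" where
  "dilate g \<phi> x = of_real (sqrt g) * \<phi> (g * x)"

(* Taken in the extended nonnegative reals, so that no convergence or boundedness
   has to be presupposed. *)
definition M_const :: "(real \<Rightarrow> complex) \<Rightarrow> real \<Rightarrow> ennreal" where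
  "M_const \<phi> h = esssup (lebesgue_on {0..1 / h}) (\<lambda>w.
     (\<Sum>\<^sub>\<infinity>l\<in>(UNIV :: int set).
        ennreal ((w + of_int l / h)\<^sup>2 * (cmod (fourier \<phi> (w + of_int l / h)))\<^sup>2)) /
     (\<Sum>\<^sub>\<infinity>l\<in>(UNIV :: int set).
        ennreal ((cmod (fourier \<phi> (w + of_int l / h)))\<^sup>2)))"

definition L2 :: "(real \<Rightarrow> complex) set" where
  "L2 = {f \<in> borel_measurable lebesgue. integrable lebesgue (\<lambda>x. (cmod (f x))\<^sup>2)}"

definition L2_inner :: "(real \<Rightarrow> complex) \<Rightarrow> (real \<Rightarrow> complex) \<Rightarrow> complex" where
  "L2_inner f g = (LINT x|lebesgue. f x * cnj (g x))"

definition L2_norm :: "(real \<Rightarrow> complex) \<Rightarrow> real" where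
  "L2_norm f = sqrt (LINT x|lebesgue. (cmod (f x))\<^sup>2)"

definition frame_L2 :: "('i \<Rightarrow> real \<Rightarrow> complex) \<Rightarrow> bool" where
  "frame_L2 e \<longleftrightarrow> (\<forall>i. e i \<in> L2) \<and>
     (\<exists>A B :: real. 0 < A \<and> 0 < B \<and>
        (\<forall>f\<in>L2.
           ennreal (A * (L2_norm f)\<^sup>2) \<le>
             (\<Sum>\<^sub>\<infinity>i\<in>UNIV. ennreal ((cmod (L2_inner f (e i)))\<^sup>2)) \<and>
           (\<Sum>\<^sub>\<infinity>i\<in>UNIV. ennreal ((cmod (L2_inner f (e i)))\<^sup>2))
             \<le> ennreal (B * (L2_norm f)\<^sup>2)))"

(* The Gabor system as a family indexed by pairs (k, m), since the frame sum runs over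
   indices rather than over the set of atoms. *)
definition gabor :: "(real \<Rightarrow> complex) \<Rightarrow> real \<Rightarrow> real \<Rightarrow> int \<times> int \<Rightarrow> real \<Rightarrow> complex" where
  "gabor \<phi> \<alpha> \<beta> = (\<lambda>(k, m) x.
     exp (2 * of_real pi * \<i> * of_real \<beta> * of_int m * of_real x) * \<phi> (x - \<alpha> * of_int k))"

end

theory Submission
  imports Defs "HOL-Probability.Characteristic_Functions"
begin

text \<open>Let \<open>F\<close> be the Fourier transform of \<open>\<phi>\<close>. Everything rests on one property of \<open>F\<close>: it has no
  zeros, and \<open>\<bar>F y\<bar> \<le> exp (\<bar>x\<bar> - \<bar>y\<bar>) \<bar>F x\<bar>\<close> whenever \<open>\<bar>x\<bar> \<le> \<bar>y\<bar>\<close>. The exponential factor of \<open>F\<close> gives the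
  rate, and the product can only help, since the modulus of each of its factors decreases in
  \<open>\<bar>w\<bar>\<close> (\<open>steep_typeII_product\<close>). Dilation by \<open>\<gamma>\<close> changes the rate to \<open>1 / \<gamma>\<close> (\<open>steep_dilate\<close>), so for small
  \<open>\<gamma>\<close> a sum of values of the transform over a lattice is governed by the points nearest to \<open>0\<close>.

  The limit. The quotient at \<open>w\<close> is a weighted mean of the squares \<open>(w + l \<alpha>)\<^sup>2\<close>. It is at least the
  smallest of them, whose supremum over \<open>w\<close> is \<open>\<alpha>\<^sup>2 / 4\<close>, and steepness bounds the excess by a
  multiple of \<open>\<gamma>\<close>, uniformly in \<open>w\<close> (\<open>ratio_bounds\<close>, \<open>M_const_bounds\<close>).

  The frame. Put \<open>p = 1 / \<beta>\<close>, let \<open>g\<close> be the dilated window and \<open>K\<close> its transform. For fixed \<open>k\<close> the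
  coefficients of \<open>f\<close> are Fourier coefficients of the \<open>p\<close>-periodization of \<open>f\<close> times the conjugate of
  the translate of \<open>g\<close> by \<open>\<alpha> k\<close>. Parseval's identity therefore writes the frame sum as an integral over \<open>x\<close> of sums
  \<open>\<Sum>k. \<bar>\<Sum>n. c n * g (p (x + n) - \<alpha> k)\<bar>\<^sup>2\<close>, where the \<open>c n\<close> are the conjugates of the values \<open>f (p (x + n))\<close>
  (\<open>gabor_coefficients_sq_sum\<close>). Fourier inversion expresses \<open>g\<close> through \<open>K\<close>, and a second application of
  Parseval's identity, now with period \<open>1 / \<alpha>\<close>, turns this sum into the mean square of the
  \<open>1 / \<alpha>\<close>-periodization of \<open>K\<close> times a phase and a trigonometric sum with coefficients \<open>c n\<close> and period \<open>\<beta>\<close>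
  (\<open>samples_sq_sum_eq\<close>). As \<open>\<beta> < 1 / \<alpha>\<close>, one period \<open>\<bar>w\<bar> \<le> \<beta> / 2\<close> of the trigonometric sum fits into
  one period of the periodization with room to spare. On it the central term is bounded below through the edge
  value of \<open>\<bar>K\<bar>\<close>, while the term shifted by \<open>l / \<alpha>\<close> is smaller than that by \<open>exp (- \<bar>l\<bar> (1 / \<alpha> - \<beta>) / \<gamma>)\<close>; for small
  \<open>\<gamma>\<close> the central term wins (\<open>samples_sq_sum_lower\<close>), and the upper bound is plain geometric decay
  (\<open>samples_sq_sum_upper\<close>). The constants do not depend on \<open>x\<close>, so integration gives frame bounds for bounded
  functions of compact support, and truncation extends them to all of \<open>L\<^sup>2\<close> (\<open>frame_bounds_extend\<close>).

  The analytic ingredients are Parseval's identity for bounded functions on the unit interval,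
  obtained from Stone-Weierstrass on the circle (\<open>parseval\<close>), and almost everywhere Fourier
  inversion for integrable functions with integrable transform, obtained by Gaussian smoothing
  (\<open>fourier_inversion\<close>).\<close>

section \<open>Borel representatives\<close>

text \<open>The Fourier transform and the frame inequalities do not see null sets, so every
  Lebesgue measurable function can be traded for a Borel measurable one. This gives access to
  the affine substitution and Fubini rules for \<^const>\<open>lborel\<close>.\<close>
lemma lebesgue_measurable_imp_ae_borel:
  fixes f :: "real \<Rightarrow> complex"
  assumes "f \<in> borel_measurable lebesgue"
  obtains f' where "f' \<in> borel_measurable borel" "AE x in lborel. f x = f' x"
proof -
  have "(\<lambda>x. Re (f x)) \<in> borel_measurable lebesgue" "(\<lambda>x. Im (f x)) \<in> borel_measurable lebesgue"
    using assms by measurable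
  then obtain a b where "a \<in> borel_measurable lborel" "AE x in lborel. Re (f x) = a x"
      "b \<in> borel_measurable lborel" "AE x in lborel. Im (f x) = b x"
    by (metis completion_ex_borel_measurable_real)
  then show thesis
    by (intro that[of "\<lambda>x. Complex (a x) (b x)"]) (auto simp: complex_eq_iff Complex_eq)
qed

lemma lebesgue_measurable_ae_borel:
  fixes f :: "real \<Rightarrow> 'b::topological_space"
  assumes f': "f' \<in> borel_measurable borel" and eq: "AE x in lborel. f x = f' x"
  shows "f \<in> borel_measurable lebesgue"
proof (rule measurableI)
  fix A :: "'b set" assume "A \<in> sets borel"
  then have "f' -` A \<in> sets lebesgue"
    using f' by (metis measurable_lborel1 measurable_completion measurable_sets_borel sets_completionI_sets sets_lborel)
  moreover have "AE x in lebesgue. x \<in> f' -` A \<longleftrightarrow> x \<in> f -` A"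
    using AE_completion[OF eq] by eventually_elim auto
  ultimately show "f -` A \<inter> space lebesgue \<in> sets lebesgue"
    by (auto intro: completion.in_sets_AE[where A = "f' -` A"])
qed auto

lemma
  fixes f :: "real \<Rightarrow> 'b::{banach, second_countable_topology}"
  assumes f': "f' \<in> borel_measurable borel" and eq: "AE x in lborel. f x = f' x"
  shows lebesgue_integral_ae_borel: "(LINT x|lebesgue. f x) = (LINT x|lborel. f' x)"
    and lebesgue_integrable_ae_borel: "integrable lebesgue f \<longleftrightarrow> integrable lborel f'"
proof -
  have m: "f \<in> borel_measurable lebesgue" "f' \<in> borel_measurable lebesgue"
    using lebesgue_measurable_ae_borel[OF f' eq] f' by (auto intro: measurable_completion)
  have "(LINT x|lebesgue. f x) = (LINT x|lebesgue. f' x)"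
    by (rule integral_cong_AE) (use m AE_completion[OF eq] in auto)
  with f' show "(LINT x|lebesgue. f x) = (LINT x|lborel. f' x)"
    by (simp add: integral_completion)
  have "integrable lebesgue f \<longleftrightarrow> integrable lebesgue f'"
    by (rule integrable_cong_AE) (use m AE_completion[OF eq] in auto)
  with f' show "integrable lebesgue f \<longleftrightarrow> integrable lborel f'"
    by (simp add: integrable_completion)
qed

text \<open>The exceptional set is enclosed in a Borel null set, whose preimage under an affine
  bijection is again null.\<close>
lemma AE_lborel_affine:
  fixes c t :: real
  assumes P: "AE x in lborel. P x" and c: "c \<noteq> 0"
  shows "AE x in lborel. P (t + c * x)"
proof -
  obtain N where N: "\<And>x. x \<in> space lborel - N \<Longrightarrow> P x" "N \<in> null_sets lborel"
    using AE_E3[OF P] by blast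
  have [measurable]: "N \<in> sets borel" using N(2) by auto
  have "AE x in lborel. x \<notin> N" using N(2) by (rule AE_not_in)
  then have "AE x in lborel. t + c * x \<notin> N"
    by (intro AE_borel_affine[OF c, of "\<lambda>x. x \<notin> N"]) auto
  then show ?thesis by eventually_elim (use N(1) in auto)
qed

section \<open>Steep transforms\<close>

text \<open>The only feature of the transform that both halves of the theorem use: its modulus
  decreases in \<open>\<bar>x\<bar>\<close> at least at the exponential rate \<open>s\<close>, relative to its own values rather than
  to a fixed envelope. Comparing values with values is what allows quotients of them to be
  controlled without any knowledge of the size of the product.\<close>
definition steep :: "real \<Rightarrow> (real \<Rightarrow> complex) \<Rightarrow> bool" where
  "steep s K \<longleftrightarrow> (\<forall>x. K x \<noteq> 0) \<and>
     (\<forall>x y. \<bar>x\<bar> \<le> \<bar>y\<bar> \<longrightarrow> cmod (K y) \<le> exp (- s * (\<bar>y\<bar> - \<bar>x\<bar>)) * cmod (K x))"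

text \<open>Each factor satisfies \<open>\<bar>1 + i z\<bar>\<^sup>2 = 1 + z\<^sup>2\<close> and \<open>\<bar>exp (i z)\<bar> = 1\<close>, so the modulus of
  every partial product is nonincreasing in \<open>\<bar>w\<bar>\<close>, and this passes to the limit; the rate
  \<open>1\<close> comes from \<open>exp (- \<bar>w\<bar>)\<close>. The compensating exponentials make each factor
  \<open>1 + O(z\<^sup>2)\<close>, so square summability gives absolute convergence and hence a nonzero product.\<close>
lemma steep_typeII_product:
  assumes v: "summable (\<lambda>j. (v j :: real)\<^sup>2)"
    and K: "\<And>w. K w = of_real (exp (- \<bar>w\<bar>)) *
           (\<Prod>j. inverse (1 + 2 * of_real pi * \<i> * of_real (v j) * of_real w) *
                exp (2 * of_real pi * \<i> * of_real (v j) * of_real w))"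
  shows "steep 1 K"
proof -
  define f where "f w j = inverse (1 + \<i> * of_real (2 * pi * v j * w)) * exp (\<i> * of_real (2 * pi * v j * w))"
    for w :: real and j
  have K': "K w = of_real (exp (- \<bar>w\<bar>)) * prodinf (f w)" for w
    unfolding K f_def by (simp add: mult_ac)
  have nz: "1 + \<i> * of_real z \<noteq> 0" for z :: real
    by (auto simp: complex_eq_iff)
  have fnz: "f w j \<noteq> 0" for w j
    using nz by (simp add: f_def del: of_real_mult)
  have cm: "cmod (f w j) = 1 / sqrt (1 + (2 * pi * v j * w)\<^sup>2)" for w j
  proof -
    have "cmod (1 + \<i> * of_real z) = sqrt (1 + z\<^sup>2)" for z :: real
      by (simp add: cmod_def)
    then show ?thesis
      by (simp add: f_def norm_mult norm_inverse divide_inverse del: of_real_mult)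
  qed
  have b: "norm (f w j - 1) \<le> (2 * pi * w)\<^sup>2 * (v j)\<^sup>2" for w j
  proof -
    define z where "z = 2 * pi * v j * w"
    have "cmod (1 + \<i> * of_real z) \<ge> \<bar>Re (1 + \<i> * of_real z)\<bar>" by (rule abs_Re_le_cmod)
    then have ge1: "cmod (1 + \<i> * of_real z) \<ge> 1" by simp
    have "f w j - 1 = (exp (\<i> * of_real z) - (1 + \<i> * of_real z)) / (1 + \<i> * of_real z)"
      using nz[of z] unfolding f_def z_def[symmetric] by (simp add: field_simps)
    then have "norm (f w j - 1) = norm (exp (\<i> * of_real z) - (1 + \<i> * of_real z)) / norm (1 + \<i> * of_real z)"
      by (simp add: norm_divide)
    also have "\<dots> \<le> norm (exp (\<i> * of_real z) - (1 + \<i> * of_real z))"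
      using ge1 by (simp add: divide_le_eq mult_le_cancel_left1)
    also have "\<dots> \<le> \<bar>z\<bar>^2 / 2"
      using iexp_approx1[of z 1] by (simp add: numeral_2_eq_2)
    also have "\<dots> \<le> z\<^sup>2" by simp
    also have "z\<^sup>2 = (2 * pi * w)\<^sup>2 * (v j)\<^sup>2" by (simp add: z_def power_mult_distrib)
    finally show ?thesis .
  qed
  have conv: "convergent_prod (f w)" for w
  proof (rule abs_convergent_prod_imp_convergent_prod[OF summable_imp_abs_convergent_prod])
    show "summable (\<lambda>i. norm (f w i - 1))"
      by (rule summable_comparison_test[OF _ summable_mult[OF v, of "(2 * pi * w)\<^sup>2"]]) (use b in auto)
  qed
  have lim: "(\<lambda>n. \<Prod>i\<le>n. cmod (f w i)) \<longlonglongrightarrow> cmod (prodinf (f w))" for w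
    using tendsto_norm[OF convergent_prod_LIMSEQ[OF conv[of w]]] by (simp add: prod_norm)
  have mono: "cmod (prodinf (f y)) \<le> cmod (prodinf (f x))" if "\<bar>x\<bar> \<le> \<bar>y\<bar>" for x y
  proof (rule LIMSEQ_le[OF lim lim], intro exI[of _ 0] allI impI prod_mono conjI)
    fix i
    have "x\<^sup>2 \<le> y\<^sup>2" using that by (simp add: abs_le_square_iff)
    then have "(2 * pi * v i * x)\<^sup>2 \<le> (2 * pi * v i * y)\<^sup>2"
      unfolding power_mult_distrib by (intro mult_left_mono) auto
    then show "cmod (f y i) \<le> cmod (f x i)"
      unfolding cm by (intro divide_left_mono mult_pos_pos real_sqrt_le_mono add_left_mono real_sqrt_gt_zero) (auto intro: add_pos_nonneg)
  qed auto
  show ?thesis unfolding steep_def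
  proof (intro conjI allI impI)
    fix w show "K w \<noteq> 0" unfolding K' using prodinf_nonzero[OF conv fnz] by auto
  next
    fix x y :: real assume xy: "\<bar>x\<bar> \<le> \<bar>y\<bar>"
    have "cmod (K y) = exp (-\<bar>y\<bar>) * cmod (prodinf (f y))"
      by (simp add: K' norm_mult)
    also have "\<dots> \<le> exp (-\<bar>y\<bar>) * cmod (prodinf (f x))"
      using mono[OF xy] by simp
    also have "exp (-\<bar>y\<bar>) = exp (- 1 * (\<bar>y\<bar> - \<bar>x\<bar>)) * exp (-\<bar>x\<bar>)"
      by (simp flip: exp_add)
    finally show "cmod (K y) \<le> exp (- 1 * (\<bar>y\<bar> - \<bar>x\<bar>)) * cmod (K x)"
      by (simp add: K' norm_mult mult.assoc)
  qed
qed

text \<open>Spreading a function out by \<open>1 / g\<close> concentrates its transform and multiplies the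
  rate by \<open>1 / g\<close>; as \<open>g\<close> tends to \<open>0\<close> the rate tends to infinity.\<close>
lemma steep_dilate:
  assumes "steep s K" "g > 0" "c \<noteq> 0"
  shows "steep (s / g) (\<lambda>w. K (w / g) * of_real c)"
  unfolding steep_def
proof (intro conjI allI impI)
  fix x y :: real assume "\<bar>x\<bar> \<le> \<bar>y\<bar>"
  then have "\<bar>x / g\<bar> \<le> \<bar>y / g\<bar>" using assms(2) by (simp add: divide_right_mono)
  then have "cmod (K (y / g)) \<le> exp (- s * (\<bar>y / g\<bar> - \<bar>x / g\<bar>)) * cmod (K (x / g))"
    using assms(1) unfolding steep_def by blast
  also have "- s * (\<bar>y / g\<bar> - \<bar>x / g\<bar>) = - (s / g) * (\<bar>y\<bar> - \<bar>x\<bar>)"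
    using assms(2) by (simp add: abs_divide algebra_simps diff_divide_distrib)
  finally show "cmod (K (y / g) * of_real c) \<le> exp (- (s / g) * (\<bar>y\<bar> - \<bar>x\<bar>)) * cmod (K (x / g) * of_real c)"
    by (simp add: norm_mult mult.assoc[symmetric] mult_right_mono)
qed (use assms in \<open>auto simp: steep_def\<close>)

section \<open>Sums over the integers\<close>

abbreviation sq_norm :: "complex \<Rightarrow> ennreal" where
  "sq_norm z \<equiv> ennreal ((cmod z)\<^sup>2)"

lemma sum_le_nn_integral_count_space:
  fixes f :: "'a \<Rightarrow> ennreal"
  assumes "finite F"
  shows "sum f F \<le> (\<integral>\<^sup>+x. f x \<partial>count_space UNIV)"
proof -
  have "sum f F = (\<integral>\<^sup>+x. f x * indicator F x \<partial>count_space UNIV)"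
    using assms by (simp add: nn_integral_count_space_indicator[symmetric] nn_integral_count_space_finite)
  also have "\<dots> \<le> (\<integral>\<^sup>+x. f x \<partial>count_space UNIV)"
    by (intro nn_integral_mono) (auto simp: indicator_def)
  finally show ?thesis .
qed

text \<open>Unordered sums in the extended nonnegative reals become integrals over counting
  measure, for which monotone convergence and Tonelli are available.\<close>
lemma infsum_ennreal_eq_nn_integral:
  fixes f :: "'a::countable \<Rightarrow> ennreal"
  assumes inf: "infinite (UNIV :: 'a set)"
  shows "(\<Sum>\<^sub>\<infinity>x\<in>UNIV. f x) = (\<integral>\<^sup>+x. f x \<partial>count_space UNIV)"
proof (rule antisym)
  show "(\<Sum>\<^sub>\<infinity>x\<in>UNIV. f x) \<le> (\<integral>\<^sup>+x. f x \<partial>count_space UNIV)"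
    by (subst nonneg_infsum_complete) (auto intro: SUP_least sum_le_nn_integral_count_space)
next
  define e where "e = from_nat_into (UNIV :: 'a set)"
  have e: "bij_betw e UNIV UNIV"
    unfolding e_def by (rule bij_betw_from_nat_into[OF _ inf]) auto
  have "(\<integral>\<^sup>+x. f x \<partial>count_space UNIV) = (\<Sum>n. f (e n))"
    by (simp add: nn_integral_bij_count_space[symmetric, OF e] nn_integral_count_space_nat)
  also have "\<dots> = (SUP n. sum f (e ` {..<n}))"
    using bij_betw_imp_inj_on[OF e]
    by (subst suminf_eq_SUP) (auto simp: sum.reindex inj_on_subset)
  also have "\<dots> \<le> (\<Sum>\<^sub>\<infinity>x\<in>UNIV. f x)"
    by (subst nonneg_infsum_complete) (auto intro!: SUP_least intro: SUP_upper)
  finally show "(\<integral>\<^sup>+x. f x \<partial>count_space UNIV) \<le> (\<Sum>\<^sub>\<infinity>x\<in>UNIV. f x)" .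
qed

lemma nn_integral_count_space_le:
  fixes f :: "'a::countable \<Rightarrow> ennreal"
  assumes inf: "infinite (UNIV :: 'a set)" and le: "\<And>F. finite F \<Longrightarrow> sum f F \<le> c"
  shows "(\<integral>\<^sup>+x. f x \<partial>count_space UNIV) \<le> c"
  unfolding infsum_ennreal_eq_nn_integral[OF inf, symmetric]
  by (subst nonneg_infsum_complete) (auto intro: SUP_least le)

abbreviation zcount :: "int measure" where
  "zcount \<equiv> count_space UNIV"

text \<open>Reduces a sum over the integers to two ordinary series, which settles measurability
  in a parameter and evaluates geometric sums.\<close>
lemma nn_integral_int_eq_suminf:
  fixes f :: "int \<Rightarrow> ennreal"
  shows "(\<integral>\<^sup>+l. f l \<partial>zcount) = (\<Sum>n. f (int n)) + (\<Sum>n. f (- int n - 1))"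
proof -
  have b1: "bij_betw int UNIV {0..}"
    by (rule bij_betw_byWitness[where f' = nat]) auto
  have b2: "bij_betw (\<lambda>n. - int n - 1) UNIV {..<0}"
    by (rule bij_betw_byWitness[where f' = "\<lambda>l. nat (- l - 1)"]) auto
  have "(\<integral>\<^sup>+l. f l \<partial>zcount) =
      (\<integral>\<^sup>+l. f l * indicator {0..} l + f l * indicator {..<0} l \<partial>zcount)"
    by (intro nn_integral_cong) (auto simp: indicator_def)
  also have "\<dots> = (\<integral>\<^sup>+l. f l \<partial>count_space {0..}) + (\<integral>\<^sup>+l. f l \<partial>count_space {..<0})"
    by (simp add: nn_integral_add nn_integral_count_space_indicator)
  also have "\<dots> = (\<Sum>n. f (int n)) + (\<Sum>n. f (- int n - 1))"
    by (simp add: nn_integral_bij_count_space[OF b1, symmetric]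
        nn_integral_bij_count_space[OF b2, symmetric] nn_integral_count_space_nat)
  finally show ?thesis .
qed

lemma borel_measurable_nn_integral_int:
  fixes f :: "int \<Rightarrow> 'a \<Rightarrow> ennreal"
  assumes [measurable]: "\<And>l. f l \<in> borel_measurable M"
  shows "(\<lambda>x. \<integral>\<^sup>+l. f l x \<partial>zcount) \<in> borel_measurable M"
  unfolding nn_integral_int_eq_suminf by measurable

lemma nn_integral_int_geometric:
  assumes q: "0 \<le> q" "q < 1"
  shows "(\<integral>\<^sup>+l. ennreal (q ^ nat \<bar>l\<bar>) \<partial>zcount) = ennreal ((1 + q) / (1 - q))"
proof -
  have a: "(\<Sum>n. ennreal (q ^ n)) = ennreal (1 / (1 - q))"
  proof -
    have "(\<Sum>n. ennreal (q ^ n)) = ennreal (\<Sum>n. q ^ n)"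
      by (rule suminf_ennreal2) (use q in \<open>auto intro: summable_geometric\<close>)
    then show ?thesis using suminf_geometric[of q] q by simp
  qed
  have "(\<Sum>n. ennreal (q ^ Suc n)) = ennreal q * (\<Sum>n. ennreal (q ^ n))"
    by (subst ennreal_suminf_cmult[symmetric]) (use q in \<open>simp add: ennreal_mult\<close>)
  also have "\<dots> = ennreal (q / (1 - q))"
    unfolding a using q by (simp add: ennreal_mult[symmetric])
  finally have b: "(\<Sum>n. ennreal (q ^ Suc n)) = ennreal (q / (1 - q))" .
  have n: "nat \<bar>int n\<bar> = n" "nat \<bar>- int n - 1\<bar> = Suc n" for n by simp_all
  show ?thesis
    unfolding nn_integral_int_eq_suminf n a b
    by (subst ennreal_plus[symmetric]) (use q in \<open>auto simp: add_divide_distrib\<close>)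
qed

lemma steep_le:
  assumes "steep s K" "\<bar>x\<bar> \<le> \<bar>y\<bar>" "s \<ge> 0"
  shows "cmod (K y) \<le> cmod (K x)"
proof -
  have "cmod (K y) \<le> exp (- s * (\<bar>y\<bar> - \<bar>x\<bar>)) * cmod (K x)"
    using assms unfolding steep_def by blast
  also have "\<dots> \<le> 1 * cmod (K x)"
    using assms by (intro mult_right_mono) auto
  finally show ?thesis by simp
qed

section \<open>The limit of the quotient\<close>

text \<open>The quotient is the weighted mean of the squares \<open>(w + l \<alpha>)\<^sup>2\<close> with weights
  \<open>\<bar>K (w + l \<alpha>)\<bar>\<^sup>2\<close>. The smallest of these squares is \<open>d\<^sup>2\<close>, where \<open>d\<close> is the distance of
  \<open>w\<close> to \<open>\<alpha> \<int>\<close>, and this is the lower bound. For the upper bound, a point whose modulus exceeds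
  \<open>d\<close> by \<open>t\<close> has weight at most \<open>exp (- 2 s t)\<close> times that of the nearest point and contributes
  an excess of at most \<open>t (t + \<alpha>)\<close>; since \<open>s t exp (- s t) \<le> 1\<close>, the total excess is
  \<open>O(1 / s)\<close> uniformly in \<open>w\<close>.\<close>
lemma ratio_bounds:
  fixes K :: "real \<Rightarrow> complex"
  assumes K: "steep s K" and s: "s \<ge> 1" and \<alpha>: "\<alpha> > 0" and w: "0 \<le> w" "w \<le> \<alpha>"
  defines "N \<equiv> \<integral>\<^sup>+l. ennreal ((w + of_int l * \<alpha>)\<^sup>2 * (cmod (K (w + of_int l * \<alpha>)))\<^sup>2) \<partial>zcount"
    and "D \<equiv> \<integral>\<^sup>+l. sq_norm (K (w + of_int l * \<alpha>)) \<partial>zcount"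
    and "C \<equiv> (2 + \<alpha>) * exp (3 * \<alpha> / 4) * ((1 + exp (- \<alpha> / 2)) / (1 - exp (- \<alpha> / 2)))"
  shows "ennreal ((min w (\<alpha> - w))\<^sup>2) \<le> N / D" "N / D \<le> ennreal (\<alpha>\<^sup>2 / 4 + C / s)"
proof -
  define d where "d = min w (\<alpha> - w)"
  define x where "x l = w + of_int l * \<alpha>" for l
  define t where "t l = \<bar>x l\<bar> - d" for l
  define q where "q = exp (- \<alpha> / 2)"
  define Q where "Q = (1 + q) / (1 - q)"
  have d: "0 \<le> d" "d \<le> \<alpha> / 2" using w by (auto simp: d_def min_def)
  have q: "0 < q" "q < 1" using \<alpha> by (auto simp: q_def)
  have Q: "0 \<le> Q" using q by (simp add: Q_def)
  have xl: "\<bar>x l\<bar> \<ge> \<bar>of_int l\<bar> * \<alpha> - \<alpha>" for l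
  proof -
    have "\<bar>of_int l * \<alpha>\<bar> \<le> \<bar>x l\<bar> + \<bar>w\<bar>" by (simp add: x_def)
    then show ?thesis using w \<alpha> by (simp add: abs_mult)
  qed
  have t0: "t l \<ge> 0" for l
  proof (cases "l \<ge> 0")
    case True
    then have "x l \<ge> w" using \<alpha> by (simp add: x_def)
    then show ?thesis using w by (auto simp: t_def d_def)
  next
    case False
    then have "of_int l * \<alpha> \<le> (-1) * \<alpha>" using \<alpha> by (intro mult_right_mono) auto
    then have "x l \<le> w - \<alpha>" by (simp add: x_def)
    then show ?thesis using w by (auto simp: t_def d_def)
  qed
  \<comment> \<open>One of the two neighbours of \<open>w\<close> in \<open>\<alpha> \<int>\<close> realizes the distance \<open>d\<close>.\<close>
  obtain l0 where l0: "\<bar>x l0\<bar> = d"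
  proof (cases "w \<le> \<alpha> - w")
    case True then show ?thesis using w by (intro that[of 0]) (auto simp: x_def d_def)
  next
    case False then show ?thesis using w by (intro that[of "-1"]) (auto simp: x_def d_def)
  qed
  \<comment> \<open>Since \<open>t l \<ge> \<bar>l\<bar> \<alpha> - 3 \<alpha> / 2\<close>, the decay in \<open>t l\<close> is geometric decay in \<open>l\<close>.\<close>
  have tl: "exp (- t l / 2) \<le> exp (3 * \<alpha> / 4) * q ^ nat \<bar>l\<bar>" for l
  proof -
    have "- t l / 2 \<le> 3 * \<alpha> / 4 + real (nat \<bar>l\<bar>) * (- \<alpha> / 2)"
      using xl[of l] d by (simp add: t_def field_simps)
    then have "exp (- t l / 2) \<le> exp (3 * \<alpha> / 4 + real (nat \<bar>l\<bar>) * (- \<alpha> / 2))"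
      by simp
    also have "\<dots> = exp (3 * \<alpha> / 4) * q ^ nat \<bar>l\<bar>"
      unfolding exp_add exp_of_nat_mult q_def by simp
    finally show ?thesis .
  qed
  define k0 where "k0 = (cmod (K (x l0)))\<^sup>2"
  have K2: "(cmod (K (x l)))\<^sup>2 \<le> exp (- 2 * s * t l) * k0" for l
  proof -
    have "cmod (K (x l)) \<le> exp (- s * t l) * cmod (K (x l0))"
      using K l0 t0[of l] unfolding steep_def t_def by (metis diff_ge_0_iff_ge)
    then have "(cmod (K (x l)))\<^sup>2 \<le> (exp (- s * t l) * cmod (K (x l0)))\<^sup>2"
      by (intro power_mono) auto
    also have "\<dots> = exp (- 2 * s * t l) * k0"
      by (simp add: power_mult_distrib k0_def exp_double[symmetric] mult.assoc)
    finally show ?thesis .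
  qed
  have k0: "k0 > 0" using K by (simp add: k0_def steep_def)
  have st: "t l \<le> s * t l" for l using s t0[of l] by (simp add: mult_le_cancel_right1)
  have geo: "(\<integral>\<^sup>+l. ennreal (q ^ nat \<bar>l\<bar>) \<partial>zcount) = ennreal Q"
    unfolding Q_def by (rule nn_integral_int_geometric) (use q in auto)
  have Dfin: "D < top"
  proof -
    have "D \<le> (\<integral>\<^sup>+l. ennreal (k0 * exp (3 * \<alpha> / 4)) * ennreal (q ^ nat \<bar>l\<bar>) \<partial>zcount)"
      unfolding D_def x_def[symmetric]
    proof (rule nn_integral_mono)
      fix l
      \<comment> \<open>Only a crude bound is needed for finiteness of the denominator.\<close>
      have "exp (- 2 * s * t l) \<le> exp (- t l / 2)" using st[of l] t0[of l] by simp
      also note tl[of l]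
      finally have "exp (- 2 * s * t l) * k0 \<le> (exp (3 * \<alpha> / 4) * q ^ nat \<bar>l\<bar>) * k0"
        using k0 by (intro mult_right_mono) auto
      with K2[of l] have "(cmod (K (x l)))\<^sup>2 \<le> (k0 * exp (3 * \<alpha> / 4)) * q ^ nat \<bar>l\<bar>"
        by (simp add: mult_ac)
      then show "sq_norm (K (x l)) \<le> ennreal (k0 * exp (3 * \<alpha> / 4)) * ennreal (q ^ nat \<bar>l\<bar>)"
        using k0 q by (simp add: ennreal_mult[symmetric])
    qed
    also have "\<dots> < top"
      by (subst nn_integral_cmult) (auto simp: geo ennreal_mult_less_top)
    finally show ?thesis .
  qed
  have Dk0: "ennreal k0 \<le> D"
    using sum_le_nn_integral_count_space[of "{l0}" "\<lambda>l. sq_norm (K (x l))"]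
    by (simp add: k0_def D_def x_def)
  then have D0: "D > 0" using k0 by (metis ennreal_eq_0_iff leD not_gr_zero)
  have "ennreal (d\<^sup>2) * D = (\<integral>\<^sup>+l. ennreal (d\<^sup>2 * (cmod (K (x l)))\<^sup>2) \<partial>zcount)"
    unfolding D_def x_def[symmetric] by (subst nn_integral_cmult[symmetric]) (auto simp: ennreal_mult)
  also have "\<dots> \<le> N"
    unfolding N_def x_def[symmetric]
  proof (intro nn_integral_mono ennreal_leI mult_right_mono)
    fix l show "d\<^sup>2 \<le> (x l)\<^sup>2" using t0[of l] d by (simp add: t_def abs_le_square_iff[symmetric])
  qed auto
  finally have "ennreal (d\<^sup>2) * D / D \<le> N / D"
    by (rule divide_right_mono_ennreal)
  moreover have "ennreal (d\<^sup>2) * D / D = ennreal (d\<^sup>2)"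
    using D0 Dfin by (intro mult_divide_eq_ennreal) auto
  ultimately show "ennreal ((min w (\<alpha> - w))\<^sup>2) \<le> N / D"
    by (simp add: d_def)
  have "N \<le> (\<integral>\<^sup>+l. ennreal (d\<^sup>2) * sq_norm (K (x l))
          + ennreal ((2 + \<alpha>) / s * exp (3 * \<alpha> / 4) * k0) * ennreal (q ^ nat \<bar>l\<bar>) \<partial>zcount)"
    unfolding N_def x_def[symmetric]
  proof (rule nn_integral_mono)
    fix l
    have "(x l)\<^sup>2 = \<bar>x l\<bar>\<^sup>2" by simp
    also have "\<bar>x l\<bar> = t l + d" by (simp add: t_def)
    finally have "(x l)\<^sup>2 - d\<^sup>2 = t l * (t l + 2 * d)" by (simp add: power2_eq_square algebra_simps)
    also have "\<dots> \<le> t l * (t l + \<alpha>)" using t0[of l] d by (intro mult_left_mono) auto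
    finally have 1: "(x l)\<^sup>2 - d\<^sup>2 \<le> t l * (t l + \<alpha>)" .
    have 2: "t l * exp (- 2 * s * t l) \<le> exp (- t l) / s"
    proof -
      have "s * t l \<le> exp (s * t l)" using exp_ge_add_one_self[of "s * t l"] by linarith
      then have "s * t l * exp (- 2 * s * t l) \<le> exp (s * t l) * exp (- 2 * s * t l)"
        by (intro mult_right_mono) auto
      also have "\<dots> = exp (- (s * t l))" by (simp flip: exp_add)
      also have "\<dots> \<le> exp (- t l)" using st[of l] by simp
      finally show ?thesis using s by (simp add: field_simps)
    qed
    \<comment> \<open>Half of the exponential absorbs the remaining linear factor.\<close>
    have 3: "(t l + \<alpha>) * exp (- t l) \<le> (2 + \<alpha>) * exp (- t l / 2)"
    proof -
      have "t l \<le> 2 * exp (t l / 2)" using exp_ge_add_one_self[of "t l / 2"] by linarith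
      moreover have "\<alpha> \<le> \<alpha> * exp (t l / 2)" using \<alpha> t0[of l] by simp
      ultimately have "(t l + \<alpha>) * exp (- t l) \<le> ((2 + \<alpha>) * exp (t l / 2)) * exp (- t l)"
        by (intro mult_right_mono) (auto simp: algebra_simps)
      also have "\<dots> = (2 + \<alpha>) * exp (- t l / 2)" by (simp add: mult.assoc flip: exp_add)
      finally show ?thesis .
    qed
    have "((x l)\<^sup>2 - d\<^sup>2) * (cmod (K (x l)))\<^sup>2 \<le> (t l * (t l + \<alpha>)) * (exp (- 2 * s * t l) * k0)"
      using 1 K2[of l] t0[of l] \<alpha> by (intro mult_mono) auto
    also have "\<dots> = (t l * exp (- 2 * s * t l)) * ((t l + \<alpha>) * k0)" by simp
    also have "\<dots> \<le> (exp (- t l) / s) * ((t l + \<alpha>) * k0)"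
      using 2 t0[of l] \<alpha> k0 by (intro mult_right_mono) auto
    also have "\<dots> = ((t l + \<alpha>) * exp (- t l)) * (k0 / s)" by simp
    also have "\<dots> \<le> ((2 + \<alpha>) * exp (- t l / 2)) * (k0 / s)"
      using 3 k0 s by (intro mult_right_mono) auto
    also have "\<dots> \<le> ((2 + \<alpha>) * (exp (3 * \<alpha> / 4) * q ^ nat \<bar>l\<bar>)) * (k0 / s)"
      using tl[of l] k0 s \<alpha> by (intro mult_right_mono mult_left_mono) auto
    finally have "(x l)\<^sup>2 * (cmod (K (x l)))\<^sup>2 \<le>
        d\<^sup>2 * (cmod (K (x l)))\<^sup>2 + ((2 + \<alpha>) / s * exp (3 * \<alpha> / 4) * k0) * q ^ nat \<bar>l\<bar>"
      by (simp add: algebra_simps add_divide_distrib)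
    then show "ennreal ((x l)\<^sup>2 * (cmod (K (x l)))\<^sup>2) \<le> ennreal (d\<^sup>2) * sq_norm (K (x l))
          + ennreal ((2 + \<alpha>) / s * exp (3 * \<alpha> / 4) * k0) * ennreal (q ^ nat \<bar>l\<bar>)"
      using \<alpha> s k0 q by (simp add: ennreal_mult[symmetric] ennreal_plus[symmetric] del: ennreal_plus)
  qed
  also have "\<dots> = ennreal (d\<^sup>2) * D + ennreal ((2 + \<alpha>) / s * exp (3 * \<alpha> / 4) * k0) * ennreal Q"
    by (simp add: nn_integral_add nn_integral_cmult geo D_def x_def)
  also have "ennreal ((2 + \<alpha>) / s * exp (3 * \<alpha> / 4) * k0) * ennreal Q = ennreal (C / s) * ennreal k0"
    using \<alpha> s k0 Q by (simp add: ennreal_mult[symmetric] C_def Q_def q_def mult_ac)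
  also have "ennreal (d\<^sup>2) * D + \<dots> \<le> ennreal (\<alpha>\<^sup>2 / 4) * D + ennreal (C / s) * D"
  proof (intro add_mono mult_mono ennreal_leI Dk0)
    show "d\<^sup>2 \<le> \<alpha>\<^sup>2 / 4" using power_mono[OF d(2) d(1), of 2] by (simp add: power_divide)
  qed auto
  also have "\<dots> = ennreal (\<alpha>\<^sup>2 / 4 + C / s) * D"
    using \<alpha> s Q by (simp add: distrib_right ennreal_plus C_def Q_def q_def)
  finally have "N / D \<le> ennreal (\<alpha>\<^sup>2 / 4 + C / s) * D / D"
    by (rule divide_right_mono_ennreal)
  also have "\<dots> = ennreal (\<alpha>\<^sup>2 / 4 + C / s)"
    using D0 Dfin by (intro mult_divide_eq_ennreal) auto
  finally show "N / D \<le> ennreal (\<alpha>\<^sup>2 / 4 + C / s)" .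
qed


lemma fourier_eq_lborel:
  assumes "f' \<in> borel_measurable borel" "AE x in lborel. f x = f' x"
  shows "fourier f w = (LINT x|lborel. f' x * exp (- 2 * of_real pi * \<i> * of_real w * of_real x))"
  unfolding fourier_def
  by (rule lebesgue_integral_ae_borel) (use assms in \<open>auto elim: eventually_mono\<close>)

lemma borel_measurable_fourier:
  assumes [measurable]: "f' \<in> borel_measurable borel" and "AE x in lborel. f x = f' x"
  shows "fourier f \<in> borel_measurable borel"
  unfolding fourier_eq_lborel[OF assms]
  by (rule lborel.borel_measurable_lebesgue_integral) measurable

lemma fourier_dilate:
  assumes f': "f' \<in> borel_measurable borel" "AE x in lborel. f x = f' x" and g: "g > 0"
  shows "fourier (dilate g f) w = fourier f (w / g) * of_real (1 / sqrt g)"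
proof -
  define h where "h y = f' y * exp (- 2 * of_real pi * \<i> * of_real (w / g) * of_real y)" for y
  note [measurable] = f'(1)
  have "AE x in lborel. f (0 + g * x) = f' (0 + g * x)"
    by (rule AE_lborel_affine) (use f' g in auto)
  then have "fourier (dilate g f) w =
      (LINT x|lborel. (of_real (sqrt g) * f' (g * x)) * exp (- 2 * of_real pi * \<i> * of_real w * of_real x))"
    by (intro fourier_eq_lborel) (auto simp: dilate_def elim!: eventually_mono)
  also have "\<dots> = (LINT x|lborel. of_real (sqrt g) * h (0 + g * x))"
    using g by (intro Bochner_Integration.integral_cong) (auto simp: h_def mult.assoc)
  also have "\<dots> = of_real (sqrt g) * (LINT x|lborel. h (0 + g * x))"
    by simp
  also have "(LINT x|lborel. h (0 + g * x)) = (1 / g) *\<^sub>R (LINT x|lborel. h x)"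
    using lborel_integral_real_affine[of g h 0] g by simp
  also have "(LINT x|lborel. h x) = fourier f (w / g)"
    unfolding fourier_eq_lborel[OF f'] h_def ..
  also have "of_real (sqrt g) * ((1 / g) *\<^sub>R fourier f (w / g)) = fourier f (w / g) * of_real (1 / sqrt g)"
    using g by (simp add: scaleR_conv_of_real field_simps flip: of_real_mult)
  finally show ?thesis .
qed

text \<open>The lower bound does not depend on the rate: near \<open>\<alpha> / 2\<close> the squared distance to
  \<open>\<alpha> \<int>\<close> comes arbitrarily close to \<open>\<alpha>\<^sup>2 / 4\<close> on sets of positive measure.\<close>
lemma M_const_bounds:
  assumes K: "steep s (fourier f)" and m: "fourier f \<in> borel_measurable borel"
    and s: "s \<ge> 1" and \<alpha>: "\<alpha> > 0"
  defines "C \<equiv> (2 + \<alpha>) * exp (3 * \<alpha> / 4) * ((1 + exp (- \<alpha> / 2)) / (1 - exp (- \<alpha> / 2)))"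
  shows "ennreal (\<alpha>\<^sup>2 / 4) \<le> M_const f (1 / \<alpha>)" "M_const f (1 / \<alpha>) \<le> ennreal (\<alpha>\<^sup>2 / 4 + C / s)"
proof -
  define R where "R w =
     (\<integral>\<^sup>+l. ennreal ((w + of_int l * \<alpha>)\<^sup>2 * (cmod (fourier f (w + of_int l * \<alpha>)))\<^sup>2) \<partial>zcount) /
     (\<integral>\<^sup>+l. sq_norm (fourier f (w + of_int l * \<alpha>)) \<partial>zcount)" for w
  have M: "M_const f (1 / \<alpha>) = esssup (lebesgue_on {0..\<alpha>}) R"
    by (simp add: M_const_def R_def[abs_def] infsum_ennreal_eq_nn_integral)
  note [measurable] = m
  have "R \<in> borel_measurable borel"
    unfolding R_def[abs_def] by (intro borel_measurable_divide_ennreal borel_measurable_nn_integral_int) measurable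
  then have "R \<in> borel_measurable lebesgue" by (auto intro: measurable_completion)
  then have Rm: "R \<in> borel_measurable (lebesgue_on {0..\<alpha>})"
    by (rule measurable_restrict_space1)
  show "M_const f (1 / \<alpha>) \<le> ennreal (\<alpha>\<^sup>2 / 4 + C / s)"
    unfolding M
  proof (rule esssup_I[OF Rm], rule AE_I2)
    fix w assume "w \<in> space (lebesgue_on {0..\<alpha>})"
    then have "0 \<le> w" "w \<le> \<alpha>" by auto
    from ratio_bounds(2)[OF K s \<alpha> this] show "R w \<le> ennreal (\<alpha>\<^sup>2 / 4 + C / s)"
      unfolding R_def C_def .
  qed
  show "ennreal (\<alpha>\<^sup>2 / 4) \<le> M_const f (1 / \<alpha>)"
  proof (rule ccontr)
    assume "\<not> ?thesis"
    then have less: "esssup (lebesgue_on {0..\<alpha>}) R < ennreal (\<alpha>\<^sup>2 / 4)" by (simp add: M)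
    then obtain m where m: "m \<ge> 0" "esssup (lebesgue_on {0..\<alpha>}) R = ennreal m"
      by (cases "esssup (lebesgue_on {0..\<alpha>}) R") auto
    with less have "m < (\<alpha> / 2)\<^sup>2" by (simp add: power_divide ennreal_less_iff)
    then have a: "sqrt m < \<alpha> / 2" using \<alpha> by (intro real_less_lsqrt) auto
    have "AE w in lebesgue_on {0..\<alpha>}. R w \<le> ennreal m"
      using esssup_AE[of R "lebesgue_on {0..\<alpha>}"] m by simp
    then have "AE w in lebesgue. w \<in> {0..\<alpha>} \<longrightarrow> R w \<le> ennreal m"
      by (simp add: AE_restrict_space_iff)
    then have "AE w in lborel. w \<in> {0..\<alpha>} \<longrightarrow> R w \<le> ennreal m"
      by (simp add: AE_completion_iff)
    \<comment> \<open>On this interval \<open>w\<close> is its own distance to \<open>\<alpha> \<int>\<close>, and its square exceeds \<open>m\<close>.\<close>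
    then have "AE w in lborel. w \<notin> {sqrt m<..<\<alpha> / 2}"
    proof eventually_elim
      fix w assume w: "w \<in> {0..\<alpha>} \<longrightarrow> R w \<le> ennreal m"
      show "w \<notin> {sqrt m<..<\<alpha> / 2}"
      proof
        assume "w \<in> {sqrt m<..<\<alpha> / 2}"
        then have w2: "sqrt m < w" "w < \<alpha> / 2" by auto
        moreover have "0 \<le> sqrt m" using m by simp
        ultimately have w3: "0 \<le> w" "w \<le> \<alpha>" "min w (\<alpha> - w) = w" by linarith+
        have "ennreal (w\<^sup>2) \<le> R w"
          using ratio_bounds(1)[OF K s \<alpha> w3(1,2)] unfolding R_def w3(3) .
        also have "\<dots> \<le> ennreal m" using w w3 by auto
        finally have "w\<^sup>2 \<le> m" using m by simp
        then have "w \<le> sqrt m" by (simp add: real_le_rsqrt)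
        then show False using w2 by simp
      qed
    qed
    then have "emeasure lborel {sqrt m<..<\<alpha> / 2} = 0"
      by (subst (asm) AE_iff_measurable[of "{sqrt m<..<\<alpha> / 2}"]) auto
    then show False using a by simp
  qed
qed

lemma M_const_dilate_limit:
  assumes f': "f' \<in> borel_measurable borel" "AE x in lborel. f x = f' x"
    and K: "steep 1 (fourier f)" and \<alpha>: "\<alpha> > 0"
  shows "((\<lambda>\<gamma>. M_const (dilate \<gamma> f) (1 / \<alpha>)) \<longlongrightarrow> ennreal (\<alpha>\<^sup>2 / 4)) (at_right 0)"
proof -
  define C where "C = (2 + \<alpha>) * exp (3 * \<alpha> / 4) * ((1 + exp (- \<alpha> / 2)) / (1 - exp (- \<alpha> / 2)))"
  have "ennreal (\<alpha>\<^sup>2 / 4) \<le> M_const (dilate g f) (1 / \<alpha>) \<and>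
      M_const (dilate g f) (1 / \<alpha>) \<le> ennreal (\<alpha>\<^sup>2 / 4 + C * g)" if g: "0 < g" "g < 1" for g
  proof -
    have eq: "fourier (dilate g f) = (\<lambda>w. fourier f (w / g) * of_real (1 / sqrt g))"
      by (rule ext, rule fourier_dilate[OF f' g(1)])
    have "steep (1 / g) (fourier (dilate g f))"
      unfolding eq by (rule steep_dilate[OF K g(1)]) (use g in auto)
    moreover have "fourier (dilate g f) \<in> borel_measurable borel"
      unfolding eq using borel_measurable_fourier[OF f'] by measurable
    ultimately show ?thesis
      using M_const_bounds[of "1 / g" "dilate g f" \<alpha>] g \<alpha> by (simp add: C_def)
  qed
  then have ev: "eventually (\<lambda>g. ennreal (\<alpha>\<^sup>2 / 4) \<le> M_const (dilate g f) (1 / \<alpha>) \<and>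
      M_const (dilate g f) (1 / \<alpha>) \<le> ennreal (\<alpha>\<^sup>2 / 4 + C * g)) (at_right 0)"
    unfolding eventually_at_right_field by (intro exI[of _ 1]) auto
  have "((\<lambda>g. \<alpha>\<^sup>2 / 4 + C * g) \<longlongrightarrow> \<alpha>\<^sup>2 / 4 + C * 0) (at_right 0)"
    by (intro tendsto_intros)
  then have lim: "((\<lambda>g. ennreal (\<alpha>\<^sup>2 / 4 + C * g)) \<longlongrightarrow> ennreal (\<alpha>\<^sup>2 / 4)) (at_right 0)"
    by (intro tendsto_ennrealI) simp
  show ?thesis
    by (rule tendsto_sandwich[OF _ _ tendsto_const lim]) (use ev in \<open>auto elim: eventually_mono\<close>)
qed

section \<open>Parseval's identity on the unit interval\<close>

text \<open>A measurable function is an almost everywhere limit of continuous functions;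
  projecting these onto the closed disc of radius \<open>R\<close> keeps them continuous and makes dominated
  convergence applicable.\<close>
lemma bounded_borel_ae_limit_continuous:
  fixes u :: "real \<Rightarrow> complex"
  assumes u: "u \<in> borel_measurable borel" and R: "\<And>x. cmod (u x) \<le> R"
  shows "\<exists>q :: nat \<Rightarrow> real \<Rightarrow> complex. (\<forall>n. continuous_on UNIV (q n)) \<and>
    (\<forall>n x. cmod (q n x) \<le> R) \<and> (AE x in lborel. (\<lambda>n. q n x) \<longlonglongrightarrow> u x)"
proof -
  have "u \<in> borel_measurable (lebesgue_on UNIV)"
    by (rule measurable_restrict_space1) (use u in \<open>auto intro: measurable_completion\<close>)
  then have "u measurable_on UNIV"
    by (subst measurable_on_iff_borel_measurable) auto
  then obtain N g where N: "negligible N" and g: "\<And>n. continuous_on UNIV (g n)"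
      and lim: "\<And>x. x \<notin> N \<Longrightarrow> (\<lambda>n. g n x) \<longlonglongrightarrow> u x"
    unfolding measurable_on_def by auto
  define B where "B = cball (0::complex) R"
  have uB: "u x \<in> B" for x using R by (simp add: B_def)
  then have "B \<noteq> {}" by blast
  moreover have "convex B" "closed B" by (simp_all add: B_def)
  ultimately have B: "convex B" "closed B" "B \<noteq> {}" by blast+
  have c: "continuous_on UNIV (closest_point B)"
    using B by (rule continuous_on_closest_point)
  show ?thesis
  proof (intro exI[of _ "\<lambda>n x. closest_point B (g n x)"] conjI allI)
    show "continuous_on UNIV (\<lambda>x. closest_point B (g n x))" for n
      by (rule continuous_on_compose2[OF c g]) auto
    show "cmod (closest_point B (g n x)) \<le> R" for n x
      using closest_point_in_set[OF B(2,3), of "g n x"] by (simp add: B_def)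
    have "AE x in lebesgue. x \<notin> N"
      using N by (intro AE_not_in) (simp add: negligible_iff_null_sets)
    then have "AE x in lborel. x \<notin> N" by (simp add: AE_completion_iff)
    then show "AE x in lborel. (\<lambda>n. closest_point B (g n x)) \<longlonglongrightarrow> u x"
    proof eventually_elim
      fix x assume "x \<notin> N"
      have "isCont (closest_point B) (u x)" by (rule continuous_at_closest_point[OF B])
      from isCont_tendsto_compose[OF this lim[OF \<open>x \<notin> N\<close>]]
      show "(\<lambda>n. closest_point B (g n x)) \<longlonglongrightarrow> u x"
        using closest_point_self[OF uB] by simp
    qed
  qed
qed

lemma borel_measurable_cnj[measurable (raw)]:
  "f \<in> borel_measurable M \<Longrightarrow> (\<lambda>x. cnj (f x)) \<in> borel_measurable M"
  by (rule measurable_compose[OF _ borel_measurable_continuous_onI]) (auto intro: continuous_intros)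

definition character :: "int \<Rightarrow> real \<Rightarrow> complex" where
  "character m x = cis (2 * pi * of_int m * x)"

lemma character_simps: "character 0 x = 1" "cnj (character m x) = character (- m) x" "character m x * character n x = character (m + n) x"
    "cmod (character m x) = 1"
  by (simp_all add: character_def cis_cnj cis_mult algebra_simps)

lemma character_periodic: "character m (x + of_int n) = character m x"
proof -
  have "character m (x + of_int n) = character m x * cis (2 * pi * of_int (m * n))"
    by (simp add: character_def cis_mult algebra_simps)
  also have "cis (2 * pi * of_int (m * n)) = 1"
    by (rule cis_multiple_2pi) simp
  finally show ?thesis by simp
qed

lemma borel_measurable_character[measurable]: "character m \<in> borel_measurable borel"
  unfolding character_def[abs_def] by (intro borel_measurable_continuous_onI continuous_intros)

abbreviation unit_interval :: "real measure" where
  "unit_interval \<equiv> restrict_space lborel {0..1}"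

lemma finite_measure_unit_interval: "finite_measure unit_interval"
  by (rule finite_measureI) (auto simp: emeasure_restrict_space space_restrict_space)

lemma integrable_unit_interval:
  fixes f :: "real \<Rightarrow> 'a::{banach, second_countable_topology}"
  assumes "f \<in> borel_measurable borel" and "\<And>x. norm (f x) \<le> R"
  shows "integrable unit_interval f"
proof (rule finite_measure.integrable_const_bound[OF finite_measure_unit_interval])
  show "f \<in> borel_measurable unit_interval"
    using assms(1) by (intro measurable_restrict_space1) simp
qed (use assms(2) in auto)

lemma integral_character: "(\<integral>x. character m x \<partial>unit_interval) = of_bool (m = 0)"
proof (cases "m = 0")
  case True
  then show ?thesis by (simp add: character_simps measure_restrict_space space_restrict_space)
next
  case False
  define c where "c = \<i> * of_real (2 * pi * of_int m)"
  have c: "c \<noteq> 0" using False by (simp add: c_def)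
  have character: "character m x = exp (c * of_real x)" for x
    by (simp add: character_def cis_conv_exp c_def mult_ac)
  have "(\<integral>x. indicator {0..1} x *\<^sub>R character m x \<partial>lborel) = exp (c * of_real 1) / c - exp (c * of_real 0) / c"
    unfolding character
  proof (rule integral_FTC_Icc)
    show "((\<lambda>x. exp (c * of_real x) / c) has_vector_derivative exp (c * of_real x)) (at x within {0..1})" for x
      by (rule has_vector_derivative_real_field) (use c in \<open>auto intro!: derivative_eq_intros\<close>)
  qed (auto intro!: continuous_intros)
  also have "\<dots> = 0"
    using character[of 1] character[of 0] character_periodic[of m 0 1] by simp
  finally show ?thesis using False by (simp add: integral_restrict_space)
qed

definition fcoeff :: "(real \<Rightarrow> complex) \<Rightarrow> int \<Rightarrow> complex" where
  "fcoeff u m = (\<integral>x. u x * cnj (character m x) \<partial>unit_interval)"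

lemma integral_norm_trig_sum:
  fixes a :: "int \<Rightarrow> complex"
  assumes M: "finite M"
  shows "(\<integral>x. (cmod (\<Sum>m\<in>M. a m * character m x))\<^sup>2 \<partial>unit_interval) = (\<Sum>m\<in>M. (cmod (a m))\<^sup>2)"
proof -
  have i: "integrable unit_interval (\<lambda>x. a m * cnj (a n) * character (m - n) x)" for m n
    by (rule integrable_unit_interval[where R = "cmod (a m * cnj (a n))"])
       (auto simp: norm_mult character_simps)
  have "complex_of_real (\<integral>x. (cmod (\<Sum>m\<in>M. a m * character m x))\<^sup>2 \<partial>unit_interval) =
      (\<integral>x. (\<Sum>m\<in>M. \<Sum>n\<in>M. a m * cnj (a n) * character (m - n) x) \<partial>unit_interval)"
    unfolding integral_complex_of_real[symmetric]
  proof (rule Bochner_Integration.integral_cong[OF refl])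
    fix x
    have "complex_of_real ((cmod (\<Sum>m\<in>M. a m * character m x))\<^sup>2) =
        (\<Sum>m\<in>M. a m * character m x) * (\<Sum>n\<in>M. cnj (a n) * cnj (character n x))"
      by (subst complex_norm_square) simp
    also have "\<dots> = (\<Sum>m\<in>M. \<Sum>n\<in>M. a m * cnj (a n) * (character m x * cnj (character n x)))"
      unfolding sum_product by (simp add: mult_ac)
    finally show "complex_of_real ((cmod (\<Sum>m\<in>M. a m * character m x))\<^sup>2) =
        (\<Sum>m\<in>M. \<Sum>n\<in>M. a m * cnj (a n) * character (m - n) x)"
      by (simp add: character_simps)
  qed
  also have "\<dots> = (\<Sum>m\<in>M. \<Sum>n\<in>M. a m * cnj (a n) * of_bool (m = n))"
    by (simp add: Bochner_Integration.integral_sum i integral_character)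
  also have "\<dots> = (\<Sum>m\<in>M. a m * cnj (a m))"
    using M by (intro sum.cong refl) (simp add: of_bool_def sum.delta' if_distrib cong: if_cong)
  also have "\<dots> = of_real (\<Sum>m\<in>M. (cmod (a m))\<^sup>2)"
    by (simp only: of_real_sum complex_norm_square)
  finally show ?thesis by (simp only: of_real_eq_iff)
qed

text \<open>Orthonormality of the characters: the mean square distance to a trigonometric sum
  exceeds its minimum exactly by the squared distance of the coefficients. With the Fourier
  coefficients themselves this is Bessel's inequality, with approximating sums it is completeness.\<close>
lemma integral_dist_trig_sum:
  fixes a :: "int \<Rightarrow> complex"
  assumes u[measurable]: "u \<in> borel_measurable borel" and R: "\<And>x. cmod (u x) \<le> R" and M: "finite M"
  shows "(\<integral>x. (cmod (u x - (\<Sum>m\<in>M. a m * character m x)))\<^sup>2 \<partial>unit_interval) =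
    (\<integral>x. (cmod (u x))\<^sup>2 \<partial>unit_interval) - (\<Sum>m\<in>M. (cmod (fcoeff u m))\<^sup>2)
      + (\<Sum>m\<in>M. (cmod (fcoeff u m - a m))\<^sup>2)"
proof -
  define T where "T x = (\<Sum>m\<in>M. a m * character m x)" for x
  have [measurable]: "T \<in> borel_measurable borel" unfolding T_def[abs_def] by measurable
  define A where "A = (\<Sum>m\<in>M. cmod (a m))"
  have T: "cmod (T x) \<le> A" for x
    unfolding T_def A_def by (rule order_trans[OF norm_sum]) (simp add: norm_mult character_simps)
  have R0: "0 \<le> R" using R[of 0] norm_ge_zero order_trans by blast
  have i1: "integrable unit_interval (\<lambda>x. (cmod (u x))\<^sup>2)"
    by (rule integrable_unit_interval[where R = "R\<^sup>2"]) (auto simp: R intro!: power_mono)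
  have i2: "integrable unit_interval (\<lambda>x. (cmod (T x))\<^sup>2)"
    by (rule integrable_unit_interval[where R = "A\<^sup>2"]) (auto simp: T intro!: power_mono)
  have i3: "integrable unit_interval (\<lambda>x. u x * cnj (T x))"
    by (rule integrable_unit_interval[where R = "R * A"]) (auto simp: T R R0 norm_mult intro!: mult_mono)
  have i4: "integrable unit_interval (\<lambda>x. u x * cnj (character m x))" for m
    by (rule integrable_unit_interval[where R = R]) (auto simp: R norm_mult character_simps)
  have sq: "(cmod (z - w))\<^sup>2 = (cmod z)\<^sup>2 - 2 * Re (z * cnj w) + (cmod w)\<^sup>2" for z w
    unfolding cmod_power2 by (simp add: power2_eq_square algebra_simps)
  have cross: "(\<integral>x. u x * cnj (T x) \<partial>unit_interval) = (\<Sum>m\<in>M. fcoeff u m * cnj (a m))"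
  proof -
    have "(\<integral>x. u x * cnj (T x) \<partial>unit_interval) = (\<integral>x. (\<Sum>m\<in>M. (u x * cnj (character m x)) * cnj (a m)) \<partial>unit_interval)"
      by (simp add: T_def sum_distrib_left mult_ac)
    also have "\<dots> = (\<Sum>m\<in>M. fcoeff u m * cnj (a m))"
      by (simp add: Bochner_Integration.integral_sum i4 fcoeff_def)
    finally show ?thesis .
  qed
  have "(\<integral>x. (cmod (u x - T x))\<^sup>2 \<partial>unit_interval) =
      (\<integral>x. (cmod (u x))\<^sup>2 \<partial>unit_interval) - 2 * Re (\<integral>x. u x * cnj (T x) \<partial>unit_interval)
      + (\<integral>x. (cmod (T x))\<^sup>2 \<partial>unit_interval)"
    unfolding sq integral_Re[OF i3, symmetric] using i1 i2 integrable_Re[OF i3]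
    by (simp del: times_complex.sel complex_cnj_mult mult_2 integral_Re)
  also have "\<dots> = (\<integral>x. (cmod (u x))\<^sup>2 \<partial>unit_interval)
      + (\<Sum>m\<in>M. - 2 * Re (fcoeff u m * cnj (a m)) + (cmod (a m))\<^sup>2)"
    unfolding cross unfolding T_def integral_norm_trig_sum[OF M]
    by (simp add: sum.distrib sum_distrib_left sum_negf sum_subtractf)
  also have "(\<Sum>m\<in>M. - 2 * Re (fcoeff u m * cnj (a m)) + (cmod (a m))\<^sup>2) =
      (\<Sum>m\<in>M. (cmod (fcoeff u m - a m))\<^sup>2 - (cmod (fcoeff u m))\<^sup>2)"
    by (intro sum.cong refl) (simp add: sq)
  finally show ?thesis unfolding T_def by (simp add: sum_subtractf)
qed

text \<open>Generated by monomials and sums, which makes closure under products a short induction;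
  coefficients are recovered in \<open>trig_poly_sum\<close>.\<close>
inductive trig_poly :: "(real \<Rightarrow> complex) \<Rightarrow> bool" where
  character: "trig_poly (\<lambda>x. c * character m x)"
| add: "trig_poly f \<Longrightarrow> trig_poly g \<Longrightarrow> trig_poly (\<lambda>x. f x + g x)"

lemma trig_poly_cmult: "trig_poly f \<Longrightarrow> trig_poly (\<lambda>x. c * character m x * f x)"
proof (induction rule: trig_poly.induct)
  case (character d n)
  then show ?case using trig_poly.character[of "c * d" "m + n"] by (simp add: character_simps(3)[symmetric] mult_ac)
next
  case (add f g)
  then show ?case using trig_poly.add by (simp add: distrib_left)
qed

lemma trig_poly_mult: "trig_poly f \<Longrightarrow> trig_poly g \<Longrightarrow> trig_poly (\<lambda>x. f x * g x)"
proof (induction rule: trig_poly.induct)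
  case (character d n)
  then show ?case by (rule trig_poly_cmult)
next
  case (add f h)
  then show ?case using trig_poly.add by (simp add: distrib_right)
qed

text \<open>A real linear functional of \<open>z\<close> is a combination of \<open>z\<close> and its conjugate, which on
  the unit circle are the characters \<open>1\<close> and \<open>- 1\<close>.\<close>
lemma trig_poly_real_polynomial_function:
  fixes r :: "complex \<Rightarrow> real"
  assumes "real_polynomial_function r"
  shows "trig_poly (\<lambda>x. of_real (r (character 1 x)))"
  using assms
proof (induction rule: real_polynomial_function.induct)
  case (linear f)
  interpret bounded_linear f by fact
  define A B where "A = f 1" and "B = f \<i>"
  have f: "f z = Re z * A + Im z * B" for z
  proof -
    have "z = Re z *\<^sub>R 1 + Im z *\<^sub>R \<i>" by (simp add: complex_eq_iff)
    then have "f z = f (Re z *\<^sub>R 1 + Im z *\<^sub>R \<i>)" by (rule arg_cong)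
    also have "\<dots> = Re z * A + Im z * B" by (simp only: add scaleR) (simp add: A_def B_def)
    finally show ?thesis .
  qed
  have eq: "of_real (f z) = (of_real A / 2 - \<i> * of_real B / 2) * z
      + (of_real A / 2 + \<i> * of_real B / 2) * cnj z" for z
    unfolding f by (simp add: complex_eq_iff algebra_simps)
  show ?case unfolding eq character_simps(2) by (intro trig_poly.intros)
next
  case (const c)
  then show ?case using trig_poly.character[of "of_real c" 0] by (simp add: character_simps)
next
  case (add f g)
  then show ?case using trig_poly.add by simp
next
  case (mult f g)
  then show ?case using trig_poly_mult by simp
qed

lemma trig_poly_sum:
  assumes "trig_poly f"
  obtains M :: "int set" and a where "finite M" "\<And>x. f x = (\<Sum>m\<in>M. a m * character m x)"
proof -
  have "\<exists>M a. finite M \<and> (\<forall>N. finite N \<longrightarrow> M \<subseteq> N \<longrightarrow> (\<forall>x. f x = (\<Sum>m\<in>N. a m * character m x)))"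
    using assms
  proof (induction rule: trig_poly.induct)
    case (character c m)
    have "c * character m x = (\<Sum>n\<in>N. (if n = m then c else 0) * character n x)" if "finite N" "{m} \<subseteq> N" for N x
    proof -
      have "(\<Sum>n\<in>N. (if n = m then c else 0) * character n x) = (\<Sum>n\<in>{m}. (if n = m then c else 0) * character n x)"
        by (rule sum.mono_neutral_right) (use that in auto)
      then show ?thesis by simp
    qed
    then have "finite {m} \<and> (\<forall>N. finite N \<longrightarrow> {m} \<subseteq> N \<longrightarrow>
        (\<forall>x. c * character m x = (\<Sum>n\<in>N. (if n = m then c else 0) * character n x)))"
      by simp
    then show ?case
      by (rule exI[where x = "\<lambda>n. if n = m then c else 0", THEN exI[where x = "{m}"]])
  next
    case (add f g)
    from add.IH(1) obtain M a
      where M: "finite M \<and> (\<forall>N. finite N \<longrightarrow> M \<subseteq> N \<longrightarrow> (\<forall>x. f x = (\<Sum>m\<in>N. a m * character m x)))"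
      by (elim exE)
    from add.IH(2) obtain M' b
      where M': "finite M' \<and> (\<forall>N. finite N \<longrightarrow> M' \<subseteq> N \<longrightarrow> (\<forall>x. g x = (\<Sum>m\<in>N. b m * character m x)))"
      by (elim exE)
    have "f x + g x = (\<Sum>m\<in>N. (a m + b m) * character m x)" if "finite N" "M \<union> M' \<subseteq> N" for N x
    proof -
      have "f x = (\<Sum>m\<in>N. a m * character m x)" "g x = (\<Sum>m\<in>N. b m * character m x)"
        using M M' that by auto
      then show ?thesis by (simp add: distrib_right sum.distrib)
    qed
    then have "finite (M \<union> M') \<and> (\<forall>N. finite N \<longrightarrow> M \<union> M' \<subseteq> N \<longrightarrow>
        (\<forall>x. f x + g x = (\<Sum>m\<in>N. (a m + b m) * character m x)))"
      using M M' by simp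
    then show ?case
      by (rule exI[where x = "\<lambda>m. a m + b m", THEN exI[where x = "M \<union> M'"]])
  qed
  then obtain M a where "finite M \<and> (\<forall>N. finite N \<longrightarrow> M \<subseteq> N \<longrightarrow> (\<forall>x. f x = (\<Sum>m\<in>N. a m * character m x)))"
    by (elim exE)
  then show thesis by (intro that[of M a]) auto
qed

text \<open>A continuous function with equal end values descends to the unit circle, because
  the unit interval is compact and its map onto the circle is closed. There Stone-Weierstrass
  provides polynomials in the real and imaginary parts, which pull back to trigonometric polynomials.\<close>
lemma periodic_continuous_trig_approx:
  fixes h :: "real \<Rightarrow> complex"
  assumes h: "continuous_on {0..1} h" "h 0 = h 1" and e: "e > 0"
  obtains T where "trig_poly T" "\<And>x. x \<in> {0..1} \<Longrightarrow> cmod (h x - T x) < e"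
proof -
  define S where "S = character 1 ` {0..1}"
  have ch: "continuous_on A (character 1)" for A
    unfolding character_def[abs_def] by (intro continuous_intros)
  have S: "compact S" unfolding S_def by (intro compact_continuous_image ch) auto
  define F where "F z = h (SOME t. t \<in> {0..1} \<and> character 1 t = z)" for z
  have F: "F (character 1 t) = h t" if t: "t \<in> {0..1}" for t
  proof -
    define t' where "t' = (SOME t'. t' \<in> {0..1} \<and> character 1 t' = character 1 t)"
    have t': "t' \<in> {0..1}" "character 1 t' = character 1 t"
      using someI[of "\<lambda>t'. t' \<in> {0..1} \<and> character 1 t' = character 1 t" t] t unfolding t'_def by auto
    from t'(2) have "cis (2 * pi * t') = cis (2 * pi * t)" by (simp add: character_def)
    then obtain n :: int where "2 * pi * t' = 2 * pi * t + 2 * pi * of_int n"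
      using sin_cos_eq_iff[of "2 * pi * t'" "2 * pi * t"] by (auto simp: complex_eq_iff)
    then have "2 * pi * t' = 2 * pi * (t + of_int n)" by (simp add: algebra_simps)
    then have n: "t' = t + of_int n" by simp
    then have "of_int n \<le> (1::real)" "of_int n \<ge> (-1::real)" using t t' by auto
    then have "n \<le> 1" "n \<ge> -1" by linarith+
    then consider "n = 0" | "n = 1" | "n = -1" by linarith
    then have "h t' = h t"
    proof cases
      case 2
      then have "t = 0" "t' = 1" using n t t' by auto
      then show ?thesis using h by simp
    next
      case 3
      then have "t = 1" "t' = 0" using n t t' by auto
      then show ?thesis using h by simp
    qed (use n in auto)
    then show ?thesis by (simp add: F_def t'_def)
  qed
  have "continuous_on S F"
    unfolding continuous_on_closed_vimage[OF compact_imp_closed[OF S]]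
  proof (intro allI impI)
    fix B :: "complex set" assume "closed B"
    then have "closed (h -` B \<inter> {0..1})"
      using h(1) continuous_on_closed_vimage[of "{0..1}" h] by auto
    moreover have "h -` B \<inter> {0..1} = {0..1} \<inter> (h -` B \<inter> {0..1})" by auto
    ultimately have "compact (h -` B \<inter> {0..1})"
      by (metis compact_Icc compact_Int_closed)
    then have "compact (character 1 ` (h -` B \<inter> {0..1}))"
      by (intro compact_continuous_image ch)
    moreover have "F -` B \<inter> S = character 1 ` (h -` B \<inter> {0..1})"
      by (auto simp: S_def F)
    ultimately show "closed (F -` B \<inter> S)" by (simp add: compact_imp_closed)
  qed
  from Stone_Weierstrass_polynomial_function[OF S this e]
  obtain p where p: "polynomial_function p" and p2: "\<forall>z\<in>S. cmod (F z - p z) < e"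
    by (elim exE conjE)
  show thesis
  proof (rule that[of "\<lambda>t. of_real ((Re \<circ> p) (character 1 t)) + \<i> * character 0 t * of_real ((Im \<circ> p) (character 1 t))"])
    show "trig_poly (\<lambda>t. of_real ((Re \<circ> p) (character 1 t)) + \<i> * character 0 t * of_real ((Im \<circ> p) (character 1 t)))"
      using p unfolding polynomial_function_def
      by (intro trig_poly.add trig_poly_cmult trig_poly_real_polynomial_function)
         (use bounded_linear_Re bounded_linear_Im in blast)+
  next
    fix x :: real assume x: "x \<in> {0..1}"
    have "of_real ((Re \<circ> p) (character 1 x)) + \<i> * character 0 x * of_real ((Im \<circ> p) (character 1 x)) = p (character 1 x)"
      by (simp add: character_simps complex_eq_iff)
    then show "cmod (h x - (of_real ((Re \<circ> p) (character 1 x)) + \<i> * character 0 x * of_real ((Im \<circ> p) (character 1 x)))) < e"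
      using p2[rule_format, of "character 1 x"] F[OF x] x by (simp add: S_def)
  qed
qed

text \<open>Continuous approximants are multiplied by a cut-off vanishing at both end points,
  so that they become periodic; the cut-off tends to \<open>1\<close> in the open interval.\<close>
lemma bounded_borel_trig_approx:
  fixes u :: "real \<Rightarrow> complex"
  assumes u[measurable]: "u \<in> borel_measurable borel" and R: "\<And>x. cmod (u x) \<le> R" and e: "e > 0"
  obtains T where "trig_poly T" "(\<integral>x. (cmod (u x - T x))\<^sup>2 \<partial>unit_interval) < e"
proof -
  obtain q where q': "\<forall>n. continuous_on UNIV (q n)" "\<forall>n x. cmod (q n x) \<le> R"
    and q3: "AE x in lborel. (\<lambda>n. q n x) \<longlonglongrightarrow> u x"
    using bounded_borel_ae_limit_continuous[OF u R] by (elim exE conjE)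
  have q: "continuous_on UNIV (q n)" "cmod (q n x) \<le> R" for n x
    using q' by blast+
  have R0: "0 \<le> R" using R[of 0] norm_ge_zero order_trans by blast
  define cut where "cut n x = min 1 (max 0 (real n * x * (1 - x)))" for n and x :: real
  define h where "h n x = of_real (cut n x) * q n x" for n x
  have hc: "continuous_on A (h n)" for n A
    unfolding h_def cut_def using continuous_on_subset[OF q(1)] by (intro continuous_intros) auto
  have [measurable]: "h n \<in> borel_measurable borel" for n
    using hc by (rule borel_measurable_continuous_onI)
  have hR: "cmod (h n x) \<le> R" for n x
  proof -
    have "\<bar>cut n x\<bar> \<le> 1" by (auto simp: cut_def)
    then have "\<bar>cut n x\<bar> * cmod (q n x) \<le> 1 * R" by (intro mult_mono q) auto
    then show ?thesis by (simp add: h_def norm_mult)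
  qed
  have AE0: "AE x in lborel. x \<noteq> (0::real)" "AE x in lborel. x \<noteq> (1::real)"
    by (rule AE_lborel_singleton)+
  have lim: "AE x in lborel. x \<in> {0..1} \<longrightarrow> (\<lambda>n. h n x) \<longlonglongrightarrow> u x"
    using q3 AE0
  proof eventually_elim
    fix x :: real assume x: "(\<lambda>n. q n x) \<longlonglongrightarrow> u x" "x \<noteq> 0" "x \<noteq> 1"
    show "x \<in> {0..1} \<longrightarrow> (\<lambda>n. h n x) \<longlonglongrightarrow> u x"
    proof
      assume "x \<in> {0..1}"
      then have pos: "x * (1 - x) > 0" using x by auto
      have "eventually (\<lambda>n. cut n x = 1) sequentially"
        using eventually_ge_at_top[of "nat \<lceil>1 / (x * (1 - x))\<rceil>"]
      proof eventually_elim
        case (elim n)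
        then have "1 / (x * (1 - x)) \<le> real n" by linarith
        then show ?case using pos by (simp add: cut_def field_simps)
      qed
      then have "eventually (\<lambda>n. q n x = h n x) sequentially"
        by eventually_elim (simp add: h_def)
      then show "(\<lambda>n. h n x) \<longlonglongrightarrow> u x" using x(1) by (rule Lim_transform_eventually[rotated])
    qed
  qed
  have "(\<lambda>n. \<integral>x. (cmod (u x - h n x))\<^sup>2 \<partial>unit_interval) \<longlonglongrightarrow> (\<integral>x. 0 \<partial>unit_interval)"
  proof (rule integral_dominated_convergence[where w = "\<lambda>_. (2 * R)\<^sup>2"])
    show "AE x in unit_interval. (\<lambda>n. (cmod (u x - h n x))\<^sup>2) \<longlonglongrightarrow> 0"
    proof (subst AE_restrict_space_iff)
      show "AE x in lborel. x \<in> {0..1} \<longrightarrow> (\<lambda>n. (cmod (u x - h n x))\<^sup>2) \<longlonglongrightarrow> 0"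
        using lim
      proof eventually_elim
        fix x assume "x \<in> {0..1} \<longrightarrow> (\<lambda>n. h n x) \<longlonglongrightarrow> u x"
        moreover have "(\<lambda>n. (cmod (u x - h n x))\<^sup>2) \<longlonglongrightarrow> (cmod (u x - u x))\<^sup>2"
          if "(\<lambda>n. h n x) \<longlonglongrightarrow> u x"
          by (intro tendsto_intros that)
        ultimately show "x \<in> {0..1} \<longrightarrow> (\<lambda>n. (cmod (u x - h n x))\<^sup>2) \<longlonglongrightarrow> 0" by simp
      qed
    qed simp
    show "AE x in unit_interval. norm ((cmod (u x - h n x))\<^sup>2) \<le> (2 * R)\<^sup>2" for n
    proof (rule AE_I2)
      fix x
      have "cmod (u x - h n x) \<le> 2 * R"
        using norm_triangle_ineq4[of "u x" "h n x"] R[of x] hR[of n x] by linarith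
      then show "norm ((cmod (u x - h n x))\<^sup>2) \<le> (2 * R)\<^sup>2"
        using power_mono[of "cmod (u x - h n x)" "2 * R" 2] by simp
    qed
    show "integrable unit_interval (\<lambda>_. (2 * R)\<^sup>2)"
      by (rule integrable_unit_interval) auto
  qed (auto intro!: measurable_restrict_space1)
  then have "eventually (\<lambda>n. (\<integral>x. (cmod (u x - h n x))\<^sup>2 \<partial>unit_interval) < e / 4) sequentially"
    using e by (intro order_tendstoD(2)) auto
  then obtain n where n: "(\<integral>x. (cmod (u x - h n x))\<^sup>2 \<partial>unit_interval) < e / 4"
    by (meson eventually_sequentially le_refl)
  have "h n 0 = h n 1" by (simp add: h_def cut_def)
  then obtain T where T: "trig_poly T" "\<And>x. x \<in> {0..1} \<Longrightarrow> cmod (h n x - T x) < sqrt (e / 4)"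
    using periodic_continuous_trig_approx[of "h n" "sqrt (e / 4)"] hc e by auto
  from T(1) have [measurable]: "T \<in> borel_measurable borel"
    by induction measurable
  have i: "integrable unit_interval (\<lambda>x. (cmod (u x - h n x))\<^sup>2)"
  proof (rule integrable_unit_interval)
    fix x
    have "cmod (u x - h n x) \<le> 2 * R"
      using norm_triangle_ineq4[of "u x" "h n x"] R[of x] hR[of n x] by linarith
    then show "norm ((cmod (u x - h n x))\<^sup>2) \<le> (2 * R)\<^sup>2"
        using power_mono[of "cmod (u x - h n x)" "2 * R" 2] by simp
  qed measurable
  have ic: "integrable unit_interval (\<lambda>x. e / 2)"
    by (rule integrable_unit_interval[where R = "\<bar>e / 2\<bar>"]) auto
  have "(\<integral>x. (cmod (u x - T x))\<^sup>2 \<partial>unit_interval) \<le> (\<integral>x. 2 * (cmod (u x - h n x))\<^sup>2 + e / 2 \<partial>unit_interval)"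
  proof (rule integral_mono')
    show "integrable unit_interval (\<lambda>x. 2 * (cmod (u x - h n x))\<^sup>2 + e / 2)"
      using i ic by (intro Bochner_Integration.integrable_add integrable_mult_right) auto
    fix x assume "x \<in> space unit_interval"
    then have x: "x \<in> {0..1}" by (simp add: space_restrict_space)
    have "(cmod (h n x - T x))\<^sup>2 \<le> (sqrt (e / 4))\<^sup>2"
      using T(2)[OF x] by (intro power_mono) auto
    then have 1: "(cmod (h n x - T x))\<^sup>2 \<le> e / 4" using e by simp
    have "cmod (u x - T x) \<le> cmod (u x - h n x) + cmod (h n x - T x)"
      using norm_triangle_ineq[of "u x - h n x" "h n x - T x"] by simp
    then have "(cmod (u x - T x))\<^sup>2 \<le> (cmod (u x - h n x) + cmod (h n x - T x))\<^sup>2"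
      by (intro power_mono) auto
    also have "\<dots> \<le> 2 * (cmod (u x - h n x))\<^sup>2 + 2 * (cmod (h n x - T x))\<^sup>2"
      using sum_squares_bound[of "cmod (u x - h n x)" "cmod (h n x - T x)"]
      by (simp add: power2_sum)
    finally show "(cmod (u x - T x))\<^sup>2 \<le> 2 * (cmod (u x - h n x))\<^sup>2 + e / 2" using 1 by linarith
    show "0 \<le> 2 * (cmod (u x - h n x))\<^sup>2 + e / 2" using e by simp
  qed
  also have "\<dots> = 2 * (\<integral>x. (cmod (u x - h n x))\<^sup>2 \<partial>unit_interval) + e / 2"
    using i ic by (simp add: measure_restrict_space space_restrict_space)
  also have "\<dots> < e" using n by simp
  finally show thesis using that T(1) by blast
qed

text \<open>Bessel's inequality bounds every finite part of the coefficient sum, and by density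
  of the trigonometric polynomials nothing of the mean square is lost in the limit.\<close>
lemma parseval:
  fixes u :: "real \<Rightarrow> complex"
  assumes u[measurable]: "u \<in> borel_measurable borel" and R: "\<And>x. cmod (u x) \<le> R"
  shows "(\<integral>\<^sup>+m. sq_norm (fcoeff u m) \<partial>zcount) = (\<integral>\<^sup>+x. sq_norm (u x) \<partial>unit_interval)"
proof -
  have i: "integrable unit_interval (\<lambda>x. (cmod (u x))\<^sup>2)"
    by (rule integrable_unit_interval[where R = "R\<^sup>2"]) (auto simp: R intro!: power_mono)
  have eq: "(\<integral>\<^sup>+x. sq_norm (u x) \<partial>unit_interval) = ennreal (\<integral>x. (cmod (u x))\<^sup>2 \<partial>unit_interval)"
    by (rule nn_integral_eq_integral[OF i]) auto
  show ?thesis unfolding eq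
  proof (rule antisym)
    show "(\<integral>\<^sup>+m. sq_norm (fcoeff u m) \<partial>zcount) \<le> ennreal (\<integral>x. (cmod (u x))\<^sup>2 \<partial>unit_interval)"
    proof (rule nn_integral_count_space_le)
      fix M :: "int set" assume M: "finite M"
      have "0 \<le> (\<integral>x. (cmod (u x - (\<Sum>m\<in>M. fcoeff u m * character m x)))\<^sup>2 \<partial>unit_interval)" by simp
      also note integral_dist_trig_sum[OF u R M]
      finally show "(\<Sum>m\<in>M. sq_norm (fcoeff u m)) \<le> ennreal (\<integral>x. (cmod (u x))\<^sup>2 \<partial>unit_interval)"
        by (subst sum_ennreal) (auto intro!: ennreal_leI)
    qed simp
    show "ennreal (\<integral>x. (cmod (u x))\<^sup>2 \<partial>unit_interval) \<le> (\<integral>\<^sup>+m. sq_norm (fcoeff u m) \<partial>zcount)"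
    proof (rule ennreal_le_epsilon)
      fix e :: real assume "e > 0"
      then obtain T where T: "trig_poly T" "(\<integral>x. (cmod (u x - T x))\<^sup>2 \<partial>unit_interval) < e"
        using bounded_borel_trig_approx[OF u R] by blast
      obtain M a where M: "finite M" and Ta: "\<And>x. T x = (\<Sum>m\<in>M. a m * character m x)"
        using trig_poly_sum[OF T(1)] by blast
      have "0 \<le> (\<Sum>m\<in>M. (cmod (fcoeff u m - a m))\<^sup>2)" by (rule sum_nonneg) simp
      then have "(\<integral>x. (cmod (u x))\<^sup>2 \<partial>unit_interval) \<le> (\<Sum>m\<in>M. (cmod (fcoeff u m))\<^sup>2) + e"
        using T(2) integral_dist_trig_sum[OF u R M, of a] unfolding Ta by linarith
      then have "ennreal (\<integral>x. (cmod (u x))\<^sup>2 \<partial>unit_interval) \<le> ennreal ((\<Sum>m\<in>M. (cmod (fcoeff u m))\<^sup>2) + e)"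
        by (rule ennreal_leI)
      also have "\<dots> = (\<Sum>m\<in>M. sq_norm (fcoeff u m)) + ennreal e"
        using \<open>e > 0\<close> by (subst ennreal_plus) (auto intro: sum_nonneg)
      also have "\<dots> \<le> (\<integral>\<^sup>+m. sq_norm (fcoeff u m) \<partial>zcount) + ennreal e"
        by (intro add_right_mono sum_le_nn_integral_count_space M)
      finally show "ennreal (\<integral>x. (cmod (u x))\<^sup>2 \<partial>unit_interval) \<le>
        (\<integral>\<^sup>+m. sq_norm (fcoeff u m) \<partial>zcount) + ennreal e" .
    qed
  qed
qed

section \<open>Fourier inversion\<close>

text \<open>The phase of the transform, in units of full turns, so that it is trivial exactly at
  the integers.\<close>
definition wave :: "real \<Rightarrow> complex" where
  "wave t = cis (2 * pi * t)"

lemma wave_simps: "wave 0 = 1" "cnj (wave t) = wave (- t)" "cmod (wave t) = 1" "wave t \<noteq> 0"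
  by (simp_all add: wave_def cis_cnj)

lemma wave_add: "wave (s + t) = wave s * wave t"
  by (simp add: wave_def cis_mult distrib_left)

lemma character_eq_wave: "character m x = wave (of_int m * x)"
  by (simp add: character_def wave_def mult.assoc)

lemma wave_of_int: "wave (of_int n) = 1"
  using character_periodic[of 1 0 n] by (simp add: character_eq_wave wave_simps)

lemma continuous_wave[continuous_intros]:
  "continuous_on A f \<Longrightarrow> continuous_on A (\<lambda>x. wave (f x))"
  unfolding wave_def by (intro continuous_intros)

lemma borel_measurable_wave[measurable]: "wave \<in> borel_measurable borel"
  by (intro borel_measurable_continuous_onI continuous_intros)

abbreviation inv_fourier :: "(real \<Rightarrow> complex) \<Rightarrow> real \<Rightarrow> complex" where
  "inv_fourier K x \<equiv> \<integral>w. K w * wave (w * x) \<partial>lborel"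

lemma fourier_kernel_eq_wave: "exp (- 2 * of_real pi * \<i> * of_real w * of_real x) = wave (- w * x)"
  by (simp add: wave_def cis_conv_exp mult_ac)

lemma integrable_mult_bounded:
  fixes a k :: "'a \<Rightarrow> complex"
  assumes a: "integrable M a" and k[measurable]: "k \<in> borel_measurable M" and B: "\<And>x. cmod (k x) \<le> B"
  shows "integrable M (\<lambda>x. a x * k x)"
proof (rule Bochner_Integration.integrable_bound[of _ "\<lambda>x. of_real B * a x"])
  note [measurable] = borel_measurable_integrable[OF a]
  show "integrable M (\<lambda>x. of_real B * a x)" using a by simp
  show "(\<lambda>x. a x * k x) \<in> borel_measurable M" by measurable
  show "AE x in M. norm (a x * k x) \<le> norm (of_real B * a x)"
  proof (rule AE_I2)
    fix x
    have "cmod (k x) \<le> \<bar>B\<bar>" using B[of x] by simp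
    then have "cmod (k x) * cmod (a x) \<le> \<bar>B\<bar> * cmod (a x)" by (intro mult_right_mono) auto
    then show "norm (a x * k x) \<le> norm (of_real B * a x)" by (simp add: norm_mult mult.commute)
  qed
qed

lemma fubini_bounded_kernel:
  fixes a b :: "real \<Rightarrow> complex" and k :: "real \<Rightarrow> real \<Rightarrow> complex"
  assumes a: "integrable lborel a" and b: "integrable lborel b"
    and k[measurable]: "(\<lambda>(x, y). k x y) \<in> borel_measurable (borel \<Otimes>\<^sub>M borel)"
    and B: "\<And>x y. cmod (k x y) \<le> B"
  shows "(\<integral>x. a x * (\<integral>y. b y * k x y \<partial>lborel) \<partial>lborel) = (\<integral>y. b y * (\<integral>x. a x * k x y \<partial>lborel) \<partial>lborel)"
proof -
  note [measurable] = borel_measurable_integrable[OF a] borel_measurable_integrable[OF b]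
  have "integrable (lborel \<Otimes>\<^sub>M lborel) (\<lambda>p. a (fst p) * b (snd p))"
  proof (rule lborel_pair.Fubini_integrable)
    show "integrable lborel (\<lambda>x. \<integral>y. norm (a (fst (x, y)) * b (snd (x, y))) \<partial>lborel)"
      using a by (simp add: norm_mult)
    show "AE x in lborel. integrable lborel (\<lambda>y. a (fst (x, y)) * b (snd (x, y)))"
      using b by simp
  qed measurable
  then have "integrable (lborel \<Otimes>\<^sub>M lborel) (\<lambda>p. (a (fst p) * b (snd p)) * (case p of (x, y) \<Rightarrow> k x y))"
    by (rule integrable_mult_bounded[where B = B]) (auto simp: B)
  then have "integrable (lborel \<Otimes>\<^sub>M lborel) (\<lambda>(x, y). a x * b y * k x y)"
    by (simp add: case_prod_unfold)
  from lborel_pair.Fubini_integral[OF this]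
  have Fub: "(\<integral>y. \<integral>x. a x * b y * k x y \<partial>lborel \<partial>lborel) = (\<integral>x. \<integral>y. a x * b y * k x y \<partial>lborel \<partial>lborel)" .
  have 1: "(\<integral>y. a x * b y * k x y \<partial>lborel) = a x * (\<integral>y. b y * k x y \<partial>lborel)" for x
    by (simp add: mult.assoc)
  have 2: "(\<integral>x. a x * b y * k x y \<partial>lborel) = b y * (\<integral>x. a x * k x y \<partial>lborel)" for y
  proof -
    have "(\<integral>x. a x * b y * k x y \<partial>lborel) = (\<integral>x. b y * (a x * k x y) \<partial>lborel)"
      by (simp only: mult_ac)
    then show ?thesis by simp
  qed
  show ?thesis using Fub unfolding 1 2 by (rule sym)
qed

text \<open>The characteristic function of the standard normal distribution, rescaled: a
  Gaussian of width \<open>1 / \<delta>\<close> in frequency is the transform of one of width \<open>\<delta>\<close>.\<close>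
lemma gaussian_transform:
  fixes \<delta> v :: real
  assumes \<delta>: "\<delta> > 0"
  defines "G \<equiv> \<lambda>w. of_real (sqrt (2 * pi) * std_normal_density (2 * pi * \<delta> * w)) :: complex"
  shows "integrable lborel G" "(\<integral>w. G w * wave (\<delta> * v * w) \<partial>lborel) = of_real (std_normal_density v / \<delta>)"
proof -
  define f where "f z = cis (v * z) * of_real (std_normal_density z)" for z
  have "integrable lborel (\<lambda>z. complex_of_real (std_normal_density z))"
    using integrable_std_normal_moment[of 0] by simp
  then have i: "integrable lborel (\<lambda>w. complex_of_real (std_normal_density (0 + (2 * pi * \<delta>) * w)))"
    by (rule lborel_integrable_real_affine) (use \<delta> in auto)
  then show "integrable lborel G" by (simp add: G_def)
  have "(\<integral>z. f z \<partial>lborel) = char std_normal_distribution v"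
    unfolding char_def f_def
    by (subst integral_density) (auto simp: normal_density_nonneg cis_conv_exp scaleR_conv_of_real mult_ac)
  also have "\<dots> = of_real (sqrt (2 * pi) * std_normal_density v)"
  proof -
    have "sqrt (2 * pi) * std_normal_density v = exp (- v\<^sup>2 / 2)" by (simp add: std_normal_density_def)
    then show ?thesis by (simp only: char_std_normal_distribution)
  qed
  finally have 1: "(\<integral>z. f z \<partial>lborel) = of_real (sqrt (2 * pi) * std_normal_density v)" .
  have "(\<integral>z. f z \<partial>lborel) = \<bar>2 * pi * \<delta>\<bar> *\<^sub>R (\<integral>w. f (0 + (2 * pi * \<delta>) * w) \<partial>lborel)"
    by (rule lborel_integral_real_affine) (use \<delta> in auto)
  then have 2: "(\<integral>z. f z \<partial>lborel) = of_real (2 * pi * \<delta>) * (\<integral>w. f (2 * pi * \<delta> * w) \<partial>lborel)"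
    using \<delta> by (simp add: scaleR_conv_of_real)
  have "(\<integral>w. G w * wave (\<delta> * v * w) \<partial>lborel) = (\<integral>w. of_real (sqrt (2 * pi)) * f (2 * pi * \<delta> * w) \<partial>lborel)"
    by (intro Bochner_Integration.integral_cong) (auto simp: G_def f_def wave_def mult_ac)
  also have "\<dots> = of_real (sqrt (2 * pi)) * (\<integral>w. f (2 * pi * \<delta> * w) \<partial>lborel)"
    by simp
  also have "\<dots> = of_real (sqrt (2 * pi)) * (of_real (sqrt (2 * pi) * std_normal_density v) / of_real (2 * pi * \<delta>))"
    using 1 2 \<delta> by (simp add: field_simps)
  also have "\<dots> = of_real (sqrt (2 * pi) * sqrt (2 * pi) * std_normal_density v / (2 * pi * \<delta>))"
    by (simp only: of_real_mult of_real_divide times_divide_eq_right mult.assoc)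
  also have "sqrt (2 * pi) * sqrt (2 * pi) * std_normal_density v / (2 * pi * \<delta>) = std_normal_density v / \<delta>"
    by simp
  finally show "(\<integral>w. G w * wave (\<delta> * v * w) \<partial>lborel) = of_real (std_normal_density v / \<delta>)" .
qed

lemma std_normal_density_le: "std_normal_density x \<le> 1 / sqrt (2 * pi)"
  unfolding std_normal_density_def by (intro mult_left_le) auto

text \<open>Averaging the test function \<open>q\<close> with a Gaussian of width \<open>\<delta>\<close> amounts to damping
  the transform of \<open>f\<close> by a Gaussian factor. The damping makes all iterated integrals
  absolutely convergent, so that Fubini applies.\<close>
lemma gaussian_smoothing_identity:
  fixes f q :: "real \<Rightarrow> complex"
  assumes f: "integrable lborel f" and q: "integrable lborel q" and \<delta>: "\<delta> > 0"
  defines "G \<equiv> \<lambda>w. of_real (sqrt (2 * pi) * std_normal_density (2 * pi * \<delta> * w)) :: complex"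
    and "K \<equiv> \<lambda>w. \<integral>x. f x * wave (- w * x) \<partial>lborel"
  shows "(\<integral>x. f x * (\<integral>z. of_real (std_normal_density z) * q (x + \<delta> * z) \<partial>lborel) \<partial>lborel) =
    (\<integral>y. q y * (\<integral>w. G w * (K w * wave (w * y)) \<partial>lborel) \<partial>lborel)"
proof -
  note [measurable] = borel_measurable_integrable[OF f] borel_measurable_integrable[OF q]
  have G: "integrable lborel G" "(\<integral>w. G w * wave (\<delta> * v * w) \<partial>lborel) = of_real (std_normal_density v / \<delta>)" for v
    using gaussian_transform[OF \<delta>] by (simp_all add: G_def)
  have [measurable]: "G \<in> borel_measurable borel" unfolding G_def by measurable
  have inner: "(\<integral>z. of_real (std_normal_density z) * q (x + \<delta> * z) \<partial>lborel) =
      (\<integral>y. q y * (\<integral>w. G w * wave ((y - x) * w) \<partial>lborel) \<partial>lborel)" for x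
  proof -
    have "(\<integral>y. q y * (\<integral>w. G w * wave ((y - x) * w) \<partial>lborel) \<partial>lborel) =
        (\<integral>y. q y * of_real (std_normal_density ((y - x) / \<delta>) / \<delta>) \<partial>lborel)"
      using G(2)[of "(y - x) / \<delta>" for y] \<delta> by (intro Bochner_Integration.integral_cong) auto
    also have "\<dots> = \<bar>\<delta>\<bar> *\<^sub>R (\<integral>z. q (x + \<delta> * z) * of_real (std_normal_density ((x + \<delta> * z - x) / \<delta>) / \<delta>) \<partial>lborel)"
      by (rule lborel_integral_real_affine) (use \<delta> in auto)
    also have "\<dots> = (\<integral>z. of_real \<delta> * (q (x + \<delta> * z) * of_real (std_normal_density ((x + \<delta> * z - x) / \<delta>) / \<delta>)) \<partial>lborel)"
      using \<delta> by (simp add: scaleR_conv_of_real)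
    also have "\<dots> = (\<integral>z. of_real (std_normal_density z) * q (x + \<delta> * z) \<partial>lborel)"
      using \<delta> by (intro Bochner_Integration.integral_cong) auto
    finally show ?thesis ..
  qed
  have swap: "(\<integral>x. f x * (\<integral>w. G w * wave ((y - x) * w) \<partial>lborel) \<partial>lborel) =
      (\<integral>w. G w * (K w * wave (w * y)) \<partial>lborel)" for y
  proof -
    have "(\<integral>x. f x * (\<integral>w. G w * wave ((y - x) * w) \<partial>lborel) \<partial>lborel) =
        (\<integral>w. G w * (\<integral>x. f x * wave ((y - x) * w) \<partial>lborel) \<partial>lborel)"
      by (rule fubini_bounded_kernel[OF f G(1), where B = 1]) (auto simp: wave_simps)
    also have "\<dots> = (\<integral>w. G w * (\<integral>x. (f x * wave (- w * x)) * wave (w * y) \<partial>lborel) \<partial>lborel)"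
      by (simp add: mult.assoc flip: wave_add) (simp add: algebra_simps)
    finally show ?thesis by (simp add: K_def)
  qed
  have "cmod (\<integral>w. G w * wave ((y - x) * w) \<partial>lborel) \<le> 1 / sqrt (2 * pi) / \<delta>" for x y
  proof -
    have "cmod (\<integral>w. G w * wave ((y - x) * w) \<partial>lborel) = std_normal_density ((y - x) / \<delta>) / \<delta>"
      using G(2)[of "(y - x) / \<delta>"] \<delta> by (simp add: norm_divide normal_density_nonneg)
    also have "\<dots> \<le> 1 / sqrt (2 * pi) / \<delta>"
      using std_normal_density_le \<delta> by (intro divide_right_mono) auto
    finally show ?thesis .
  qed
  then have "(\<integral>x. f x * (\<integral>y. q y * (\<integral>w. G w * wave ((y - x) * w) \<partial>lborel) \<partial>lborel) \<partial>lborel) =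
      (\<integral>y. q y * (\<integral>x. f x * (\<integral>w. G w * wave ((y - x) * w) \<partial>lborel) \<partial>lborel) \<partial>lborel)"
    by (intro fubini_bounded_kernel[OF f q]) auto
  then show ?thesis by (simp add: inner swap)
qed

text \<open>As the width tends to \<open>0\<close> in the smoothing identity, the left side converges by
  continuity of \<open>q\<close> and the right side because the damping factor tends to \<open>1\<close> and
  \<open>K\<close> is integrable.\<close>
lemma fourier_inversion_weak:
  fixes f q :: "real \<Rightarrow> complex"
  defines "K \<equiv> \<lambda>w. \<integral>x. f x * wave (- w * x) \<partial>lborel"
  assumes f: "integrable lborel f" and K: "integrable lborel K"
    and q: "integrable lborel q" "continuous_on UNIV q" "\<And>x. cmod (q x) \<le> B"
  shows "(\<integral>x. f x * q x \<partial>lborel) = (\<integral>y. q y * inv_fourier K y \<partial>lborel)"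
proof (rule LIMSEQ_unique)
  define \<delta> where "\<delta> n = 1 / real (Suc n)" for n
  have \<delta>: "\<delta> n > 0" for n by (simp add: \<delta>_def)
  have \<delta>0: "\<delta> \<longlonglongrightarrow> 0" unfolding \<delta>_def[abs_def] by (rule LIMSEQ_Suc[OF lim_1_over_n])
  note [measurable] = borel_measurable_integrable[OF f] borel_measurable_integrable[OF q(1)] borel_measurable_integrable[OF K]
  define N where "N z = complex_of_real (std_normal_density z)" for z
  have N: "integrable lborel N" using integrable_std_normal_moment[of 0] by (simp add: N_def[abs_def])
  note [measurable] = borel_measurable_integrable[OF N]
  have N1: "(\<integral>z. N z \<partial>lborel) = 1"
    using integral_std_normal_moment_even[of 0] by (simp add: N_def)
  have N1': "(\<integral>z. norm (N z) \<partial>lborel) = 1"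
    using integral_std_normal_moment_even[of 0] by (simp add: N_def normal_density_nonneg)
  define G where "G n w = complex_of_real (sqrt (2 * pi) * std_normal_density (2 * pi * \<delta> n * w))" for n w
  have [measurable]: "G n \<in> borel_measurable borel" for n unfolding G_def[abs_def] by measurable
  have G1: "cmod (G n w) \<le> 1" for n w
    using std_normal_density_le[of "2 * pi * \<delta> n * w"]
    by (simp add: G_def norm_mult normal_density_nonneg field_simps)
  define P where "P n x = (\<integral>z. N z * q (x + \<delta> n * z) \<partial>lborel)" for n x
  have Pm[measurable]: "P n \<in> borel_measurable borel" for n
    unfolding P_def[abs_def] by (rule lborel.borel_measurable_lebesgue_integral) measurable
  have B0: "0 \<le> B" using q(3)[of 0] norm_ge_zero order_trans by blast
  have Nq: "integrable lborel (\<lambda>z. N z * q (x + \<delta> n * z))" for n x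
    by (rule integrable_mult_bounded[OF N, where B = B]) (auto simp: q(3))
  have PB: "cmod (P n x) \<le> B" for n x
  proof -
    have "cmod (P n x) \<le> (\<integral>z. norm (N z * q (x + \<delta> n * z)) \<partial>lborel)"
      unfolding P_def by (rule integral_norm_bound)
    also have "\<dots> \<le> (\<integral>z. norm (N z) * B \<partial>lborel)"
      using Nq N by (intro integral_mono integrable_norm integrable_mult_left)
        (auto simp: norm_mult q(3) intro!: mult_left_mono)
    also have "\<dots> = B" by (simp add: N1')
    finally show ?thesis .
  qed
  have Plim: "(\<lambda>n. P n x) \<longlonglongrightarrow> q x" for x
  proof -
    have "(\<lambda>n. P n x) \<longlonglongrightarrow> (\<integral>z. N z * q x \<partial>lborel)"
      unfolding P_def
    proof (rule integral_dominated_convergence[where w = "\<lambda>z. norm (N z) * B"])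
      show "integrable lborel (\<lambda>z. norm (N z) * B)" using N by simp
      show "AE z in lborel. (\<lambda>n. N z * q (x + \<delta> n * z)) \<longlonglongrightarrow> N z * q x"
      proof (rule AE_I2)
        fix z
        have "(\<lambda>n. x + \<delta> n * z) \<longlonglongrightarrow> x + 0 * z" by (intro tendsto_intros \<delta>0)
        moreover have "isCont q x" using q(2) by (simp add: continuous_on_eq_continuous_at)
        ultimately have "(\<lambda>n. q (x + \<delta> n * z)) \<longlonglongrightarrow> q x" using isCont_tendsto_compose[of x q] by simp
        then show "(\<lambda>n. N z * q (x + \<delta> n * z)) \<longlonglongrightarrow> N z * q x" by (intro tendsto_intros)
      qed
    qed (auto simp: norm_mult q(3) intro!: mult_left_mono)
    then show ?thesis by (simp add: N1)
  qed
  show "(\<lambda>n. \<integral>x. f x * P n x \<partial>lborel) \<longlonglongrightarrow> (\<integral>x. f x * q x \<partial>lborel)"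
  proof (rule integral_dominated_convergence[where w = "\<lambda>x. norm (f x) * B"])
    show "integrable lborel (\<lambda>x. norm (f x) * B)" using f by simp
    show "AE x in lborel. (\<lambda>n. f x * P n x) \<longlonglongrightarrow> f x * q x"
      by (intro AE_I2 tendsto_intros Plim)
  qed (auto simp: norm_mult PB intro!: mult_left_mono)
  have eq: "(\<integral>x. f x * P n x \<partial>lborel) = (\<integral>y. q y * (\<integral>w. G n w * (K w * wave (w * y)) \<partial>lborel) \<partial>lborel)" for n
    using gaussian_smoothing_identity[OF f q(1) \<delta>[of n]] unfolding P_def N_def G_def K_def .
  define I where "I n y = (\<integral>w. G n w * (K w * wave (w * y)) \<partial>lborel)" for n y
  define kk where "kk = (\<integral>w. norm (K w) \<partial>lborel)"
  have [measurable]: "I n \<in> borel_measurable borel" for n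
    unfolding I_def[abs_def] by (rule lborel.borel_measurable_lebesgue_integral) measurable
  define J where "J y = inv_fourier K y" for y
  have [measurable]: "J \<in> borel_measurable borel"
    unfolding J_def[abs_def] by (rule lborel.borel_measurable_lebesgue_integral) measurable
  have bd: "norm (G n w * (K w * wave (w * y))) \<le> norm (K w)" for n w y
    using mult_right_mono[OF G1, of "norm (K w)" n w] by (simp add: norm_mult wave_simps)
  have Ib: "cmod (I n y) \<le> kk" for n y
  proof -
    have "cmod (I n y) \<le> (\<integral>w. norm (G n w * (K w * wave (w * y))) \<partial>lborel)"
      unfolding I_def by (rule integral_norm_bound)
    also have "\<dots> \<le> kk"
      unfolding kk_def using K bd by (intro integral_mono') auto
    finally show ?thesis .
  qed
  have Ilim: "(\<lambda>n. I n y) \<longlonglongrightarrow> J y" for y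
    unfolding I_def J_def
  proof (rule integral_dominated_convergence[where w = "\<lambda>w. norm (K w)"])
    show "AE w in lborel. (\<lambda>n. G n w * (K w * wave (w * y))) \<longlonglongrightarrow> K w * wave (w * y)"
    proof (rule AE_I2)
      fix w
      have "(\<lambda>n. G n w) \<longlonglongrightarrow> complex_of_real (sqrt (2 * pi) * (1 / sqrt (2 * pi) * exp (- (2 * pi * 0 * w)\<^sup>2 / 2)))"
        unfolding G_def std_normal_density_def by (intro tendsto_intros \<delta>0) auto
      then have "(\<lambda>n. G n w) \<longlonglongrightarrow> 1" by simp
      then have "(\<lambda>n. G n w * (K w * wave (w * y))) \<longlonglongrightarrow> 1 * (K w * wave (w * y))" by (intro tendsto_intros)
      then show "(\<lambda>n. G n w * (K w * wave (w * y))) \<longlonglongrightarrow> K w * wave (w * y)" by simp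
    qed
  qed (use K bd in auto)
  have "(\<lambda>n. \<integral>y. q y * I n y \<partial>lborel) \<longlonglongrightarrow> (\<integral>y. q y * J y \<partial>lborel)"
  proof (rule integral_dominated_convergence[where w = "\<lambda>y. norm (q y) * kk"])
    show "integrable lborel (\<lambda>y. norm (q y) * kk)" using q(1) by simp
    show "AE y in lborel. (\<lambda>n. q y * I n y) \<longlonglongrightarrow> q y * J y"
      by (intro AE_I2 tendsto_intros Ilim)
  qed (auto simp: norm_mult Ib intro!: mult_left_mono)
  then show "(\<lambda>n. \<integral>x. f x * P n x \<partial>lborel) \<longlonglongrightarrow> (\<integral>y. q y * inv_fourier K y \<partial>lborel)"
    unfolding eq I_def J_def .
qed

text \<open>Testing against bounded continuous approximants of the conjugate sign of \<open>h\<close> shows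
  that \<open>\<bar>h\<bar>\<close> times any tent cut-off integrates to \<open>0\<close>. The cut-offs appear because the
  intended \<open>h\<close> is a difference of an integrable and a merely bounded function.\<close>
lemma AE_eq_0_if_orthogonal_to_continuous:
  fixes h :: "real \<Rightarrow> complex"
  assumes hm[measurable]: "h \<in> borel_measurable borel"
    and hi: "\<And>N. integrable lborel (\<lambda>x. h x * of_real (max 0 (min 1 (real N - \<bar>x\<bar>))))"
    and orth: "\<And>q N. continuous_on UNIV q \<Longrightarrow> (\<And>x. cmod (q x) \<le> 1) \<Longrightarrow>
      (\<integral>x. (h x * of_real (max 0 (min 1 (real N - \<bar>x\<bar>)))) * q x \<partial>lborel) = 0"
  shows "AE x in lborel. h x = 0"
proof -
  define cut where "cut N x = max 0 (min 1 (real N - \<bar>x\<bar>))" for N and x :: real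
  define u where "u x = cnj (sgn (h x))" for x
  have um[measurable]: "u \<in> borel_measurable borel"
    unfolding u_def[abs_def] sgn_eq by measurable
  have sg: "cmod (u x) \<le> 1" for x by (simp add: u_def norm_sgn)
  obtain q where q': "\<forall>n. continuous_on UNIV (q n)" "\<forall>n x. cmod (q n x) \<le> 1"
    and qlim: "AE x in lborel. (\<lambda>n. q n x) \<longlonglongrightarrow> u x"
    using bounded_borel_ae_limit_continuous[OF um sg] by (elim exE conjE)
  have q: "continuous_on UNIV (q n)" "cmod (q n x) \<le> 1" for n x using q' by blast+
  have [measurable]: "q n \<in> borel_measurable borel" for n
    by (rule borel_measurable_continuous_onI[OF q(1)])
  have "AE x in lborel. cmod (h x) * cut N x = 0" for N
  proof -
    have i: "integrable lborel (\<lambda>x. h x * of_real (cut N x))" using hi unfolding cut_def .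
    note [measurable] = borel_measurable_integrable[OF i]
    have "(\<lambda>n. \<integral>x. (h x * of_real (cut N x)) * q n x \<partial>lborel) \<longlonglongrightarrow>
        (\<integral>x. (h x * of_real (cut N x)) * u x \<partial>lborel)"
    proof (rule integral_dominated_convergence[where w = "\<lambda>x. norm (h x * of_real (cut N x))"])
      show "AE x in lborel. (\<lambda>n. (h x * of_real (cut N x)) * q n x) \<longlonglongrightarrow> (h x * of_real (cut N x)) * u x"
        using qlim by eventually_elim (intro tendsto_intros)
      show "AE x in lborel. norm ((h x * of_real (cut N x)) * q n x) \<le> norm (h x * of_real (cut N x))" for n
        using q(2) by (auto simp: norm_mult intro!: AE_I2 mult_left_le)
    qed (use i in auto)
    moreover have "(\<integral>x. (h x * of_real (cut N x)) * q n x \<partial>lborel) = 0" for n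
      unfolding cut_def by (rule orth[OF q])
    ultimately have "(\<integral>x. (h x * of_real (cut N x)) * u x \<partial>lborel) = 0"
      by (simp add: LIMSEQ_const_iff)
    moreover have "(h x * of_real (cut N x)) * u x = of_real (cmod (h x) * cut N x)" for x
    proof -
      have "h x * u x = of_real (cmod (h x))"
        using complex_norm_square[of "h x"]
        by (cases "h x = 0") (simp_all add: u_def sgn_eq power2_eq_square field_simps)
      then show ?thesis by (simp add: mult_ac)
    qed
    ultimately have "complex_of_real (\<integral>x. cmod (h x) * cut N x \<partial>lborel) = 0"
      by (simp only: integral_complex_of_real)
    then have z: "(\<integral>x. cmod (h x) * cut N x \<partial>lborel) = 0" by (simp only: of_real_eq_0_iff)
    have pos: "0 \<le> cmod (h x) * cut N x" for x by (simp add: cut_def)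
    have "integrable lborel (\<lambda>x. cmod (h x) * cut N x)"
      using integrable_norm[OF i] by (simp add: norm_mult cut_def)
    then show ?thesis using z pos by (subst (asm) integral_nonneg_eq_0_iff_AE) auto
  qed
  then have "AE x in lborel. \<forall>N. cmod (h x) * cut N x = 0" unfolding AE_all_countable by blast
  then show ?thesis
  proof eventually_elim
    fix x assume "\<forall>N. cmod (h x) * cut N x = 0"
    moreover have "cut (nat \<lceil>\<bar>x\<bar> + 1\<rceil>) x = 1"
    proof -
      have "real (nat \<lceil>\<bar>x\<bar> + 1\<rceil>) \<ge> \<bar>x\<bar> + 1" by linarith
      then show ?thesis by (simp add: cut_def)
    qed
    ultimately show "h x = 0" by (metis mult.right_neutral norm_eq_zero)
  qed
qed

text \<open>The weak identity says that the difference of \<open>f\<close> and the inverse transform is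
  orthogonal to every compactly supported continuous function.\<close>
lemma fourier_inversion:
  fixes f :: "real \<Rightarrow> complex"
  defines "K \<equiv> \<lambda>w. \<integral>x. f x * wave (- w * x) \<partial>lborel"
  assumes f: "integrable lborel f" and K: "integrable lborel K"
  shows "AE x in lborel. f x = inv_fourier K x"
proof -
  note [measurable] = borel_measurable_integrable[OF f] borel_measurable_integrable[OF K]
  define J where "J y = inv_fourier K y" for y
  have Jm[measurable]: "J \<in> borel_measurable borel"
    unfolding J_def[abs_def] by (rule lborel.borel_measurable_lebesgue_integral) measurable
  have JB: "cmod (J y) \<le> (\<integral>w. norm (K w) \<partial>lborel)" for y
    unfolding J_def by (rule order_trans[OF integral_norm_bound]) (simp add: norm_mult wave_simps)
  define cut where "cut N x = complex_of_real (max 0 (min 1 (real N - \<bar>x\<bar>)))" for N x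
  have cutc: "continuous_on UNIV (cut N)" for N
    unfolding cut_def by (intro continuous_intros)
  have [measurable]: "cut N \<in> borel_measurable borel" for N
    by (rule borel_measurable_continuous_onI[OF cutc])
  have cutb: "cmod (cut N x) \<le> 1" for N x by (auto simp: cut_def)
  have cuti: "integrable lborel (cut N)" for N
  proof (rule Bochner_Integration.integrable_bound[of _ "\<lambda>x. indicator {- real N..real N} x :: real"])
    show "AE x in lborel. norm (cut N x) \<le> norm (indicator {- real N..real N} x :: real)"
      by (intro AE_I2) (auto simp: cut_def indicator_def)
  qed (auto simp: emeasure_lborel_Icc_eq)
  have 1: "integrable lborel (\<lambda>x. f x * (cut N x * q x))"
    if [measurable]: "q \<in> borel_measurable borel" and "\<And>x. cmod (q x) \<le> 1" for N q
    by (rule integrable_mult_bounded[OF f, where B = 1])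
       (use that cutb in \<open>auto simp: norm_mult intro!: mult_le_one\<close>)
  have 2: "integrable lborel (\<lambda>x. cut N x * q x)"
    if [measurable]: "q \<in> borel_measurable borel" and "\<And>x. cmod (q x) \<le> 1" for N q
    by (rule integrable_mult_bounded[OF cuti]) (use that in auto)
  have 3: "integrable lborel (\<lambda>x. (cut N x * q x) * J x)"
    if [measurable]: "q \<in> borel_measurable borel" and "\<And>x. cmod (q x) \<le> 1" for N q
    by (rule integrable_mult_bounded[OF 2[OF that], where B = "\<integral>w. norm (K w) \<partial>lborel"]) (use JB in auto)
  have "AE x in lborel. f x - J x = 0"
  proof (rule AE_eq_0_if_orthogonal_to_continuous, unfold cut_def[symmetric])
    show "integrable lborel (\<lambda>x. (f x - J x) * cut N x)" for N
      using Bochner_Integration.integrable_diff[OF 1[of "\<lambda>_. 1" N] 3[of "\<lambda>_. 1" N]]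
      by (simp add: algebra_simps)
  next
    fix q :: "real \<Rightarrow> complex" and N assume q: "continuous_on UNIV q" "\<And>x. cmod (q x) \<le> 1"
    have qm: "q \<in> borel_measurable borel" by (rule borel_measurable_continuous_onI[OF q(1)])
    have "(\<integral>x. f x * (cut N x * q x) \<partial>lborel) = (\<integral>x. (cut N x * q x) * J x \<partial>lborel)"
      unfolding J_def K_def
      by (rule fourier_inversion_weak[OF f K[unfolded K_def], where B = 1])
         (use 2[OF qm q(2)] cutb q in \<open>auto intro!: continuous_intros cutc simp: norm_mult mult_le_one\<close>)
    then have "(\<integral>x. f x * (cut N x * q x) - (cut N x * q x) * J x \<partial>lborel) = 0"
      using 1[OF qm q(2), of N] 3[OF qm q(2), of N] by simp
    then show "(\<integral>x. ((f x - J x) * cut N x) * q x \<partial>lborel) = 0"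
      by (simp add: algebra_simps)
  qed measurable
  then show ?thesis unfolding J_def by simp
qed

section \<open>Periodization\<close>

interpretation unit_interval: finite_measure unit_interval
  by (rule finite_measure_unit_interval)

interpretation int_count: sigma_finite_measure "zcount"
  by (rule sigma_finite_measure_count_space)

interpretation unit_int: pair_sigma_finite unit_interval "zcount" ..

text \<open>The line is the disjoint union of the integer translates of the half-open unit interval.\<close>
lemma nn_integral_lborel_eq_periodization:
  fixes G :: "real \<Rightarrow> ennreal"
  assumes [measurable]: "G \<in> borel_measurable borel"
  shows "(\<integral>\<^sup>+x. G x \<partial>lborel) = (\<integral>\<^sup>+x. \<integral>\<^sup>+n. G (x + of_int n) \<partial>zcount \<partial>unit_interval)"
proof -
  have one: "(\<integral>\<^sup>+n. c * indicator {of_int n..<of_int n + 1} x \<partial>zcount) = c" for x :: real and c :: ennreal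
  proof -
    have "(\<integral>\<^sup>+n. c * indicator {of_int n..<of_int n + 1} x \<partial>zcount) =
        (\<integral>\<^sup>+n. c * indicator {\<lfloor>x\<rfloor>} n \<partial>zcount)"
    proof (intro nn_integral_cong)
      fix n :: int
      have "of_int n \<le> x \<and> x < of_int n + 1 \<longleftrightarrow> n = \<lfloor>x\<rfloor>" by linarith
      then show "c * indicator {of_int n..<of_int n + 1} x = c * indicator {\<lfloor>x\<rfloor>} n"
        by (simp add: indicator_def)
    qed
    also have "\<dots> = c"
      by (simp add: nn_integral_count_space_indicator[symmetric] nn_integral_count_space_finite)
    finally show ?thesis .
  qed
  have "(\<integral>\<^sup>+x. G x \<partial>lborel) = (\<integral>\<^sup>+x. \<integral>\<^sup>+n. G x * indicator {of_int n..<of_int n + 1} x \<partial>zcount \<partial>lborel)"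
    by (simp add: one)
  also have "\<dots> = (\<integral>\<^sup>+n. \<integral>\<^sup>+x. G x * indicator {of_int n..<of_int n + 1} x \<partial>lborel \<partial>zcount)"
    by (rule nn_integral_count_space_nn_integral) auto
  also have "\<dots> = (\<integral>\<^sup>+n. \<integral>\<^sup>+x. G (x + of_int n) * indicator {0..1} x \<partial>lborel \<partial>zcount)"
  proof (rule nn_integral_cong)
    fix n :: int
    have "(\<integral>\<^sup>+x. G x * indicator {of_int n..<of_int n + 1} x \<partial>lborel) =
        (\<integral>\<^sup>+x. G (of_int n + 1 * x) * indicator {of_int n..<of_int n + 1} (of_int n + 1 * x) \<partial>lborel)"
      by (subst nn_integral_real_affine[where c = 1 and t = "of_int n"]) auto
    also have "\<dots> = (\<integral>\<^sup>+x. G (x + of_int n) * indicator {0..1} x \<partial>lborel)"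
    proof (rule nn_integral_cong_AE)
      show "AE x in lborel. G (of_int n + 1 * x) * indicator {of_int n..<of_int n + 1} (of_int n + 1 * x) =
          G (x + of_int n) * indicator {0..1} x"
        using AE_lborel_singleton[of "1::real"] by eventually_elim (auto simp: indicator_def add.commute)
    qed
    finally show "(\<integral>\<^sup>+x. G x * indicator {of_int n..<of_int n + 1} x \<partial>lborel) =
        (\<integral>\<^sup>+x. G (x + of_int n) * indicator {0..1} x \<partial>lborel)" .
  qed
  also have "\<dots> = (\<integral>\<^sup>+x. \<integral>\<^sup>+n. G (x + of_int n) * indicator {0..1} x \<partial>zcount \<partial>lborel)"
    by (rule nn_integral_count_space_nn_integral[symmetric]) auto
  also have "\<dots> = (\<integral>\<^sup>+x. (\<integral>\<^sup>+n. G (x + of_int n) \<partial>zcount) * indicator {0..1} x \<partial>lborel)"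
    by (simp add: nn_integral_multc)
  also have "\<dots> = (\<integral>\<^sup>+x. \<integral>\<^sup>+n. G (x + of_int n) \<partial>zcount \<partial>unit_interval)"
    by (simp add: nn_integral_restrict_space)
  finally show ?thesis .
qed

lemma nn_integral_lborel_eq_scaled_periodization:
  fixes G :: "real \<Rightarrow> ennreal"
  assumes [measurable]: "G \<in> borel_measurable borel" and p: "p > 0"
  shows "(\<integral>\<^sup>+x. G x \<partial>lborel) =
    ennreal p * (\<integral>\<^sup>+x. \<integral>\<^sup>+n. G (p * (x + of_int n)) \<partial>zcount \<partial>unit_interval)"
proof -
  have "(\<integral>\<^sup>+x. G x \<partial>lborel) = ennreal \<bar>p\<bar> * (\<integral>\<^sup>+x. G (0 + p * x) \<partial>lborel)"
    by (rule nn_integral_real_affine) (use p in auto)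
  also have "(\<integral>\<^sup>+x. G (0 + p * x) \<partial>lborel) = (\<integral>\<^sup>+x. G (p * x) \<partial>lborel)" by simp
  also have "\<dots> = (\<integral>\<^sup>+x. \<integral>\<^sup>+n. G (p * (x + of_int n)) \<partial>zcount \<partial>unit_interval)"
    by (rule nn_integral_lborel_eq_periodization) measurable
  finally show ?thesis using p by simp
qed

lemma measurable_shift_int[measurable]:
  "(\<lambda>(x, n). x + of_int n :: real) \<in> borel_measurable (unit_interval \<Otimes>\<^sub>M zcount)"
proof -
  have "(\<lambda>x. x) \<in> borel_measurable unit_interval"
    by (rule measurable_restrict_space1) simp
  from measurable_compose[OF measurable_fst this]
  have [measurable]: "fst \<in> borel_measurable (unit_interval \<Otimes>\<^sub>M zcount)" .
  have [measurable]: "(\<lambda>z. real_of_int (snd z)) \<in> borel_measurable (unit_interval \<Otimes>\<^sub>M zcount)"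
    by (rule measurable_compose[OF measurable_snd]) simp
  show ?thesis unfolding case_prod_unfold by measurable
qed

text \<open>The same decomposition as an equality of measures, so that it transfers to complex
  integrands.\<close>
lemma lborel_eq_distr_unit_interval_int:
  "lborel = distr (unit_interval \<Otimes>\<^sub>M zcount) borel (\<lambda>(x, n :: int). x + of_int n)"
proof (rule measure_eqI)
  fix A :: "real set" assume "A \<in> sets lborel"
  then have [measurable]: "A \<in> sets borel" by simp
  let ?P = "unit_interval \<Otimes>\<^sub>M zcount"
  have "emeasure (distr ?P borel (\<lambda>(x, n). x + of_int n)) A =
      (\<integral>\<^sup>+z. indicator A z \<partial>distr ?P borel (\<lambda>(x, n). x + of_int n))"
    by simp
  also have "\<dots> = (\<integral>\<^sup>+z. indicator A ((\<lambda>(x, n). x + of_int n) z) \<partial>?P)"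
    by (rule nn_integral_distr) measurable
  also have "\<dots> = (\<integral>\<^sup>+x. \<integral>\<^sup>+n. indicator A ((\<lambda>(x, n). x + of_int n) (x, n)) \<partial>zcount \<partial>unit_interval)"
    by (rule int_count.nn_integral_fst[symmetric]) measurable
  also have "\<dots> = (\<integral>\<^sup>+z. indicator A z \<partial>lborel)"
    by (subst nn_integral_lborel_eq_periodization) auto
  finally show "emeasure lborel A = emeasure (distr ?P borel (\<lambda>(x, n). x + of_int n)) A" by simp
qed simp

lemma integral_lborel_eq_periodization:
  fixes F :: "real \<Rightarrow> complex"
  assumes F: "integrable lborel F"
  shows "(\<integral>x. F x \<partial>lborel) = (\<integral>x. (\<integral>n. F (x + of_int n) \<partial>zcount) \<partial>unit_interval)"
proof -
  let ?P = "unit_interval \<Otimes>\<^sub>M zcount"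
  note [measurable] = borel_measurable_integrable[OF F, simplified]
  have i: "integrable ?P (\<lambda>z. F ((\<lambda>(x, n). x + of_int n) z))"
    using F by (subst (asm) lborel_eq_distr_unit_interval_int) (rule integrable_distr[rotated], auto)
  have "(\<integral>x. F x \<partial>lborel) = (\<integral>z. F ((\<lambda>(x, n). x + of_int n) z) \<partial>?P)"
    by (subst lborel_eq_distr_unit_interval_int) (rule integral_distr, auto)
  also have "\<dots> = (\<integral>x. (\<integral>n. F ((\<lambda>(x, n). x + of_int n) (x, n)) \<partial>zcount) \<partial>unit_interval)"
    by (rule unit_int.integral_fst'[OF i, symmetric])
  finally show ?thesis by simp
qed

lemma borel_measurable_integral_int:
  fixes F :: "real \<Rightarrow> int \<Rightarrow> complex"
  assumes "\<And>n. (\<lambda>x. F x n) \<in> borel_measurable borel"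
  shows "(\<lambda>x. \<integral>n. F x n \<partial>zcount) \<in> borel_measurable borel"
proof (rule int_count.borel_measurable_lebesgue_integral)
  have "(\<lambda>z. F (snd z) (fst z)) \<in> borel_measurable (zcount \<Otimes>\<^sub>M borel)"
    by (rule measurable_pair_measure_countable1) (use assms in auto)
  from measurable_compose[OF measurable_pair_swap' this]
  show "(\<lambda>(x, n). F x n) \<in> borel_measurable (borel \<Otimes>\<^sub>M zcount)"
    by (simp add: case_prod_unfold)
qed

lemma integrable_if_periodization_bounded:
  fixes F :: "real \<Rightarrow> complex"
  assumes Fm[measurable]: "F \<in> borel_measurable borel" and p: "p > 0"
    and bd: "\<And>x. x \<in> {0..1} \<Longrightarrow> (\<integral>\<^sup>+n. ennreal (cmod (F (p * (x + of_int n)))) \<partial>zcount) \<le> ennreal R"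
  shows "integrable lborel F"
proof -
  have "(\<integral>\<^sup>+x. ennreal (cmod (F x)) \<partial>lborel) =
      ennreal p * (\<integral>\<^sup>+x. \<integral>\<^sup>+n. ennreal (cmod (F (p * (x + of_int n)))) \<partial>zcount \<partial>unit_interval)"
    by (rule nn_integral_lborel_eq_scaled_periodization) (use p in auto)
  also have "\<dots> \<le> ennreal p * (\<integral>\<^sup>+x. ennreal R \<partial>unit_interval)"
    by (intro mult_left_mono nn_integral_mono bd) (auto simp: space_restrict_space)
  also have "\<dots> < \<infinity>"
    by (simp add: ennreal_mult_less_top emeasure_restrict_space space_restrict_space)
  finally show ?thesis by (simp add: integrable_iff_bounded)
qed

text \<open>The transform of \<open>F\<close> at the frequencies \<open>m / p\<close> consists, up to the factor \<open>p\<close>, of the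
  Fourier coefficients of the \<open>p\<close>-periodization of \<open>F\<close>. Absolute convergence of the
  periodization to a bounded function is what makes Parseval's identity applicable.\<close>
lemma parseval_periodization:
  fixes F :: "real \<Rightarrow> complex"
  assumes Fm[measurable]: "F \<in> borel_measurable borel" and p: "p > 0" and R: "0 \<le> R"
    and bd: "\<And>x. x \<in> {0..1} \<Longrightarrow> (\<integral>\<^sup>+n. ennreal (cmod (F (p * (x + of_int n)))) \<partial>zcount) \<le> ennreal R"
  shows "(\<integral>\<^sup>+m. sq_norm (\<integral>x. F x * wave (- (of_int m / p) * x) \<partial>lborel) \<partial>zcount) =
    ennreal (p\<^sup>2) * (\<integral>\<^sup>+x. sq_norm (\<integral>n. F (p * (x + of_int n)) \<partial>zcount) \<partial>unit_interval)"
proof -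
  define P where "P x = (\<integral>n. F (p * (x + of_int n)) \<partial>zcount)" for x
  define u where "u x = indicator {0..1} x *\<^sub>R P x" for x
  have [measurable]: "P \<in> borel_measurable borel"
    unfolding P_def[abs_def] by (rule borel_measurable_integral_int) measurable
  have um: "u \<in> borel_measurable borel" unfolding u_def[abs_def] by measurable
  have uR: "cmod (u x) \<le> R" for x
  proof (cases "x \<in> {0..1}")
    case True
    have i: "integrable zcount (\<lambda>n :: int. F (p * (x + of_int n)))"
      using bd[OF True] by (auto simp: integrable_iff_bounded intro: le_less_trans)
    have "ennreal (cmod (P x)) \<le> ennreal R"
      unfolding P_def using integral_norm_bound_ennreal[OF i] bd[OF True] by (rule order_trans)
    then show ?thesis using True R by (simp add: u_def)
  qed (use R in \<open>simp add: u_def\<close>)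
  have Fi: "integrable lborel F" by (rule integrable_if_periodization_bounded[OF Fm p bd])
  have coeff: "(\<integral>x. F x * wave (- (of_int m / p) * x) \<partial>lborel) = of_real p * fcoeff u m" for m
  proof -
    define h where "h x = F x * wave (- (of_int m / p) * x)" for x
    have hi: "integrable lborel h"
      unfolding h_def[abs_def] by (rule integrable_mult_bounded[OF Fi, where B = 1]) (auto simp: wave_simps)
    have hip: "integrable lborel (\<lambda>x. h (p * x))"
      using lborel_integrable_real_affine[OF hi, of p 0] p by simp
    have hp: "h (p * (x + of_int n)) = F (p * (x + of_int n)) * cnj (character m x)" for x and n :: int
    proof -
      have "- (of_int m / p) * (p * (x + of_int n)) = of_int (- m) * x + of_int (- m * n)"
        using p by (simp add: field_simps)
      then show ?thesis
        unfolding h_def character_simps(2) by (simp only: wave_add wave_of_int character_eq_wave mult_1_right)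
    qed
    have "(\<integral>x. h x \<partial>lborel) = \<bar>p\<bar> *\<^sub>R (\<integral>x. h (0 + p * x) \<partial>lborel)"
      by (rule lborel_integral_real_affine) (use p in auto)
    also have "\<dots> = of_real p * (\<integral>x. h (p * x) \<partial>lborel)"
      using p by (simp add: scaleR_conv_of_real)
    also have "(\<integral>x. h (p * x) \<partial>lborel) = (\<integral>x. (\<integral>n. h (p * (x + of_int n)) \<partial>zcount) \<partial>unit_interval)"
      by (rule integral_lborel_eq_periodization[OF hip])
    also have "\<dots> = (\<integral>x. P x * cnj (character m x) \<partial>unit_interval)"
      by (simp add: hp P_def)
    also have "\<dots> = fcoeff u m"
      unfolding fcoeff_def by (rule Bochner_Integration.integral_cong) (auto simp: u_def space_restrict_space)
    finally show ?thesis unfolding h_def .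
  qed
  have "(\<integral>\<^sup>+m. sq_norm (\<integral>x. F x * wave (- (of_int m / p) * x) \<partial>lborel) \<partial>zcount) =
      (\<integral>\<^sup>+m. ennreal (p\<^sup>2) * sq_norm (fcoeff u m) \<partial>zcount)"
    unfolding coeff by (simp add: norm_mult power_mult_distrib ennreal_mult)
  also have "\<dots> = ennreal (p\<^sup>2) * (\<integral>\<^sup>+x. sq_norm (u x) \<partial>unit_interval)"
    by (simp add: nn_integral_cmult parseval[OF um uR])
  also have "(\<integral>\<^sup>+x. sq_norm (u x) \<partial>unit_interval) = (\<integral>\<^sup>+x. sq_norm (P x) \<partial>unit_interval)"
    by (rule nn_integral_cong) (auto simp: u_def space_restrict_space)
  finally show ?thesis unfolding P_def .
qed

text \<open>Cauchy-Schwarz with the weight split evenly between both factors.\<close>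
lemma integral_int_sq_le_weighted:
  fixes h :: "int \<Rightarrow> complex" and a \<rho> :: "int \<Rightarrow> real"
  assumes h: "\<And>l. cmod (h l) \<le> \<kappa> * (\<rho> l * a l)" and nn: "\<kappa> \<ge> 0" "\<And>l. \<rho> l \<ge> 0" "\<And>l. a l \<ge> 0"
  shows "sq_norm (\<integral>l. h l \<partial>zcount) \<le>
    ennreal (\<kappa>\<^sup>2) * (\<integral>\<^sup>+l. ennreal (\<rho> l) \<partial>zcount) * (\<integral>\<^sup>+l. ennreal (\<rho> l * (a l)\<^sup>2) \<partial>zcount)"
proof -
  let ?C = "zcount"
  have "ennreal (cmod (\<integral>l. h l \<partial>?C)) \<le> (\<integral>\<^sup>+l. ennreal (cmod (h l)) \<partial>?C)"
    by (cases "integrable ?C h") (auto intro: integral_norm_bound_ennreal simp: not_integrable_integral_eq)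
  also have "\<dots> \<le> (\<integral>\<^sup>+l. ennreal \<kappa> * ennreal (\<rho> l * a l) \<partial>?C)"
    using h nn by (intro nn_integral_mono) (simp add: ennreal_mult[symmetric] ennreal_leI)
  also have "\<dots> = ennreal \<kappa> * (\<integral>\<^sup>+l. ennreal (sqrt (\<rho> l)) * ennreal (sqrt (\<rho> l) * a l) \<partial>?C)"
    using nn by (subst nn_integral_cmult) (simp_all add: ennreal_mult[symmetric] mult.assoc[symmetric])
  finally have "(ennreal (cmod (\<integral>l. h l \<partial>?C)))\<^sup>2 \<le>
      (ennreal \<kappa> * (\<integral>\<^sup>+l. ennreal (sqrt (\<rho> l)) * ennreal (sqrt (\<rho> l) * a l) \<partial>?C))\<^sup>2"
    by (intro power_mono) auto
  also have "\<dots> \<le> (ennreal \<kappa>)\<^sup>2 * ((\<integral>\<^sup>+l. (ennreal (sqrt (\<rho> l)))\<^sup>2 \<partial>?C) * (\<integral>\<^sup>+l. (ennreal (sqrt (\<rho> l) * a l))\<^sup>2 \<partial>?C))"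
    unfolding power_mult_distrib by (intro mult_left_mono Cauchy_Schwarz_nn_integral) auto
  finally show ?thesis
    using nn by (simp add: ennreal_power power_mult_distrib mult.assoc)
qed

text \<open>A translation of the argument only multiplies the coefficients by unimodular numbers;
  therefore the mean square over a full period does not depend on where the period starts nor
  on \<open>w\<close>.\<close>
lemma nn_integral_trig_sum_shift:
  fixes c :: "int \<Rightarrow> complex"
  assumes N: "finite N" and b: "b > 0"
  shows "(\<integral>\<^sup>+t. sq_norm (\<Sum>n\<in>N. c n * wave (of_int n * (b * t + w))) * indicator {t0..t0 + 1 / b} t \<partial>lborel) =
    ennreal (1 / b * (\<Sum>n\<in>N. (cmod (c n))\<^sup>2))"
proof -
  define w' where "w' = b * t0 + w"
  define d where "d n = c n * wave (of_int n * w')" for n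
  define T where "T x = (cmod (\<Sum>n\<in>N. d n * character n x))\<^sup>2" for x
  have [measurable]: "T \<in> borel_measurable borel" unfolding T_def[abs_def] by measurable
  have dn: "cmod (d n) = cmod (c n)" for n by (simp add: d_def norm_mult wave_simps)
  have i: "integrable unit_interval T"
  proof (rule integrable_unit_interval[where R = "(\<Sum>n\<in>N. cmod (d n))\<^sup>2"])
    fix x
    have "cmod (\<Sum>n\<in>N. d n * character n x) \<le> (\<Sum>n\<in>N. cmod (d n))"
      by (rule order_trans[OF norm_sum]) (simp add: norm_mult character_simps)
    then show "norm (T x) \<le> (\<Sum>n\<in>N. cmod (d n))\<^sup>2" by (simp add: T_def power_mono)
  qed measurable
  have "(\<integral>\<^sup>+t. sq_norm (\<Sum>n\<in>N. c n * wave (of_int n * (b * t + w))) * indicator {t0..t0 + 1 / b} t \<partial>lborel) =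
      ennreal \<bar>1 / b\<bar> * (\<integral>\<^sup>+y. sq_norm (\<Sum>n\<in>N. c n * wave (of_int n * (b * (t0 + 1 / b * y) + w)))
        * indicator {t0..t0 + 1 / b} (t0 + 1 / b * y) \<partial>lborel)"
    by (rule nn_integral_real_affine) (use b in auto)
  also have "(\<integral>\<^sup>+y. sq_norm (\<Sum>n\<in>N. c n * wave (of_int n * (b * (t0 + 1 / b * y) + w)))
        * indicator {t0..t0 + 1 / b} (t0 + 1 / b * y) \<partial>lborel) = (\<integral>\<^sup>+y. ennreal (T y) * indicator {0..1} y \<partial>lborel)"
  proof (intro nn_integral_cong arg_cong2[where f = "(*)"])
    fix y
    have "c n * wave (of_int n * (b * (t0 + 1 / b * y) + w)) = d n * character n y" for n
    proof -
      have "of_int n * (b * (t0 + 1 / b * y) + w) = of_int n * w' + of_int n * y"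
        using b by (simp add: w'_def field_simps)
      then show ?thesis by (simp only: wave_add d_def character_eq_wave mult.assoc)
    qed
    then show "sq_norm (\<Sum>n\<in>N. c n * wave (of_int n * (b * (t0 + 1 / b * y) + w))) = ennreal (T y)"
      by (simp add: T_def)
    show "indicator {t0..t0 + 1 / b} (t0 + 1 / b * y) = (indicator {0..1} y :: ennreal)"
      using b by (auto simp: indicator_def field_simps)
  qed
  also have "\<dots> = (\<integral>\<^sup>+y. ennreal (T y) \<partial>unit_interval)"
    by (simp add: nn_integral_restrict_space)
  also have "\<dots> = ennreal (\<integral>y. T y \<partial>unit_interval)"
    by (rule nn_integral_eq_integral[OF i]) (simp add: T_def)
  also have "(\<integral>y. T y \<partial>unit_interval) = (\<Sum>n\<in>N. (cmod (c n))\<^sup>2)"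
    unfolding T_def integral_norm_trig_sum[OF N] dn ..
  finally show ?thesis using b by (simp add: ennreal_mult[symmetric] sum_nonneg)
qed

section \<open>Sampling bounds\<close>

abbreviation sample_sum ::
  "(real \<Rightarrow> complex) \<Rightarrow> real \<Rightarrow> real \<Rightarrow> int set \<Rightarrow> (int \<Rightarrow> complex) \<Rightarrow> real \<Rightarrow> ennreal" where
  "sample_sum g p \<alpha> N c x \<equiv>
    \<integral>\<^sup>+k. sq_norm (\<Sum>n\<in>N. c n * g (p * (x + of_int n) - \<alpha> * of_int k)) \<partial>zcount"

lemma steep_period_decay:
  assumes K: "steep s K" and s: "s > 0" and b: "b > 0" and t: "t \<in> {0..1}"
  shows "cmod (K (b * (t + of_int l))) \<le> cmod (K 0) * exp (s * b) * exp (- s * b) ^ nat \<bar>l\<bar>"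
proof -
  define w where "w = b * (t + of_int l)"
  have "\<bar>of_int l :: real\<bar> - 1 \<le> \<bar>t + of_int l\<bar>" using t by auto
  then have "b * (\<bar>of_int l\<bar> - 1) \<le> \<bar>w\<bar>"
    using b by (simp add: w_def abs_mult)
  then have "s * (b * (\<bar>of_int l\<bar> - 1)) \<le> s * \<bar>w\<bar>"
    using s by (intro mult_left_mono) auto
  then have "- s * (\<bar>w\<bar> - \<bar>0\<bar>) \<le> s * b + real (nat \<bar>l\<bar>) * (- s * b)"
    by (simp add: algebra_simps)
  then have e: "exp (- s * (\<bar>w\<bar> - \<bar>0\<bar>)) \<le> exp (s * b) * exp (- s * b) ^ nat \<bar>l\<bar>"
    unfolding exp_of_nat_mult[symmetric] exp_add[symmetric] by (simp only: exp_le_cancel_iff)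
  have "cmod (K w) \<le> exp (- s * (\<bar>w\<bar> - \<bar>0\<bar>)) * cmod (K 0)"
    using K[unfolded steep_def, THEN conjunct2, rule_format, of 0 w] by simp
  also have "\<dots> \<le> exp (s * b) * exp (- s * b) ^ nat \<bar>l\<bar> * cmod (K 0)"
    using e by (rule mult_right_mono) simp
  finally show ?thesis unfolding w_def by (simp add: mult_ac)
qed

text \<open>The bound is uniform over the cell, which makes periodizations of steep functions and of their
  products with bounded functions bounded.\<close>
lemma steep_periodization_bounded:
  assumes K: "steep s K" and s: "s > 0" and b: "b > 0"
  obtains R where "R \<ge> 0" "\<And>t. t \<in> {0..1} \<Longrightarrow>
    (\<integral>\<^sup>+l. ennreal (cmod (K (b * (t + of_int l)))) \<partial>zcount) \<le> ennreal R"
proof -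
  define r where "r = exp (- s * b)"
  have r: "0 \<le> r" "r < 1" using s b by (auto simp: r_def)
  define k0 where "k0 = cmod (K 0) * exp (s * b)"
  have k0: "k0 \<ge> 0" by (simp add: k0_def)
  show thesis
  proof (rule that)
    show "k0 * ((1 + r) / (1 - r)) \<ge> 0" using k0 r by simp
  next
    fix t :: real assume t: "t \<in> {0..1}"
    have "(\<integral>\<^sup>+l. ennreal (cmod (K (b * (t + of_int l)))) \<partial>zcount) \<le>
        (\<integral>\<^sup>+l. ennreal k0 * ennreal (r ^ nat \<bar>l\<bar>) \<partial>zcount)"
      unfolding r_def k0_def using steep_period_decay[OF K s b t]
      by (intro nn_integral_mono) (simp add: ennreal_mult[symmetric] ennreal_leI)
    also have "\<dots> = ennreal k0 * ennreal ((1 + r) / (1 - r))"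
      by (simp add: nn_integral_cmult nn_integral_int_geometric[OF r])
    also have "\<dots> = ennreal (k0 * ((1 + r) / (1 - r)))"
      by (rule ennreal_mult[symmetric]) (use r k0 in auto)
    finally show "(\<integral>\<^sup>+l. ennreal (cmod (K (b * (t + of_int l)))) \<partial>zcount) \<le>
      ennreal (k0 * ((1 + r) / (1 - r)))" .
  qed
qed

lemma steep_integrable:
  assumes K: "steep s K" and Km: "K \<in> borel_measurable borel" and s: "s > 0"
  shows "integrable lborel K"
  by (rule steep_periodization_bounded[OF K s zero_less_one])
     (rule integrable_if_periodization_bounded[OF Km zero_less_one])

lemma nn_integral_trig_sum_unit_interval_le:
  fixes c :: "int \<Rightarrow> complex"
  assumes N: "finite N" and b: "b > 0"
  shows "(\<integral>\<^sup>+t. sq_norm (\<Sum>n\<in>N. c n * wave (of_int n * (b * t + w))) \<partial>unit_interval) \<le>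
    ennreal (real (nat \<lceil>b\<rceil>) / b * (\<Sum>n\<in>N. (cmod (c n))\<^sup>2))"
proof -
  define T where "T t = (cmod (\<Sum>n\<in>N. c n * wave (of_int n * (b * t + w))))\<^sup>2" for t
  have [measurable]: "T \<in> borel_measurable borel" unfolding T_def[abs_def] by measurable
  define I where "I j = {real j / b..real j / b + 1 / b}" for j :: nat
  define m where "m = nat \<lceil>b\<rceil>"
  \<comment> \<open>The interval \<open>{0..1}\<close> is covered by \<open>m\<close> periods of the trigonometric sum.\<close>
  have cover: "indicator {0..1} t \<le> (\<Sum>j<m. indicator (I j) t :: ennreal)" for t :: real
  proof (cases "t \<in> {0..1}")
    case True
    have "\<exists>j<m. t \<in> I j"
    proof (cases "t = 1")
      case True
      have m: "real m \<ge> b" "real m - 1 < b" "m > 0" using b unfolding m_def by linarith+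
      have "1 \<in> I (m - 1)" using m b by (auto simp: I_def field_simps of_nat_diff)
      then show ?thesis using True m by (intro exI[of _ "m - 1"]) auto
    next
      case False
      then have t: "0 \<le> t" "t < 1" using \<open>t \<in> {0..1}\<close> by auto
      have bt: "0 \<le> b * t" "b * t < b" using t b by auto
      define j where "j = nat \<lfloor>b * t\<rfloor>"
      have j: "real j \<le> b * t" "b * t < real j + 1" using bt unfolding j_def by linarith+
      moreover have "j < m" using bt j unfolding m_def by linarith
      ultimately show ?thesis using b by (intro exI[of _ j]) (auto simp: I_def field_simps)
    qed
    then obtain j where j: "j < m" "t \<in> I j" by blast
    then have "(\<Sum>j\<in>{j}. indicator (I j) t :: ennreal) \<le> (\<Sum>j<m. indicator (I j) t)"
      by (intro sum_mono2) auto
    then show ?thesis using j True by simp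
  qed simp
  have "(\<integral>\<^sup>+t. ennreal (T t) \<partial>unit_interval) = (\<integral>\<^sup>+t. ennreal (T t) * indicator {0..1} t \<partial>lborel)"
    by (simp add: nn_integral_restrict_space)
  also have "\<dots> \<le> (\<integral>\<^sup>+t. (\<Sum>j<m. ennreal (T t) * indicator (I j) t) \<partial>lborel)"
    unfolding sum_distrib_left[symmetric] by (intro nn_integral_mono mult_left_mono cover) simp
  also have "\<dots> = (\<Sum>j<m. \<integral>\<^sup>+t. ennreal (T t) * indicator (I j) t \<partial>lborel)"
    by (rule nn_integral_sum) (auto simp: I_def)
  also have "\<dots> = (\<Sum>j<m. ennreal (1 / b * (\<Sum>n\<in>N. (cmod (c n))\<^sup>2)))"
    unfolding T_def I_def nn_integral_trig_sum_shift[OF N b] ..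
  also have "\<dots> = ennreal (real m / b * (\<Sum>n\<in>N. (cmod (c n))\<^sup>2))"
    using b by (simp add: ennreal_of_nat_eq_real_of_nat ennreal_mult[symmetric] sum_nonneg)
  finally show ?thesis unfolding T_def m_def .
qed

text \<open>By the integral representation of \<open>y \<mapsto> \<integral>w. K w * wave (w * y)\<close>, the combinations of its
  samples along \<open>\<alpha> \<int>\<close> are values at \<open>\<alpha> \<int>\<close> of the transform of \<open>H\<close>, the product of \<open>K\<close>, a phase and
  a trigonometric sum with period \<open>1 / p\<close>. Parseval's identity with period \<open>1 / \<alpha>\<close> then
  replaces the sum over \<open>k\<close> by a mean square of the periodization of \<open>H\<close>.\<close>
lemma samples_sq_sum_eq:
  fixes K :: "real \<Rightarrow> complex" and c :: "int \<Rightarrow> complex" and p x :: real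
  assumes K: "steep s K" and Km[measurable]: "K \<in> borel_measurable borel" and s: "s > 0"
    and \<alpha>: "\<alpha> > 0" and N: "finite N"
  defines "H \<equiv> \<lambda>w. K w * wave (w * (p * x)) * (\<Sum>n\<in>N. c n * wave (of_int n * (p * w)))"
  shows "sample_sum (inv_fourier K) p \<alpha> N c x =
    ennreal ((1 / \<alpha>)\<^sup>2) * (\<integral>\<^sup>+t. sq_norm (\<integral>l. H (1 / \<alpha> * (t + of_int l)) \<partial>zcount) \<partial>unit_interval)"
    (is "?L = ?R")
    and "\<And>t. t \<in> {0..1} \<Longrightarrow> integrable zcount (\<lambda>l :: int. H (1 / \<alpha> * (t + of_int l)))"
    and "H \<in> borel_measurable borel"
proof -
  have Ki: "integrable lborel K" by (rule steep_integrable[OF K Km s])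
  have [measurable]: "H \<in> borel_measurable borel" unfolding H_def by measurable
  then show "H \<in> borel_measurable borel" .
  define S where "S = (\<Sum>n\<in>N. cmod (c n))"
  have S: "S \<ge> 0" unfolding S_def by (rule sum_nonneg) simp
  have HK: "cmod (H w) \<le> cmod (K w) * S" for w
  proof -
    have "cmod (\<Sum>n\<in>N. c n * wave (of_int n * (p * w))) \<le> S"
      unfolding S_def by (rule order_trans[OF norm_sum]) (simp add: norm_mult wave_simps)
    then show ?thesis unfolding H_def by (simp add: norm_mult wave_simps mult_left_mono)
  qed
  have "1 / \<alpha> > 0" using \<alpha> by simp
  from steep_periodization_bounded[OF K s this] obtain R where R: "R \<ge> 0" and KR: "\<And>t. t \<in> {0..1} \<Longrightarrow>
    (\<integral>\<^sup>+l. ennreal (cmod (K (1 / \<alpha> * (t + of_int l)))) \<partial>zcount) \<le> ennreal R"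
    by blast
  have bd: "(\<integral>\<^sup>+l. ennreal (cmod (H (1 / \<alpha> * (t + of_int l)))) \<partial>zcount) \<le> ennreal (R * S)"
    if t: "t \<in> {0..1}" for t
  proof -
    have "(\<integral>\<^sup>+l. ennreal (cmod (H (1 / \<alpha> * (t + of_int l)))) \<partial>zcount) \<le>
        (\<integral>\<^sup>+l. ennreal (cmod (K (1 / \<alpha> * (t + of_int l)))) * ennreal S \<partial>zcount)"
      using HK S by (intro nn_integral_mono) (simp add: ennreal_mult[symmetric] ennreal_leI)
    also have "\<dots> = (\<integral>\<^sup>+l. ennreal (cmod (K (1 / \<alpha> * (t + of_int l)))) \<partial>zcount) * ennreal S"
      by (rule nn_integral_multc) simp
    also have "\<dots> \<le> ennreal R * ennreal S" by (intro mult_right_mono KR t) simp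
    also have "\<dots> = ennreal (R * S)" using R S by (simp add: ennreal_mult)
    finally show ?thesis .
  qed
  show "integrable zcount (\<lambda>l :: int. H (1 / \<alpha> * (t + of_int l)))" if "t \<in> {0..1}" for t
    using bd[OF that] by (auto simp: integrable_iff_bounded intro: le_less_trans)
  have coeff: "(\<Sum>n\<in>N. c n * inv_fourier K (p * (x + of_int n) - \<alpha> * of_int k)) =
      (\<integral>w. H w * wave (- (of_int k / (1 / \<alpha>)) * w) \<partial>lborel)" for k
  proof -
    have i: "integrable lborel (\<lambda>w. K w * wave (w * y))" for y
      by (rule integrable_mult_bounded[OF Ki, where B = 1]) (auto simp: wave_simps)
    have "(\<Sum>n\<in>N. c n * inv_fourier K (p * (x + of_int n) - \<alpha> * of_int k)) =
        (\<integral>w. (\<Sum>n\<in>N. c n * (K w * wave (w * (p * (x + of_int n) - \<alpha> * of_int k)))) \<partial>lborel)"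
      by (subst Bochner_Integration.integral_sum) (auto intro: i)
    also have "\<dots> = (\<integral>w. H w * wave (- (of_int k / (1 / \<alpha>)) * w) \<partial>lborel)"
    proof (rule Bochner_Integration.integral_cong[OF refl])
      fix w
      have "w * (p * (x + of_int n) - \<alpha> * of_int k) = (w * (p * x) + of_int n * (p * w)) + (- (of_int k / (1 / \<alpha>)) * w)" for n
        by (simp add: algebra_simps)
      then have e: "wave (w * (p * (x + of_int n) - \<alpha> * of_int k)) =
          wave (w * (p * x)) * wave (of_int n * (p * w)) * wave (- (of_int k / (1 / \<alpha>)) * w)" for n
        by (simp only: wave_add)
      show "(\<Sum>n\<in>N. c n * (K w * wave (w * (p * (x + of_int n) - \<alpha> * of_int k)))) = H w * wave (- (of_int k / (1 / \<alpha>)) * w)"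
        unfolding e H_def sum_distrib_left sum_distrib_right by (simp only: mult_ac)
    qed
    finally show ?thesis .
  qed
  show "?L = ?R"
    unfolding coeff
    by (rule parseval_periodization[where R = "R * S"]) (use \<alpha> R S bd in auto)
qed

text \<open>An interval shorter than the period meets each orbit of the integer translations
  at most once.\<close>
lemma nn_integral_periodic_cell_le:
  fixes Q :: "real \<Rightarrow> ennreal"
  assumes [measurable]: "Q \<in> borel_measurable borel" and per: "\<And>t (n :: int). Q (t + of_int n) = Q t" and d: "d < 1"
  shows "(\<integral>\<^sup>+t. Q t * indicator {t0..t0 + d} t \<partial>lborel) \<le> (\<integral>\<^sup>+t. Q t \<partial>unit_interval)"
proof -
  have one: "(\<integral>\<^sup>+n. indicator {t0..t0 + d} (t + of_int n) \<partial>zcount) \<le> (1 :: ennreal)" for t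
  proof (cases "\<exists>n0 :: int. t + of_int n0 \<in> {t0..t0 + d}")
    case True
    then obtain n0 :: int where n0: "t + of_int n0 \<in> {t0..t0 + d}" by blast
    have "indicator {t0..t0 + d} (t + of_int n) \<le> (indicator {n0} n :: ennreal)" for n :: int
    proof (cases "t + of_int n \<in> {t0..t0 + d}")
      case True
      then have "\<bar>of_int n - of_int n0 :: real\<bar> < 1" using n0 d by (auto simp: abs_if)
      then have "\<bar>of_int (n - n0) :: real\<bar> < of_int 1" by simp
      then have "n = n0" unfolding of_int_abs[symmetric] of_int_less_iff by simp
      then show ?thesis by (simp add: indicator_def)
    qed simp
    then have "(\<integral>\<^sup>+n. indicator {t0..t0 + d} (t + of_int n) \<partial>zcount) \<le>
        (\<integral>\<^sup>+n. (indicator {n0} n :: ennreal) \<partial>zcount)"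
      by (intro nn_integral_mono)
    also have "\<dots> = 1" by simp
    finally show ?thesis .
  next
    case False
    then have "indicator {t0..t0 + d} (t + of_int n) = (0 :: ennreal)" for n :: int by simp
    then show ?thesis by simp
  qed
  have "(\<integral>\<^sup>+t. Q t * indicator {t0..t0 + d} t \<partial>lborel) =
      (\<integral>\<^sup>+t. \<integral>\<^sup>+n. Q (t + of_int n) * indicator {t0..t0 + d} (t + of_int n) \<partial>zcount \<partial>unit_interval)"
    by (rule nn_integral_lborel_eq_periodization) measurable
  also have "\<dots> = (\<integral>\<^sup>+t. Q t * (\<integral>\<^sup>+n. indicator {t0..t0 + d} (t + of_int n) \<partial>zcount) \<partial>unit_interval)"
    unfolding per by (simp add: nn_integral_cmult)
  also have "\<dots> \<le> (\<integral>\<^sup>+t. Q t * 1 \<partial>unit_interval)"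
    by (intro nn_integral_mono mult_left_mono one) simp
  finally show ?thesis by simp
qed

text \<open>Every translate of the trigonometric sum has the same bound \<open>Z\<close> for its mean square
  over \<open>J\<close>, so a weighted family of translates costs only the total weight.\<close>
lemma shifted_bands_bound:
  fixes c :: "int \<Rightarrow> complex" and \<rho> :: "int \<Rightarrow> real"
  assumes N: "finite N" and b: "b > 0" and \<rho>: "\<And>l. \<rho> l \<ge> 0"
    and J: "J \<in> sets borel"
    and Z: "\<And>w. (\<integral>\<^sup>+t. sq_norm (\<Sum>n\<in>N. c n * wave (of_int n * (b * t + w))) * indicator J t \<partial>lborel) \<le> Z"
  shows "(\<integral>\<^sup>+t. (\<integral>\<^sup>+l. ennreal (\<rho> l * (cmod (\<Sum>n\<in>N. c n * wave (of_int n * (b * t + b * of_int l))))\<^sup>2)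
      \<partial>zcount) * indicator J t \<partial>lborel) \<le> (\<integral>\<^sup>+l. ennreal (\<rho> l) \<partial>zcount) * Z"
proof -
  define T where "T l t = (cmod (\<Sum>n\<in>N. c n * wave (of_int n * (b * t + b * of_int l))))\<^sup>2" for l :: int and t
  note [measurable] = J
  have [measurable]: "T l \<in> borel_measurable borel" for l unfolding T_def[abs_def] by measurable
  have "(\<integral>\<^sup>+t. (\<integral>\<^sup>+l. ennreal (\<rho> l * T l t) \<partial>zcount) * indicator J t \<partial>lborel) =
      (\<integral>\<^sup>+t. (\<integral>\<^sup>+l. ennreal (\<rho> l) * (ennreal (T l t) * indicator J t) \<partial>zcount) \<partial>lborel)"
  proof (rule nn_integral_cong)
    fix t
    show "(\<integral>\<^sup>+l. ennreal (\<rho> l * T l t) \<partial>zcount) * indicator J t =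
        (\<integral>\<^sup>+l. ennreal (\<rho> l) * (ennreal (T l t) * indicator J t) \<partial>zcount)"
      by (subst nn_integral_multc[symmetric]) (auto simp: ennreal_mult[OF \<rho>] T_def mult.assoc)
  qed
  also have "\<dots> = (\<integral>\<^sup>+l. (\<integral>\<^sup>+t. ennreal (\<rho> l) * (ennreal (T l t) * indicator J t) \<partial>lborel) \<partial>zcount)"
    by (rule nn_integral_count_space_nn_integral) auto
  also have "\<dots> = (\<integral>\<^sup>+l. ennreal (\<rho> l) * (\<integral>\<^sup>+t. ennreal (T l t) * indicator J t \<partial>lborel) \<partial>zcount)"
    by (rule nn_integral_cong) (rule nn_integral_cmult, measurable)
  also have "\<dots> \<le> (\<integral>\<^sup>+l. ennreal (\<rho> l) * Z \<partial>zcount)"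
    unfolding T_def by (intro nn_integral_mono mult_left_mono Z) simp
  also have "\<dots> = (\<integral>\<^sup>+l. ennreal (\<rho> l) \<partial>zcount) * Z"
    by (rule nn_integral_multc) simp
  finally show ?thesis unfolding T_def .
qed

text \<open>On one period the terms of the periodized \<open>H\<close> decay geometrically in \<open>l\<close>, uniformly in
  the phase; the constant \<open>B\<close> is therefore independent of \<open>x\<close> and of the coefficients.\<close>
lemma samples_sq_sum_upper:
  fixes K :: "real \<Rightarrow> complex"
  assumes K: "steep s K" and Km[measurable]: "K \<in> borel_measurable borel" and s: "s > 0"
    and \<alpha>: "\<alpha> > 0" and p: "p > 0"
  obtains B where "B > 0" "\<And>N (c :: int \<Rightarrow> complex) x. finite N \<Longrightarrow>
    sample_sum (inv_fourier K) p \<alpha> N c x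
      \<le> ennreal (B * (\<Sum>n\<in>N. (cmod (c n))\<^sup>2))"
proof -
  define b where "b = p / \<alpha>"
  have b: "b > 0" using p \<alpha> by (simp add: b_def)
  define r where "r = exp (- s * (1 / \<alpha>))"
  have r: "0 \<le> r" "r < 1" using s \<alpha> by (auto simp: r_def)
  define \<kappa> where "\<kappa> = cmod (K 0) * exp (s * (1 / \<alpha>))"
  have \<kappa>: "\<kappa> > 0" using K by (simp add: \<kappa>_def steep_def)
  define \<sigma> where "\<sigma> = (1 + r) / (1 - r)"
  have \<sigma>: "\<sigma> > 0" using r by (simp add: \<sigma>_def)
  define m where "m = real (nat \<lceil>b\<rceil>) / b"
  have m: "m > 0" using b by (simp add: m_def)
  define B where "B = (1 / \<alpha>)\<^sup>2 * (\<kappa>\<^sup>2 * \<sigma> * (\<sigma> * m))"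
  have B: "B > 0" using \<alpha> \<kappa> \<sigma> m by (simp add: B_def)
  show thesis
  proof (rule that[OF B])
    fix N :: "int set" and c :: "int \<Rightarrow> complex" and x :: real assume N: "finite N"
    define E where "E = (\<Sum>n\<in>N. (cmod (c n))\<^sup>2)"
    have E: "E \<ge> 0" unfolding E_def by (rule sum_nonneg) simp
    define H where "H w = K w * wave (w * (p * x)) * (\<Sum>n\<in>N. c n * wave (of_int n * (p * w)))" for w
    note eq = samples_sq_sum_eq[OF K Km s \<alpha> N, where c = c and p = p and x = x, folded H_def]
    define C where "C l t = cmod (\<Sum>n\<in>N. c n * wave (of_int n * (b * t + b * of_int l)))" for l :: int and t
    have pC: "p * (1 / \<alpha> * (t + of_int l)) = b * t + b * of_int l" for t and l :: int
      by (simp add: b_def distrib_left)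
    have Z: "(\<integral>\<^sup>+t. sq_norm (\<Sum>n\<in>N. c n * wave (of_int n * (b * t + w))) * indicator {0..1} t \<partial>lborel) \<le> ennreal (m * E)" for w
      using nn_integral_trig_sum_unit_interval_le[OF N b, of c w]
      by (simp add: nn_integral_restrict_space m_def E_def)
    have "(\<integral>\<^sup>+t. sq_norm (\<integral>l. H (1 / \<alpha> * (t + of_int l)) \<partial>zcount) \<partial>unit_interval) \<le>
       (\<integral>\<^sup>+t. ennreal (\<kappa>\<^sup>2) * ennreal \<sigma> * (\<integral>\<^sup>+l. ennreal (r ^ nat \<bar>l\<bar> * (C l t)\<^sup>2) \<partial>zcount) \<partial>unit_interval)"
    proof (rule nn_integral_mono)
      fix t assume "t \<in> space unit_interval"
      then have t: "t \<in> {0..1}" by (simp add: space_restrict_space)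
      have "cmod (H (1 / \<alpha> * (t + of_int l))) \<le> \<kappa> * (r ^ nat \<bar>l\<bar> * C l t)" for l
      proof -
        have "cmod (H (1 / \<alpha> * (t + of_int l))) = cmod (K (1 / \<alpha> * (t + of_int l))) * C l t"
          unfolding H_def pC C_def by (simp add: norm_mult wave_simps)
        also have "\<dots> \<le> (\<kappa> * r ^ nat \<bar>l\<bar>) * C l t"
          unfolding r_def \<kappa>_def
          by (intro mult_right_mono steep_period_decay[OF K s _ t]) (use \<alpha> in \<open>auto simp: C_def\<close>)
        finally show ?thesis by (simp add: mult.assoc)
      qed
      then have "sq_norm (\<integral>l. H (1 / \<alpha> * (t + of_int l)) \<partial>zcount) \<le>
          ennreal (\<kappa>\<^sup>2) * (\<integral>\<^sup>+l. ennreal (r ^ nat \<bar>l\<bar>) \<partial>zcount) *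
          (\<integral>\<^sup>+l. ennreal (r ^ nat \<bar>l\<bar> * (C l t)\<^sup>2) \<partial>zcount)"
        using \<kappa> r by (intro integral_int_sq_le_weighted) (auto simp: C_def)
      then show "sq_norm (\<integral>l. H (1 / \<alpha> * (t + of_int l)) \<partial>zcount) \<le>
          ennreal (\<kappa>\<^sup>2) * ennreal \<sigma> * (\<integral>\<^sup>+l. ennreal (r ^ nat \<bar>l\<bar> * (C l t)\<^sup>2) \<partial>zcount)"
        unfolding nn_integral_int_geometric[OF r] \<sigma>_def .
    qed
    also have "\<dots> = ennreal (\<kappa>\<^sup>2) * ennreal \<sigma> *
        (\<integral>\<^sup>+t. (\<integral>\<^sup>+l. ennreal (r ^ nat \<bar>l\<bar> * (C l t)\<^sup>2) \<partial>zcount) * indicator {0..1} t \<partial>lborel)"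
    proof -
      define S where "S t = (\<integral>\<^sup>+l. ennreal (r ^ nat \<bar>l\<bar> * (C l t)\<^sup>2) \<partial>zcount)" for t
      have [measurable]: "S \<in> borel_measurable borel"
        unfolding S_def[abs_def] C_def by (rule borel_measurable_nn_integral_int) measurable
      show ?thesis
        unfolding S_def[symmetric]
        by (subst nn_integral_restrict_space) (auto simp: mult.assoc nn_integral_cmult)
    qed
    also have "\<dots> \<le> ennreal (\<kappa>\<^sup>2) * ennreal \<sigma> * ((\<integral>\<^sup>+l. ennreal (r ^ nat \<bar>l\<bar>) \<partial>zcount) * ennreal (m * E))"
      unfolding C_def using r by (intro mult_left_mono shifted_bands_bound[OF N b] Z) auto
    also have "\<dots> = ennreal (\<kappa>\<^sup>2 * \<sigma> * (\<sigma> * (m * E)))"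
      unfolding nn_integral_int_geometric[OF r] \<sigma>_def[symmetric]
      using \<sigma> m E by (simp add: ennreal_mult[symmetric])
    finally have "ennreal ((1 / \<alpha>)\<^sup>2) * (\<integral>\<^sup>+t. sq_norm (\<integral>l. H (1 / \<alpha> * (t + of_int l)) \<partial>zcount) \<partial>unit_interval)
      \<le> ennreal ((1 / \<alpha>)\<^sup>2) * ennreal (\<kappa>\<^sup>2 * \<sigma> * (\<sigma> * (m * E)))"
      by (rule mult_left_mono) simp
    also have "\<dots> = ennreal (B * E)"
      using \<alpha> \<sigma> m E by (simp add: ennreal_mult[symmetric] B_def mult_ac)
    finally show "sample_sum (inv_fourier K) p \<alpha> N c x
      \<le> ennreal (B * (\<Sum>n\<in>N. (cmod (c n))\<^sup>2))"
      unfolding eq(1) E_def[symmetric] .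
  qed
qed

text \<open>On the band \<open>\<bar>w\<bar> \<le> 1 / (2 p)\<close>, whose length is less than the period \<open>1 / \<alpha>\<close>, the
  modulus of \<open>K\<close> is at least its value \<open>\<kappa>\<close> at the edge. The translate of the band by \<open>l / \<alpha>\<close> with
  \<open>l \<noteq> 0\<close> lies outside of it at distance at least \<open>\<bar>l\<bar> (1 / \<alpha> - 1 / p)\<close> from the edge, so there the modulus
  is at most \<open>\<kappa> q ^ \<bar>l\<bar>\<close> with \<open>q = exp (- s (1 / \<alpha> - 1 / p))\<close>. The trigonometric sum has the same mean square over every
  translate of the band because the band is one of its periods. Hence for small \<open>q\<close> the term
  \<open>l = 0\<close> dominates the periodization of \<open>H\<close> in mean square on the band.\<close>
lemma samples_sq_sum_lower:
  fixes K :: "real \<Rightarrow> complex"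
  assumes K: "steep s K" and Km[measurable]: "K \<in> borel_measurable borel" and s: "s > 0"
    and \<alpha>: "\<alpha> > 0" and p: "\<alpha> < p" and small: "exp (- s * (1 / \<alpha> - 1 / p)) \<le> 1 / 5"
  obtains A where "A > 0" "\<And>N (c :: int \<Rightarrow> complex) x. finite N \<Longrightarrow>
    ennreal (A * (\<Sum>n\<in>N. (cmod (c n))\<^sup>2)) \<le> sample_sum (inv_fourier K) p \<alpha> N c x"
proof -
  have p0: "p > 0" using \<alpha> p by simp
  define b where "b = p / \<alpha>"
  have b: "b > 1" using p \<alpha> by (simp add: b_def)
  define \<delta> where "\<delta> = 1 / \<alpha> - 1 / p"
  have \<delta>: "\<delta> > 0" using p \<alpha> by (simp add: \<delta>_def frac_less2)
  define q where "q = exp (- s * \<delta>)"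
  have q: "0 \<le> q" "q \<le> 1 / 5" using small by (simp_all add: q_def \<delta>_def)
  define \<kappa> where "\<kappa> = cmod (K (1 / (2 * p)))"
  have \<kappa>: "\<kappa> > 0" using K by (simp add: \<kappa>_def steep_def)
  define \<rho> where "\<rho> l = (if l = 0 then 0 else q ^ nat \<bar>l\<bar>)" for l :: int
  have \<rho>: "\<rho> l \<ge> 0" for l using q by (simp add: \<rho>_def)
  \<comment> \<open>With \<open>q \<le> 1 / 5\<close> the off-centre weights add up to \<open>2 q / (1 - q) \<le> 1 / 2\<close>.\<close>
  have \<sigma>: "(\<integral>\<^sup>+l. ennreal (\<rho> l) \<partial>zcount) \<le> ennreal (1 / 2)"
  proof -
    have "(\<integral>\<^sup>+l. ennreal (\<rho> l) \<partial>zcount) + 1 =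
        (\<integral>\<^sup>+l. ennreal (\<rho> l) + indicator {0} l \<partial>zcount)"
      by (subst nn_integral_add) auto
    also have "\<dots> = (\<integral>\<^sup>+l. ennreal (q ^ nat \<bar>l\<bar>) \<partial>zcount)"
      by (rule nn_integral_cong) (simp add: \<rho>_def indicator_def)
    also have "\<dots> = ennreal ((1 + q) / (1 - q))"
      by (rule nn_integral_int_geometric) (use q in auto)
    also have "\<dots> \<le> ennreal (3 / 2)"
      using q by (intro ennreal_leI) (simp add: field_simps)
    finally have le: "(\<integral>\<^sup>+l. ennreal (\<rho> l) \<partial>zcount) + 1 \<le> ennreal (3 / 2)" .
    show ?thesis
    proof (cases "\<integral>\<^sup>+l. ennreal (\<rho> l) \<partial>zcount")
      case (real z)
      then have "ennreal (z + 1) \<le> ennreal (3 / 2)" using le by (simp add: ennreal_plus)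
      then have "z \<le> 1 / 2" by (subst (asm) ennreal_le_iff) auto
      then show ?thesis unfolding real(2) by (rule ennreal_leI)
    qed (use le in \<open>simp add: top_unique\<close>)
  qed
  define t0 where "t0 = - (1 / (2 * b))"
  define J where "J = {t0..t0 + 1 / b}"
  have J: "J \<in> sets borel" by (simp add: J_def)
  have tJ: "\<bar>1 / \<alpha> * t\<bar> \<le> 1 / (2 * p)" if "t \<in> J" for t
  proof -
    have "\<bar>t\<bar> \<le> 1 / (2 * b)" using that b by (auto simp: J_def t0_def abs_le_iff field_simps)
    then have "1 / \<alpha> * \<bar>t\<bar> \<le> 1 / \<alpha> * (1 / (2 * b))" using \<alpha> by (intro mult_left_mono) auto
    also have "\<dots> = 1 / (2 * p)" using \<alpha> p0 by (simp add: b_def)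
    finally show ?thesis using \<alpha> by (simp add: abs_mult)
  qed
  have K0: "cmod (K (1 / \<alpha> * t)) \<ge> \<kappa>" if "t \<in> J" for t
    unfolding \<kappa>_def using steep_le[OF K, of "1 / \<alpha> * t" "1 / (2 * p)"] tJ[OF that] s p0 by simp
  have Kl: "cmod (K (1 / \<alpha> * (t + of_int l))) \<le> \<kappa> * q ^ nat \<bar>l\<bar>" if t: "t \<in> J" and l: "l \<noteq> 0" for t and l :: int
  proof -
    define u where "u = 1 / \<alpha> * (t + of_int l)"
    have l1: "\<bar>of_int l :: real\<bar> \<ge> 1" using l by linarith
    have "1 / \<alpha> * of_int l = u - 1 / \<alpha> * t" by (simp add: u_def distrib_left)
    then have "\<bar>1 / \<alpha> * of_int l\<bar> \<le> \<bar>u\<bar> + \<bar>1 / \<alpha> * t\<bar>" by (metis abs_triangle_ineq4)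
    then have 1: "1 / \<alpha> * \<bar>of_int l\<bar> \<le> \<bar>u\<bar> + 1 / (2 * p)"
      using tJ[OF t] \<alpha> by (simp add: abs_mult)
    have "1 / p \<le> 1 / p * \<bar>of_int l\<bar>" using l1 p0 by (simp add: divide_right_mono)
    then have 2: "\<delta> * \<bar>of_int l\<bar> \<le> \<bar>u\<bar> - 1 / (2 * p)"
      using 1 by (simp add: \<delta>_def left_diff_distrib)
    have "0 \<le> \<delta> * \<bar>of_int l\<bar>" using \<delta> by simp
    then have "\<bar>1 / (2 * p)\<bar> \<le> \<bar>u\<bar>" using 2 p0 by simp
    then have "cmod (K u) \<le> exp (- s * (\<bar>u\<bar> - \<bar>1 / (2 * p)\<bar>)) * \<kappa>"
      using K[unfolded steep_def, THEN conjunct2, rule_format, of "1 / (2 * p)" u] by (simp add: \<kappa>_def)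
    also have "\<dots> \<le> q ^ nat \<bar>l\<bar> * \<kappa>"
    proof (rule mult_right_mono)
      have "s * (\<delta> * \<bar>of_int l\<bar>) \<le> s * (\<bar>u\<bar> - \<bar>1 / (2 * p)\<bar>)"
        using 2 s p0 by (intro mult_left_mono) auto
      then have "- s * (\<bar>u\<bar> - \<bar>1 / (2 * p)\<bar>) \<le> real (nat \<bar>l\<bar>) * (- s * \<delta>)"
        by (simp add: algebra_simps)
      then show "exp (- s * (\<bar>u\<bar> - \<bar>1 / (2 * p)\<bar>)) \<le> q ^ nat \<bar>l\<bar>"
        unfolding q_def exp_of_nat_mult[symmetric] by (simp only: exp_le_cancel_iff)
    qed (use \<kappa> in simp)
    finally show ?thesis by (simp add: u_def mult.commute)
  qed
  define A where "A = (1 / \<alpha>)\<^sup>2 * (\<kappa>\<^sup>2 / 4 / b)"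
  have A: "A > 0" using \<alpha> \<kappa> b by (simp add: A_def)
  show thesis
  proof (rule that[OF A])
    fix N :: "int set" and c :: "int \<Rightarrow> complex" and x :: real assume N: "finite N"
    define E where "E = (\<Sum>n\<in>N. (cmod (c n))\<^sup>2)"
    have E: "E \<ge> 0" unfolding E_def by (rule sum_nonneg) simp
    define H where "H w = K w * wave (w * (p * x)) * (\<Sum>n\<in>N. c n * wave (of_int n * (p * w)))" for w
    note eq = samples_sq_sum_eq[OF K Km s \<alpha> N, where c = c and p = p and x = x, folded H_def]
    note [measurable] = eq(3)
    define C where "C l t = cmod (\<Sum>n\<in>N. c n * wave (of_int n * (b * t + b * of_int l)))" for l :: int and t
    have Cm[measurable]: "C l \<in> borel_measurable borel" for l unfolding C_def[abs_def] by measurable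
    have pC: "p * (1 / \<alpha> * (t + of_int l)) = b * t + b * of_int l" for t and l :: int
      by (simp add: b_def distrib_left)
    have HC: "cmod (H (1 / \<alpha> * (t + of_int l))) = cmod (K (1 / \<alpha> * (t + of_int l))) * C l t" for t l
      unfolding H_def pC C_def by (simp add: norm_mult wave_simps)
    define P where "P t = (\<integral>l. H (1 / \<alpha> * (t + of_int l)) \<partial>zcount)" for t
    have [measurable]: "P \<in> borel_measurable borel"
      unfolding P_def[abs_def] by (rule borel_measurable_integral_int) measurable
    \<comment> \<open>Periodicity allows the band centred at \<open>0\<close> to be compared with the cell \<open>{0..1}\<close>.\<close>
    have Pper: "P (t + of_int n) = P t" for t and n :: int
    proof -
      have "bij_betw (\<lambda>l. l + n) UNIV UNIV"
        by (rule bij_betw_byWitness[where f' = "\<lambda>l. l - n"]) auto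
      from integral_bij_count_space[OF this, of "\<lambda>l. H (1 / \<alpha> * (t + of_int l))"]
      show ?thesis by (simp add: P_def add_ac)
    qed
    define Z where "Z = 1 / b * E"
    have Z0: "Z \<ge> 0" using b E by (simp add: Z_def)
    have Z: "(\<integral>\<^sup>+t. sq_norm (\<Sum>n\<in>N. c n * wave (of_int n * (b * t + w))) * indicator J t \<partial>lborel) = ennreal Z" for w
      using nn_integral_trig_sum_shift[OF N, of b c w t0] b by (simp add: J_def Z_def E_def)
    have ptw: "ennreal (\<kappa>\<^sup>2 * (C 0 t)\<^sup>2) \<le> 2 * sq_norm (P t)
        + ennreal (\<kappa>\<^sup>2) * (\<integral>\<^sup>+l. ennreal (\<rho> l * (C l t)\<^sup>2) \<partial>zcount)" if t: "t \<in> J" for t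
    proof -
      have i: "integrable zcount (\<lambda>l :: int. H (1 / \<alpha> * (t + of_int l)))"
      proof -
        define n where "n = \<lfloor>t\<rfloor>"
        have "t - of_int n \<in> {0..1}" unfolding n_def by (simp; linarith)
        then have "integrable zcount (\<lambda>l :: int. H (1 / \<alpha> * (t - of_int n + of_int l)))"
          by (rule eq(2))
        moreover have "bij_betw (\<lambda>l. l - n) UNIV UNIV"
          by (rule bij_betw_byWitness[where f' = "\<lambda>l. l + n"]) auto
        ultimately show ?thesis
          using integrable_bij_count_space[of "\<lambda>l. l - n" UNIV UNIV "\<lambda>l. H (1 / \<alpha> * (t + of_int l))"]
          by (simp add: algebra_simps)
      qed
      \<comment> \<open>The periodization splits into its central term \<open>h0\<close> and the sum \<open>h\<close> of all other terms.\<close>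
      define h where "h l = (if l = 0 then 0 else H (1 / \<alpha> * (t + of_int l)))" for l :: int
      define h0 where "h0 l = (if l = 0 then H (1 / \<alpha> * t) else 0)" for l :: int
      have i0: "integrable zcount h0"
      proof -
        have "integrable zcount (\<lambda>l. indicator {0} l *\<^sub>R H (1 / \<alpha> * t))" by simp
        moreover have "h0 = (\<lambda>l. indicator {0} l *\<^sub>R H (1 / \<alpha> * t))" by (auto simp: h0_def indicator_def)
        ultimately show ?thesis by simp
      qed
      have v0: "(\<integral>l. h0 l \<partial>zcount) = H (1 / \<alpha> * t)"
        by (subst lebesgue_integral_count_space_finite_support) (auto simp: h0_def)
      have "P t - H (1 / \<alpha> * t) = (\<integral>l. H (1 / \<alpha> * (t + of_int l)) - h0 l \<partial>zcount)"
        unfolding P_def v0[symmetric] using i i0 by simp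
      also have "\<dots> = (\<integral>l. h l \<partial>zcount)"
        by (intro Bochner_Integration.integral_cong) (auto simp: h_def h0_def)
      finally have Ph: "H (1 / \<alpha> * t) = P t - (\<integral>l. h l \<partial>zcount)" by (simp add: algebra_simps)
      have "cmod (h l) \<le> \<kappa> * (\<rho> l * C l t)" for l
      proof (cases "l = 0")
        case False
        then have "h l = H (1 / \<alpha> * (t + of_int l))" by (simp only: h_def if_False)
        then have "cmod (h l) = cmod (K (1 / \<alpha> * (t + of_int l))) * C l t" by (simp only: HC)
        also have "\<dots> \<le> (\<kappa> * q ^ nat \<bar>l\<bar>) * C l t"
          by (intro mult_right_mono Kl[OF t False]) (simp add: C_def)
        finally show ?thesis using False by (simp add: \<rho>_def mult.assoc)
      qed (simp add: h_def \<rho>_def)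
      then have "sq_norm (\<integral>l. h l \<partial>zcount) \<le>
          ennreal (\<kappa>\<^sup>2) * (\<integral>\<^sup>+l. ennreal (\<rho> l) \<partial>zcount) * (\<integral>\<^sup>+l. ennreal (\<rho> l * (C l t)\<^sup>2) \<partial>zcount)"
        using \<kappa> \<rho> by (intro integral_int_sq_le_weighted) (auto simp: C_def)
      also have "\<dots> \<le> ennreal (\<kappa>\<^sup>2) * ennreal (1 / 2) * (\<integral>\<^sup>+l. ennreal (\<rho> l * (C l t)\<^sup>2) \<partial>zcount)"
        by (intro mult_right_mono mult_left_mono \<sigma>) auto
      finally have h2: "sq_norm (\<integral>l. h l \<partial>zcount) \<le>
          ennreal (\<kappa>\<^sup>2) * ennreal (1 / 2) * (\<integral>\<^sup>+l. ennreal (\<rho> l * (C l t)\<^sup>2) \<partial>zcount)" .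
      have "\<kappa> * C 0 t \<le> cmod (H (1 / \<alpha> * t))"
        using HC[of t 0] K0[OF t] by (simp add: C_def mult_right_mono)
      also have "\<dots> \<le> cmod (P t) + cmod (\<integral>l. h l \<partial>zcount)"
        unfolding Ph by (rule norm_triangle_ineq4)
      finally have "(\<kappa> * C 0 t)\<^sup>2 \<le> (cmod (P t) + cmod (\<integral>l. h l \<partial>zcount))\<^sup>2"
        using \<kappa> by (intro power_mono) (auto simp: C_def)
      also have "\<dots> \<le> 2 * (cmod (P t))\<^sup>2 + 2 * (cmod (\<integral>l. h l \<partial>zcount))\<^sup>2"
        using sum_squares_bound[of "cmod (P t)" "cmod (\<integral>l. h l \<partial>zcount)"] by (simp add: power2_sum)
      finally have "ennreal (\<kappa>\<^sup>2 * (C 0 t)\<^sup>2) \<le> ennreal (2 * (cmod (P t))\<^sup>2 + 2 * (cmod (\<integral>l. h l \<partial>zcount))\<^sup>2)"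
        by (intro ennreal_leI) (simp add: power_mult_distrib)
      also have "\<dots> = 2 * sq_norm (P t) + 2 * sq_norm (\<integral>l. h l \<partial>zcount)"
        by (simp add: ennreal_plus ennreal_mult)
      also have "\<dots> \<le> 2 * sq_norm (P t) +
          2 * (ennreal (\<kappa>\<^sup>2) * ennreal (1 / 2) * (\<integral>\<^sup>+l. ennreal (\<rho> l * (C l t)\<^sup>2) \<partial>zcount))"
        by (intro add_left_mono mult_left_mono h2) simp
      also have "2 * (ennreal (\<kappa>\<^sup>2) * ennreal (1 / 2) * (\<integral>\<^sup>+l. ennreal (\<rho> l * (C l t)\<^sup>2) \<partial>zcount)) =
          (ennreal 2 * ennreal (1 / 2)) * (ennreal (\<kappa>\<^sup>2) * (\<integral>\<^sup>+l. ennreal (\<rho> l * (C l t)\<^sup>2) \<partial>zcount))"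
        by (simp only: ennreal_numeral mult_ac)
      also have "ennreal 2 * ennreal (1 / 2) = 1"
        by (subst ennreal_mult[symmetric]) auto
      finally show ?thesis by simp
    qed
    have Sm[measurable]: "(\<lambda>t. \<integral>\<^sup>+l. ennreal (\<rho> l * (C l t)\<^sup>2) \<partial>zcount) \<in> borel_measurable borel"
      by (rule borel_measurable_nn_integral_int) measurable
    note [measurable] = J
    define QJ where "QJ = (\<integral>\<^sup>+t. sq_norm (P t) * indicator J t \<partial>lborel)"
    have "ennreal (\<kappa>\<^sup>2 * Z) = ennreal (\<kappa>\<^sup>2) * (\<integral>\<^sup>+t. ennreal ((C 0 t)\<^sup>2) * indicator J t \<partial>lborel)"
      using Z[of 0] Z0 by (simp add: C_def ennreal_mult)
    also have "\<dots> = (\<integral>\<^sup>+t. ennreal (\<kappa>\<^sup>2 * (C 0 t)\<^sup>2) * indicator J t \<partial>lborel)"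
      by (subst nn_integral_cmult[symmetric]) (auto simp: ennreal_mult mult.assoc)
    also have "\<dots> \<le> (\<integral>\<^sup>+t. 2 * (sq_norm (P t) * indicator J t)
        + ennreal (\<kappa>\<^sup>2) * ((\<integral>\<^sup>+l. ennreal (\<rho> l * (C l t)\<^sup>2) \<partial>zcount) * indicator J t) \<partial>lborel)"
      by (rule nn_integral_mono) (use ptw in \<open>auto simp: indicator_def\<close>)
    also have "\<dots> = 2 * QJ + ennreal (\<kappa>\<^sup>2) * (\<integral>\<^sup>+t. (\<integral>\<^sup>+l. ennreal (\<rho> l * (C l t)\<^sup>2) \<partial>zcount) * indicator J t \<partial>lborel)"
      unfolding QJ_def by (simp add: nn_integral_add nn_integral_cmult)
    also have "\<dots> \<le> 2 * QJ + ennreal (\<kappa>\<^sup>2) * ((\<integral>\<^sup>+l. ennreal (\<rho> l) \<partial>zcount) * ennreal Z)"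
    proof (intro add_left_mono mult_left_mono)
      show "(\<integral>\<^sup>+t. (\<integral>\<^sup>+l. ennreal (\<rho> l * (C l t)\<^sup>2) \<partial>zcount) * indicator J t \<partial>lborel)
          \<le> (\<integral>\<^sup>+l. ennreal (\<rho> l) \<partial>zcount) * ennreal Z"
        unfolding C_def by (rule shifted_bands_bound[OF N _ \<rho> J eq_refl[OF Z]]) (use b in simp)
    qed simp
    also have "\<dots> \<le> 2 * QJ + ennreal (\<kappa>\<^sup>2) * (ennreal (1 / 2) * ennreal Z)"
      by (intro add_left_mono mult_left_mono mult_right_mono \<sigma>) auto
    also have "ennreal (\<kappa>\<^sup>2) * (ennreal (1 / 2) * ennreal Z) = ennreal (\<kappa>\<^sup>2 * Z / 2)"
      using Z0 by (subst ennreal_mult[symmetric], simp, simp, subst ennreal_mult[symmetric]) auto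
    finally have main: "ennreal (\<kappa>\<^sup>2 * Z) \<le> 2 * QJ + ennreal (\<kappa>\<^sup>2 * Z / 2)" .
    \<comment> \<open>The off-centre part takes at most half of \<open>\<kappa>\<^sup>2 Z\<close>, and the other half bounds \<open>2 QJ\<close>.\<close>
    have "ennreal (\<kappa>\<^sup>2 * Z / 4) \<le> QJ"
    proof (cases QJ)
      case (real y)
      have "2 * QJ = ennreal (2 * y)" using real by (simp add: ennreal_mult)
      then have "ennreal (\<kappa>\<^sup>2 * Z) \<le> ennreal (2 * y + \<kappa>\<^sup>2 * Z / 2)"
        using main real Z0 by (simp add: ennreal_plus)
      then have "\<kappa>\<^sup>2 * Z \<le> 2 * y + \<kappa>\<^sup>2 * Z / 2"
        using real Z0 by (subst (asm) ennreal_le_iff) auto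
      then show ?thesis using real by (simp add: ennreal_leI)
    qed simp
    also have "QJ \<le> (\<integral>\<^sup>+t. sq_norm (P t) \<partial>unit_interval)"
      unfolding QJ_def J_def by (rule nn_integral_periodic_cell_le) (use b Pper in auto)
    finally have "ennreal ((1 / \<alpha>)\<^sup>2) * ennreal (\<kappa>\<^sup>2 * Z / 4) \<le> ennreal ((1 / \<alpha>)\<^sup>2) * (\<integral>\<^sup>+t. sq_norm (P t) \<partial>unit_interval)"
      by (rule mult_left_mono) simp
    moreover have "ennreal ((1 / \<alpha>)\<^sup>2) * ennreal (\<kappa>\<^sup>2 * Z / 4) = ennreal (A * E)"
    proof -
      have AE: "A * E = (1 / \<alpha>)\<^sup>2 * (\<kappa>\<^sup>2 * Z / 4)" by (simp add: A_def Z_def)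
      show ?thesis unfolding AE by (rule ennreal_mult[symmetric]) (use Z0 in simp_all)
    qed
    ultimately show "ennreal (A * (\<Sum>n\<in>N. (cmod (c n))\<^sup>2)) \<le> sample_sum (inv_fourier K) p \<alpha> N c x"
      unfolding eq(1) E_def[symmetric] P_def by simp
  qed
qed

section \<open>Frame bounds\<close>

abbreviation frame_sum :: "('i \<Rightarrow> real \<Rightarrow> complex) \<Rightarrow> (real \<Rightarrow> complex) \<Rightarrow> ennreal" where
  "frame_sum e f \<equiv> \<integral>\<^sup>+i. sq_norm (\<integral>x. f x * cnj (e i x) \<partial>lborel) \<partial>count_space UNIV"

text \<open>Truncation in space and in size approximates \<open>f\<close> in mean square and makes its
  coefficients converge. The upper bound passes to the limit on finite index sets; applied to the
  truncation error it then yields the lower bound, where \<open>\<bar>a - b\<bar>\<^sup>2 \<le> 2 \<bar>a\<bar>\<^sup>2 + 2 \<bar>b\<bar>\<^sup>2\<close> costs a factor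
  \<open>2\<close>.\<close>
lemma frame_bounds_extend:
  fixes e :: "'i::countable \<Rightarrow> real \<Rightarrow> complex"
  assumes inf: "infinite (UNIV :: 'i set)"
    and em[measurable]: "\<And>i. e i \<in> borel_measurable borel" and ei: "\<And>i. integrable lborel (\<lambda>x. (cmod (e i x))\<^sup>2)"
    and A: "A > 0" and B: "B > 0"
    and bounds: "\<And>f R X. f \<in> borel_measurable borel \<Longrightarrow> \<forall>x. cmod (f x) \<le> R \<Longrightarrow> \<forall>x. X < \<bar>x\<bar> \<longrightarrow> f x = 0 \<Longrightarrow>
      ennreal A * (\<integral>\<^sup>+x. sq_norm (f x) \<partial>lborel) \<le>
        frame_sum e f \<and>
      frame_sum e f \<le>
        ennreal B * (\<integral>\<^sup>+x. sq_norm (f x) \<partial>lborel)"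
    and fm: "f \<in> borel_measurable borel" and fi: "integrable lborel (\<lambda>x. (cmod (f x))\<^sup>2)"
  shows "ennreal (A / 2 * (\<integral>x. (cmod (f x))\<^sup>2 \<partial>lborel)) \<le>
      frame_sum e f" (is ?lower)
    and "frame_sum e f
      \<le> ennreal (B * (\<integral>x. (cmod (f x))\<^sup>2 \<partial>lborel))" (is ?upper)
proof -
  define ip where "ip f i = (\<integral>x. f x * cnj (e i x) \<partial>lborel)" for f i
  define n2 where "n2 f = (\<integral>x. (cmod (f x))\<^sup>2 \<partial>lborel)" for f :: "real \<Rightarrow> complex"
  define S where "S f = (\<integral>\<^sup>+i. sq_norm (ip f i) \<partial>count_space UNIV)" for f
  define tr where "tr f N x = indicator {x. \<bar>x\<bar> \<le> real N \<and> cmod (f x) \<le> real N} x *\<^sub>R f x"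
    for f :: "real \<Rightarrow> complex" and N :: nat and x
  have tr_le: "cmod (tr f N x) \<le> cmod (f x)" "cmod (f x - tr f N x) \<le> cmod (f x)" for f N x
    by (auto simp: tr_def indicator_def)
  have tr_lim: "(\<lambda>N. tr f N x) \<longlonglongrightarrow> f x" for f x
  proof (rule tendsto_eventually)
    show "eventually (\<lambda>N. tr f N x = f x) sequentially"
      using eventually_ge_at_top[of "nat \<lceil>max \<bar>x\<bar> (cmod (f x))\<rceil>"]
    proof eventually_elim
      case (elim N)
      then have "max \<bar>x\<bar> (cmod (f x)) \<le> real N" by linarith
      then show ?case by (simp add: tr_def)
    qed
  qed
  have trm: "tr f N \<in> borel_measurable borel" if [measurable]: "f \<in> borel_measurable borel" for f N
    unfolding tr_def[abs_def] by measurable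
  have nn2: "(\<integral>\<^sup>+x. sq_norm (f x) \<partial>lborel) = ennreal (n2 f)"
    if "integrable lborel (\<lambda>x. (cmod (f x))\<^sup>2)" for f :: "real \<Rightarrow> complex"
    unfolding n2_def by (rule nn_integral_eq_integral[OF that]) simp
  have dom: "integrable lborel (\<lambda>x. (cmod (g x))\<^sup>2)"
    if "integrable lborel (\<lambda>x. (cmod (f x))\<^sup>2)" "g \<in> borel_measurable borel" "\<And>x. cmod (g x) \<le> cmod (f x)"
    for f g :: "real \<Rightarrow> complex"
  proof (rule Bochner_Integration.integrable_bound[OF that(1)])
    show "(\<lambda>x. (cmod (g x))\<^sup>2) \<in> borel_measurable lborel" using that(2) by measurable
  qed (use that(3) in \<open>auto intro: power_mono\<close>)
  have prod_int: "integrable lborel (\<lambda>x. f x * cnj (e i x))"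
    if [measurable]: "f \<in> borel_measurable borel" and i: "integrable lborel (\<lambda>x. (cmod (f x))\<^sup>2)" for f i
  proof (rule Bochner_Integration.integrable_bound)
    show "integrable lborel (\<lambda>x. (cmod (f x))\<^sup>2 + (cmod (e i x))\<^sup>2)" using i ei by simp
    show "AE x in lborel. norm (f x * cnj (e i x)) \<le> norm ((cmod (f x))\<^sup>2 + (cmod (e i x))\<^sup>2)"
    proof (rule AE_I2)
      fix x
      have "2 * (cmod (f x) * cmod (e i x)) \<le> (cmod (f x))\<^sup>2 + (cmod (e i x))\<^sup>2"
        using sum_squares_bound[of "cmod (f x)" "cmod (e i x)"] by simp
      moreover have "0 \<le> cmod (f x) * cmod (e i x)" by simp
      ultimately have "cmod (f x) * cmod (e i x) \<le> (cmod (f x))\<^sup>2 + (cmod (e i x))\<^sup>2" by linarith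
      then show "norm (f x * cnj (e i x)) \<le> norm ((cmod (f x))\<^sup>2 + (cmod (e i x))\<^sup>2)"
        by (simp add: norm_mult)
    qed
  qed measurable
  have ip_lim: "(\<lambda>N. ip (tr f N) i) \<longlonglongrightarrow> ip f i"
    if f[measurable]: "f \<in> borel_measurable borel" and i: "integrable lborel (\<lambda>x. (cmod (f x))\<^sup>2)" for f i
    unfolding ip_def
  proof (rule integral_dominated_convergence[where w = "\<lambda>x. norm (f x * cnj (e i x))"])
    note [measurable] = trm[OF f]
    show "(\<lambda>x. tr f N x * cnj (e i x)) \<in> borel_measurable lborel" for N by measurable
    show "integrable lborel (\<lambda>x. norm (f x * cnj (e i x)))" using prod_int[OF f i] by simp
    show "AE x in lborel. (\<lambda>N. tr f N x * cnj (e i x)) \<longlonglongrightarrow> f x * cnj (e i x)"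
      by (intro AE_I2 tendsto_intros tr_lim)
    show "AE x in lborel. norm (tr f N x * cnj (e i x)) \<le> norm (f x * cnj (e i x))" for N
      using tr_le by (auto simp: norm_mult intro!: mult_right_mono)
  qed measurable
  have trb: "ennreal (A * n2 (tr f N)) \<le> S (tr f N)" "S (tr f N) \<le> ennreal (B * n2 (tr f N))"
    if f: "f \<in> borel_measurable borel" and i: "integrable lborel (\<lambda>x. (cmod (f x))\<^sup>2)" for f N
  proof -
    have "\<forall>x. cmod (tr f N x) \<le> real N" "\<forall>x. real N < \<bar>x\<bar> \<longrightarrow> tr f N x = 0"
      by (auto simp: tr_def indicator_def)
    note b = bounds[OF trm[OF f] this]
    have "integrable lborel (\<lambda>x. (cmod (tr f N x))\<^sup>2)"
      by (rule dom[OF i trm[OF f] tr_le(1)])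
    note e = nn2[OF this]
    have n0: "0 \<le> n2 (tr f N)" unfolding n2_def by simp
    show "ennreal (A * n2 (tr f N)) \<le> S (tr f N)" "S (tr f N) \<le> ennreal (B * n2 (tr f N))"
      using b A B n0 unfolding S_def ip_def e by (auto simp: ennreal_mult)
  qed
  have upper: "S f \<le> ennreal (B * n2 f)"
    if f: "f \<in> borel_measurable borel" and i: "integrable lborel (\<lambda>x. (cmod (f x))\<^sup>2)" for f
    unfolding S_def
  proof (rule nn_integral_count_space_le[OF inf])
    fix F :: "'i set" assume F: "finite F"
    have "(\<lambda>N. \<Sum>i\<in>F. (cmod (ip (tr f N) i))\<^sup>2) \<longlonglongrightarrow> (\<Sum>i\<in>F. (cmod (ip f i))\<^sup>2)"
      by (intro tendsto_intros ip_lim f i)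
    moreover have "(\<Sum>i\<in>F. (cmod (ip (tr f N) i))\<^sup>2) \<le> B * n2 f" for N
    proof -
      have ti: "integrable lborel (\<lambda>x. (cmod (tr f N x))\<^sup>2)" by (rule dom[OF i trm[OF f] tr_le(1)])
      have "n2 (tr f N) \<le> n2 f"
        unfolding n2_def by (rule integral_mono[OF ti i]) (intro power_mono tr_le norm_ge_zero)
      then have le: "B * n2 (tr f N) \<le> B * n2 f" using B by simp
      have "ennreal (\<Sum>i\<in>F. (cmod (ip (tr f N) i))\<^sup>2) = (\<Sum>i\<in>F. sq_norm (ip (tr f N) i))"
        by (rule sum_ennreal[symmetric]) simp
      also have "\<dots> \<le> S (tr f N)" unfolding S_def by (rule sum_le_nn_integral_count_space[OF F])
      also have "\<dots> \<le> ennreal (B * n2 (tr f N))" by (rule trb(2)[OF f i])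
      also have "\<dots> \<le> ennreal (B * n2 f)" using le by (rule ennreal_leI)
      finally show ?thesis
        using B by (subst (asm) ennreal_le_iff) (auto simp: n2_def)
    qed
    ultimately have "(\<Sum>i\<in>F. (cmod (ip f i))\<^sup>2) \<le> B * n2 f" by (intro LIMSEQ_le_const2) auto
    then show "(\<Sum>i\<in>F. sq_norm (ip f i)) \<le> ennreal (B * n2 f)"
      by (subst sum_ennreal) (auto intro: ennreal_leI)
  qed
  show ?upper using upper[OF fm fi] unfolding S_def ip_def n2_def .
  show ?lower unfolding ip_def[symmetric] S_def[symmetric] n2_def[symmetric]
  proof (cases "S f")
    case (real y)
    have ti: "integrable lborel (\<lambda>x. (cmod (tr f N x))\<^sup>2)" for N
      by (rule dom[OF fi trm[OF fm] tr_le(1)])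
    define d where "d N x = f x - tr f N x" for N x
    have dm: "d N \<in> borel_measurable borel" for N
      unfolding d_def[abs_def] using fm trm[OF fm] by measurable
    have di: "integrable lborel (\<lambda>x. (cmod (d N x))\<^sup>2)" for N
      by (rule dom[OF fi dm]) (simp add: d_def tr_le)
    have "A * n2 (tr f N) \<le> 2 * y + 2 * (B * n2 (d N))" for N
    proof -
      have "ip (tr f N) i = ip f i - ip (d N) i" for i
        unfolding ip_def d_def using prod_int[OF fm fi] prod_int[OF trm[OF fm] ti]
        by (simp add: left_diff_distrib)
      then have "cmod (ip (tr f N) i) \<le> cmod (ip f i) + cmod (ip (d N) i)" for i
        by (simp add: norm_triangle_ineq4)
      then have "(cmod (ip (tr f N) i))\<^sup>2 \<le> (cmod (ip f i) + cmod (ip (d N) i))\<^sup>2" for i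
        by (intro power_mono) auto
      also have "(cmod (ip f i) + cmod (ip (d N) i))\<^sup>2 \<le> 2 * (cmod (ip f i))\<^sup>2 + 2 * (cmod (ip (d N) i))\<^sup>2" for i
        using sum_squares_bound[of "cmod (ip f i)" "cmod (ip (d N) i)"] by (simp add: power2_sum)
      finally have le: "(cmod (ip (tr f N) i))\<^sup>2 \<le> 2 * (cmod (ip f i))\<^sup>2 + 2 * (cmod (ip (d N) i))\<^sup>2" for i .
      have "ennreal (A * n2 (tr f N)) \<le> S (tr f N)" by (rule trb(1)[OF fm fi])
      also have "\<dots> \<le> (\<integral>\<^sup>+i. ennreal 2 * sq_norm (ip f i) + ennreal 2 * sq_norm (ip (d N) i) \<partial>count_space UNIV)"
        unfolding S_def
        by (rule nn_integral_mono) (use le in \<open>simp add: ennreal_mult[symmetric] ennreal_plus[symmetric] ennreal_leI del: ennreal_plus ennreal_numeral\<close>)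
      also have "\<dots> = ennreal 2 * S f + ennreal 2 * S (d N)"
        unfolding S_def by (simp add: nn_integral_add nn_integral_cmult del: ennreal_numeral)
      also have "\<dots> \<le> ennreal 2 * S f + ennreal 2 * ennreal (B * n2 (d N))"
        by (intro add_left_mono mult_left_mono upper dm di) auto
      also have "\<dots> = ennreal (2 * y + 2 * (B * n2 (d N)))"
        using real B by (simp add: ennreal_mult[symmetric] n2_def del: ennreal_numeral)
      finally show ?thesis
        using real B by (subst (asm) ennreal_le_iff) (auto simp: n2_def)
    qed
    moreover have "(\<lambda>N. A * n2 (tr f N)) \<longlonglongrightarrow> A * n2 f"
    proof (intro tendsto_intros)
      show "(\<lambda>N. n2 (tr f N)) \<longlonglongrightarrow> n2 f"
        unfolding n2_def
      proof (rule integral_dominated_convergence[where w = "\<lambda>x. (cmod (f x))\<^sup>2"])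
        show "AE x in lborel. (\<lambda>N. (cmod (tr f N x))\<^sup>2) \<longlonglongrightarrow> (cmod (f x))\<^sup>2"
          by (intro AE_I2 tendsto_intros tr_lim)
      qed (use fi ti tr_le in \<open>auto intro!: power_mono AE_I2\<close>)
    qed
    moreover have "(\<lambda>N. 2 * y + 2 * (B * n2 (d N))) \<longlonglongrightarrow> 2 * y + 2 * (B * 0)"
    proof (intro tendsto_intros)
      have "(\<lambda>N. n2 (d N)) \<longlonglongrightarrow> (\<integral>x. (cmod 0)\<^sup>2 \<partial>(lborel :: real measure))"
        unfolding n2_def
      proof (rule integral_dominated_convergence[where w = "\<lambda>x. (cmod (f x))\<^sup>2"])
        show "AE x in lborel. (\<lambda>N. (cmod (d N x))\<^sup>2) \<longlonglongrightarrow> (cmod 0)\<^sup>2"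
        proof (rule AE_I2, intro tendsto_intros)
          fix x show "(\<lambda>N. d N x) \<longlonglongrightarrow> 0"
            unfolding d_def using tendsto_diff[OF tendsto_const tr_lim, of "f x" f x] by simp
        qed
      qed (use fi di tr_le in \<open>auto simp: d_def intro!: power_mono AE_I2\<close>)
      then show "(\<lambda>N. n2 (d N)) \<longlonglongrightarrow> 0" by simp
    qed
    ultimately have "A * n2 f \<le> 2 * y + 2 * (B * 0)"
      by (intro LIMSEQ_le) auto
    then show "ennreal (A / 2 * n2 f) \<le> S f" unfolding real(2) by (intro ennreal_leI) simp
  qed simp
qed

text \<open>For fixed \<open>k\<close> the coefficients are the transform of \<open>f\<close> times the conjugate of a
  translate of \<open>g\<close> at the frequencies \<open>m / p\<close>; Parseval's identity removes the sum over \<open>m\<close>. Since \<open>f\<close> is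
  compactly supported, a finite set \<open>N\<close> of translates covers its support for all \<open>x\<close> of the
  unit interval, and the remaining sum over \<open>k\<close> is one of samples of \<open>g\<close>, fibre by fibre in \<open>x\<close>.\<close>
lemma gabor_coefficients_sq_sum:
  fixes f g :: "real \<Rightarrow> complex"
  assumes f[measurable]: "f \<in> borel_measurable borel" and R: "\<And>x. cmod (f x) \<le> R" and X: "\<And>x. X < \<bar>x\<bar> \<Longrightarrow> f x = 0"
    and g[measurable]: "g \<in> borel_measurable borel" and G: "\<And>x. cmod (g x) \<le> G"
    and p: "p > 0"
  obtains N :: "int set" where "finite N"
    "(\<integral>\<^sup>+x. sq_norm (f x) \<partial>lborel) = ennreal p * (\<integral>\<^sup>+x. ennreal (\<Sum>n\<in>N. (cmod (cnj (f (p * (x + of_int n)))))\<^sup>2) \<partial>unit_interval)"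
    "(\<integral>\<^sup>+km. sq_norm (\<integral>x. f x * cnj (wave (of_int (snd km) / p * x) * g (x - \<alpha> * of_int (fst km))) \<partial>lborel) \<partial>count_space UNIV) =
      ennreal (p\<^sup>2) * (\<integral>\<^sup>+x. \<integral>\<^sup>+k. sq_norm (\<Sum>n\<in>N. cnj (f (p * (x + of_int n))) * g (p * (x + of_int n) - \<alpha> * of_int k))
        \<partial>zcount \<partial>unit_interval)"
proof -
  define N where "N = {n :: int. \<bar>of_int n\<bar> \<le> X / p + 1}"
  have "N \<subseteq> {- \<lceil>X / p + 1\<rceil>..\<lceil>X / p + 1\<rceil>}" unfolding N_def by auto linarith+
  then have N: "finite N" by (rule finite_subset) simp
  have out: "f (p * (x + of_int n)) = 0" if x: "x \<in> {0..1}" and n: "n \<notin> N" for x and n :: int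
  proof (rule X)
    have "\<bar>of_int n\<bar> - 1 \<le> \<bar>x + of_int n\<bar>" using x by auto
    moreover have "X / p < \<bar>of_int n\<bar> - 1" using n by (simp add: N_def)
    ultimately have "X / p < \<bar>x + of_int n\<bar>" by linarith
    then have "X < p * \<bar>x + of_int n\<bar>" using p by (simp add: field_simps)
    then show "X < \<bar>p * (x + of_int n)\<bar>" using p by (simp only: abs_mult abs_of_pos)
  qed
  have 1: "(\<integral>\<^sup>+x. sq_norm (f x) \<partial>lborel) = ennreal p * (\<integral>\<^sup>+x. ennreal (\<Sum>n\<in>N. (cmod (cnj (f (p * (x + of_int n)))))\<^sup>2) \<partial>unit_interval)"
  proof -
    have "(\<integral>\<^sup>+x. sq_norm (f x) \<partial>lborel) =
        ennreal p * (\<integral>\<^sup>+x. \<integral>\<^sup>+n. sq_norm (f (p * (x + of_int n))) \<partial>zcount \<partial>unit_interval)"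
      by (rule nn_integral_lborel_eq_scaled_periodization[OF _ p]) measurable
    also have "(\<integral>\<^sup>+x. \<integral>\<^sup>+n. sq_norm (f (p * (x + of_int n))) \<partial>zcount \<partial>unit_interval) =
        (\<integral>\<^sup>+x. ennreal (\<Sum>n\<in>N. (cmod (cnj (f (p * (x + of_int n)))))\<^sup>2) \<partial>unit_interval)"
    proof (rule nn_integral_cong)
      fix x assume "x \<in> space unit_interval"
      then have x: "x \<in> {0..1}" by (simp add: space_restrict_space)
      have "(\<integral>\<^sup>+n. sq_norm (f (p * (x + of_int n))) \<partial>zcount) =
          (\<Sum>n\<in>N. sq_norm (f (p * (x + of_int n))))"
        using out[OF x] by (intro nn_integral_count_space' N) auto
      then show "(\<integral>\<^sup>+n. sq_norm (f (p * (x + of_int n))) \<partial>zcount) =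
          ennreal (\<Sum>n\<in>N. (cmod (cnj (f (p * (x + of_int n)))))\<^sup>2)"
        by simp
    qed
    finally show ?thesis .
  qed
  have R0: "0 \<le> R" using R[of 0] norm_ge_zero order_trans by blast
  have G0: "0 \<le> G" using G[of 0] norm_ge_zero order_trans by blast
  define V where "V k x = (\<Sum>n\<in>N. cnj (f (p * (x + of_int n))) * g (p * (x + of_int n) - \<alpha> * of_int k))" for k :: int and x
  have [measurable]: "V k \<in> borel_measurable borel" for k unfolding V_def[abs_def] by measurable
  have Vm: "(\<lambda>x. sq_norm (V k x)) \<in> borel_measurable unit_interval" for k
    by (rule measurable_restrict_space1) measurable
  have inner: "(\<integral>\<^sup>+m. sq_norm (\<integral>x. f x * cnj (wave (of_int m / p * x) * g (x - \<alpha> * of_int k)) \<partial>lborel) \<partial>count_space UNIV) =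
      ennreal (p\<^sup>2) * (\<integral>\<^sup>+x. sq_norm (V k x) \<partial>unit_interval)" for k :: int
  proof -
    define F where "F x = f x * cnj (g (x - \<alpha> * of_int k))" for x
    have [measurable]: "F \<in> borel_measurable borel" unfolding F_def[abs_def] by measurable
    have FB: "cmod (F x) \<le> R * G" for x
      unfolding F_def using R G R0 by (simp add: norm_mult mult_mono)
    have Fout: "F (p * (x + of_int n)) = 0" if "x \<in> {0..1}" "n \<notin> N" for x and n :: int
      using out[OF that] by (simp add: F_def)
    have "(\<integral>\<^sup>+m. sq_norm (\<integral>x. F x * wave (- (of_int m / p) * x) \<partial>lborel) \<partial>count_space UNIV) =
        ennreal (p\<^sup>2) * (\<integral>\<^sup>+x. sq_norm (\<integral>n. F (p * (x + of_int n)) \<partial>count_space UNIV) \<partial>unit_interval)"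
    proof (rule parseval_periodization[where R = "real (card N) * (R * G)"])
      fix x :: real assume x: "x \<in> {0..1}"
      have "(\<integral>\<^sup>+n. ennreal (cmod (F (p * (x + of_int n)))) \<partial>count_space UNIV) = (\<Sum>n\<in>N. ennreal (cmod (F (p * (x + of_int n)))))"
        using Fout[OF x] by (intro nn_integral_count_space' N) auto
      also have "\<dots> = ennreal (\<Sum>n\<in>N. cmod (F (p * (x + of_int n))))" by simp
      also have "\<dots> \<le> ennreal (\<Sum>n\<in>N. R * G)" by (intro ennreal_leI sum_mono FB)
      finally show "(\<integral>\<^sup>+n. ennreal (cmod (F (p * (x + of_int n)))) \<partial>count_space UNIV) \<le> ennreal (real (card N) * (R * G))"
        by simp
    qed (use p R0 G0 in auto)
    also have "(\<integral>\<^sup>+x. sq_norm (\<integral>n. F (p * (x + of_int n)) \<partial>count_space UNIV) \<partial>unit_interval) =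
        (\<integral>\<^sup>+x. sq_norm (V k x) \<partial>unit_interval)"
    proof (rule nn_integral_cong)
      fix x assume "x \<in> space unit_interval"
      then have x: "x \<in> {0..1}" by (simp add: space_restrict_space)
      have sub: "{n. F (p * (x + of_int n)) \<noteq> 0} \<subseteq> N" using Fout[OF x] by blast
      have "(\<integral>n. F (p * (x + of_int n)) \<partial>count_space UNIV) = (\<Sum>n\<in>{n. F (p * (x + of_int n)) \<noteq> 0}. F (p * (x + of_int n)))"
        using lebesgue_integral_count_space_finite_support[of UNIV "\<lambda>n. F (p * (x + of_int n))"] finite_subset[OF sub N] by simp
      also have "\<dots> = (\<Sum>n\<in>N. F (p * (x + of_int n)))"
        by (rule sum.mono_neutral_left[OF N sub]) auto
      also have "\<dots> = cnj (V k x)" by (simp add: F_def V_def)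
      finally show "sq_norm (\<integral>n. F (p * (x + of_int n)) \<partial>count_space UNIV) = sq_norm (V k x)" by simp
    qed
    also have "(\<lambda>m x. F x * wave (- (of_int m / p) * x)) = (\<lambda>m x. f x * cnj (wave (of_int m / p * x) * g (x - \<alpha> * of_int k)))"
      by (simp add: F_def wave_simps mult_ac)
    finally show ?thesis .
  qed
  define I where "I km = sq_norm (\<integral>x. f x * cnj (wave (of_int (snd km) / p * x) * g (x - \<alpha> * of_int (fst km))) \<partial>lborel)"
    for km :: "int \<times> int"
  have "(\<integral>\<^sup>+km. I km \<partial>count_space UNIV) = (\<integral>\<^sup>+km. I km \<partial>(count_space UNIV \<Otimes>\<^sub>M count_space UNIV))"
    by (rule nn_integral_count_space_prod_eq[symmetric])
  also have "\<dots> = (\<integral>\<^sup>+k. \<integral>\<^sup>+m. I (k, m) \<partial>count_space UNIV \<partial>count_space UNIV)"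
    by (rule int_count.nn_integral_fst[symmetric]) (simp add: pair_measure_countable)
  also have "\<dots> = (\<integral>\<^sup>+k. ennreal (p\<^sup>2) * (\<integral>\<^sup>+x. sq_norm (V k x) \<partial>unit_interval) \<partial>count_space UNIV)"
    unfolding I_def fst_conv snd_conv inner ..
  also have "\<dots> = ennreal (p\<^sup>2) * (\<integral>\<^sup>+k. (\<integral>\<^sup>+x. sq_norm (V k x) \<partial>unit_interval) \<partial>count_space UNIV)"
    by (rule nn_integral_cmult) simp
  also have "(\<integral>\<^sup>+k. (\<integral>\<^sup>+x. sq_norm (V k x) \<partial>unit_interval) \<partial>count_space UNIV) =
      (\<integral>\<^sup>+x. (\<integral>\<^sup>+k. sq_norm (V k x) \<partial>count_space UNIV) \<partial>unit_interval)"
    by (rule nn_integral_count_space_nn_integral[OF _ Vm, symmetric]) simp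
  finally show thesis
    using that[OF N 1] unfolding I_def V_def by blast
qed

text \<open>The counterpart of \<^const>\<open>frame_L2\<close> among Borel functions. Passing between the two is a
  matter of null sets alone, which keeps those out of the estimates.\<close>
definition borel_frame :: "('i \<Rightarrow> real \<Rightarrow> complex) \<Rightarrow> bool" where
  "borel_frame e \<longleftrightarrow> (\<exists>A B. A > 0 \<and> B > 0 \<and> (\<forall>f. f \<in> borel_measurable borel \<longrightarrow> integrable lborel (\<lambda>x. (cmod (f x))\<^sup>2) \<longrightarrow>
       ennreal (A * (\<integral>x. (cmod (f x))\<^sup>2 \<partial>lborel)) \<le>
         frame_sum e f \<and>
       frame_sum e f
         \<le> ennreal (B * (\<integral>x. (cmod (f x))\<^sup>2 \<partial>lborel))))"

text \<open>The sampling bounds hold with the same constants for every \<open>x\<close>; integrating them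
  over a period gives the frame inequalities for bounded, compactly supported functions, to which
  \<open>frame_bounds_extend\<close> applies.\<close>
lemma gabor_frame_bounds:
  fixes K :: "real \<Rightarrow> complex"
  assumes K: "steep s K" and Km: "K \<in> borel_measurable borel" and s: "s > 0"
    and \<alpha>: "\<alpha> > 0" and p: "\<alpha> < p" and small: "exp (- s * (1 / \<alpha> - 1 / p)) \<le> 1 / 5"
    and gK: "\<And>y. g y = inv_fourier K y"
    and gi: "integrable lborel g"
  defines "e \<equiv> \<lambda>km x. wave (of_int (snd km) / p * x) * g (x - \<alpha> * of_int (fst km))"
  shows "\<And>km. e km \<in> borel_measurable borel" "\<And>km. integrable lborel (\<lambda>x. (cmod (e km x))\<^sup>2)"
    "borel_frame e"
proof -
  have p0: "p > 0" using \<alpha> p by simp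
  have gm[measurable]: "g \<in> borel_measurable borel" using borel_measurable_integrable[OF gi] by simp
  define G where "G = (\<integral>w. norm (K w) \<partial>lborel)"
  have gG: "cmod (g y) \<le> G" for y
    unfolding gK G_def by (rule order_trans[OF integral_norm_bound]) (simp add: norm_mult wave_simps)
  show em: "e km \<in> borel_measurable borel" for km unfolding e_def by measurable
  show ei: "integrable lborel (\<lambda>x. (cmod (e km x))\<^sup>2)" for km
  proof -
    have "integrable lborel (\<lambda>x. g (- \<alpha> * of_int (fst km) + 1 * x))"
      by (rule lborel_integrable_real_affine[OF gi]) simp
    then have i: "integrable lborel (\<lambda>x. G * cmod (g (x - \<alpha> * of_int (fst km))))" by simp
    show ?thesis
    proof (rule Bochner_Integration.integrable_bound[OF i])
      show "(\<lambda>x. (cmod (e km x))\<^sup>2) \<in> borel_measurable lborel" using em by measurable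
      show "AE x in lborel. norm ((cmod (e km x))\<^sup>2) \<le> norm (G * cmod (g (x - \<alpha> * of_int (fst km))))"
      proof (rule AE_I2)
        fix x
        have "0 \<le> G" using gG[of 0] norm_ge_zero order_trans by blast
        moreover have "cmod (g (x - \<alpha> * of_int (fst km))) * cmod (g (x - \<alpha> * of_int (fst km))) \<le>
            G * cmod (g (x - \<alpha> * of_int (fst km)))"
          by (rule mult_right_mono[OF gG]) simp
        ultimately show "norm ((cmod (e km x))\<^sup>2) \<le> norm (G * cmod (g (x - \<alpha> * of_int (fst km))))"
          by (simp add: e_def norm_mult wave_simps power2_eq_square)
      qed
    qed
  qed
  obtain A where A: "A > 0" and lower: "\<And>N (c :: int \<Rightarrow> complex) x. finite N \<Longrightarrow>
    ennreal (A * (\<Sum>n\<in>N. (cmod (c n))\<^sup>2)) \<le> sample_sum g p \<alpha> N c x"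
    unfolding gK by (rule samples_sq_sum_lower[OF K Km s \<alpha> p small]) blast
  obtain B where B: "B > 0" and upper: "\<And>N (c :: int \<Rightarrow> complex) x. finite N \<Longrightarrow>
    sample_sum g p \<alpha> N c x \<le> ennreal (B * (\<Sum>n\<in>N. (cmod (c n))\<^sup>2))"
    unfolding gK by (rule samples_sq_sum_upper[OF K Km s \<alpha> p0]) blast
  have pA: "p * A > 0" and pB: "p * B > 0" using p0 A B by auto
  have bounds: "ennreal (p * A) * (\<integral>\<^sup>+x. sq_norm (f x) \<partial>lborel) \<le>
        frame_sum e f \<and>
      frame_sum e f \<le>
        ennreal (p * B) * (\<integral>\<^sup>+x. sq_norm (f x) \<partial>lborel)"
    if f[measurable]: "f \<in> borel_measurable borel" and R': "\<forall>x. cmod (f x) \<le> R" and X': "\<forall>x. X < \<bar>x\<bar> \<longrightarrow> f x = 0"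
    for f R X
  proof -
    have R: "cmod (f x) \<le> R" and X: "X < \<bar>x\<bar> \<Longrightarrow> f x = 0" for x using R' X' by auto
    obtain N :: "int set" where N: "finite N" and f2:
      "(\<integral>\<^sup>+x. sq_norm (f x) \<partial>lborel) = ennreal p * (\<integral>\<^sup>+x. ennreal (\<Sum>n\<in>N. (cmod (cnj (f (p * (x + of_int n)))))\<^sup>2) \<partial>unit_interval)"
      and sum: "(\<integral>\<^sup>+km. sq_norm (\<integral>x. f x * cnj (e km x) \<partial>lborel) \<partial>count_space UNIV) =
      ennreal (p\<^sup>2) * (\<integral>\<^sup>+x. \<integral>\<^sup>+k. sq_norm (\<Sum>n\<in>N. cnj (f (p * (x + of_int n))) * g (p * (x + of_int n) - \<alpha> * of_int k))
        \<partial>zcount \<partial>unit_interval)"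
      unfolding e_def by (rule gabor_coefficients_sq_sum[OF f R X gm gG p0])
    define L where "L x = (\<Sum>n\<in>N. (cmod (cnj (f (p * (x + of_int n)))))\<^sup>2)" for x
    have L0: "L x \<ge> 0" for x unfolding L_def by (rule sum_nonneg) simp
    have [measurable]: "(\<lambda>x. ennreal (L x)) \<in> borel_measurable unit_interval"
      unfolding L_def[abs_def] by (rule measurable_restrict_space1) measurable
    define V where "V x = (\<integral>\<^sup>+k. sq_norm (\<Sum>n\<in>N. cnj (f (p * (x + of_int n))) * g (p * (x + of_int n) - \<alpha> * of_int k))
        \<partial>zcount)" for x
    have scale: "ennreal (p * c) * (\<integral>\<^sup>+x. sq_norm (f x) \<partial>lborel) = ennreal (p\<^sup>2) * (\<integral>\<^sup>+x. ennreal (c * L x) \<partial>unit_interval)"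
      if c: "c > 0" for c
    proof -
      have "(\<integral>\<^sup>+x. ennreal (c * L x) \<partial>unit_interval) = ennreal c * (\<integral>\<^sup>+x. ennreal (L x) \<partial>unit_interval)"
      proof -
        have "(\<integral>\<^sup>+x. ennreal (c * L x) \<partial>unit_interval) = (\<integral>\<^sup>+x. ennreal c * ennreal (L x) \<partial>unit_interval)"
          using c L0 by (simp add: ennreal_mult)
        also have "\<dots> = ennreal c * (\<integral>\<^sup>+x. ennreal (L x) \<partial>unit_interval)"
          by (rule nn_integral_cmult) fact
        finally show ?thesis .
      qed
      moreover have "ennreal (p\<^sup>2) = ennreal p * ennreal p"
        using p0 by (simp add: power2_eq_square ennreal_mult)
      moreover have "ennreal (p * c) = ennreal p * ennreal c" using p0 c by (simp add: ennreal_mult)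
      ultimately show ?thesis unfolding f2 L_def[symmetric] by (simp only: mult_ac)
    qed
    show ?thesis unfolding sum V_def[symmetric] scale[OF A] scale[OF B]
    proof (intro conjI mult_left_mono nn_integral_mono)
      fix x show "ennreal (A * L x) \<le> V x"
        using lower[OF N, of "\<lambda>n. cnj (f (p * (x + of_int n)))" x] unfolding L_def V_def .
      show "V x \<le> ennreal (B * L x)"
        using upper[OF N, of "\<lambda>n. cnj (f (p * (x + of_int n)))" x] unfolding L_def V_def .
    qed auto
  qed
  have inf: "infinite (UNIV :: (int \<times> int) set)" by (simp add: finite_prod)
  show "borel_frame e"
    unfolding borel_frame_def
  proof (rule exI[of _ "p * A / 2"], rule exI[of _ "p * B"], intro conjI allI impI)
    fix f :: "real \<Rightarrow> complex" assume f: "f \<in> borel_measurable borel" "integrable lborel (\<lambda>x. (cmod (f x))\<^sup>2)"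
    show "ennreal (p * A / 2 * (\<integral>x. (cmod (f x))\<^sup>2 \<partial>lborel)) \<le>
         frame_sum e f"
      by (rule frame_bounds_extend(1)[OF inf em ei pA pB _ f]) (rule bounds)
    show "frame_sum e f
         \<le> ennreal (p * B * (\<integral>x. (cmod (f x))\<^sup>2 \<partial>lborel))"
      by (rule frame_bounds_extend(2)[OF inf em ei pA pB _ f]) (rule bounds)
  qed (use pA pB in simp_all)
qed

text \<open>Inserts the inversion formula into the atoms and absorbs the dilation into the
  frequency variable.\<close>
lemma dilate_gabor_ae_eq:
  assumes f: "AE x in lborel. f x = inv_fourier K x" and \<gamma>: "\<gamma> > 0" and p: "p > 0"
  shows "AE x in lborel. gabor (dilate \<gamma> f) \<alpha> (1 / p) km x =
    wave (of_int (snd km) / p * x) *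
      (\<integral>w. (K (w / \<gamma>) * of_real (1 / sqrt \<gamma>)) * wave (w * (x - \<alpha> * of_int (fst km))) \<partial>lborel)"
proof -
  have int: "of_real (sqrt \<gamma>) * inv_fourier K (\<gamma> * y) =
      (\<integral>w. (K (w / \<gamma>) * of_real (1 / sqrt \<gamma>)) * wave (w * y) \<partial>lborel)" for y
  proof -
    have "(\<integral>w. (K (w / \<gamma>) * of_real (1 / sqrt \<gamma>)) * wave (w * y) \<partial>lborel) =
        \<bar>\<gamma>\<bar> *\<^sub>R (\<integral>w. (K ((0 + \<gamma> * w) / \<gamma>) * of_real (1 / sqrt \<gamma>)) * wave ((0 + \<gamma> * w) * y) \<partial>lborel)"
      by (rule lborel_integral_real_affine) (use \<gamma> in auto)
    also have "(\<integral>w. (K ((0 + \<gamma> * w) / \<gamma>) * of_real (1 / sqrt \<gamma>)) * wave ((0 + \<gamma> * w) * y) \<partial>lborel) =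
        (\<integral>w. of_real (1 / sqrt \<gamma>) * (K w * wave (w * (\<gamma> * y))) \<partial>lborel)"
      using \<gamma> by (intro Bochner_Integration.integral_cong) (auto simp: mult_ac)
    also have "\<dots> = of_real (1 / sqrt \<gamma>) * inv_fourier K (\<gamma> * y)"
      by (rule integral_mult_right_zero)
    also have "\<bar>\<gamma>\<bar> *\<^sub>R \<dots> = of_real (\<gamma> * (1 / sqrt \<gamma>)) * inv_fourier K (\<gamma> * y)"
      using \<gamma> by (simp add: scaleR_conv_of_real)
    also have "\<gamma> * (1 / sqrt \<gamma>) = sqrt \<gamma>" using \<gamma> by (simp add: real_div_sqrt)
    finally show ?thesis ..
  qed
  have "AE x in lborel. f (- \<gamma> * \<alpha> * of_int (fst km) + \<gamma> * x) =
      inv_fourier K (- \<gamma> * \<alpha> * of_int (fst km) + \<gamma> * x)"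
    by (rule AE_lborel_affine[OF f]) (use \<gamma> in simp)
  then show ?thesis
  proof eventually_elim
    fix x
    assume eq: "f (- \<gamma> * \<alpha> * of_int (fst km) + \<gamma> * x) =
      inv_fourier K (- \<gamma> * \<alpha> * of_int (fst km) + \<gamma> * x)"
    have arg: "- \<gamma> * \<alpha> * of_int (fst km) + \<gamma> * x = \<gamma> * (x - \<alpha> * of_int (fst km))" by (simp add: algebra_simps)
    have w: "exp (2 * of_real pi * \<i> * of_real (1 / p) * of_int (snd km) * of_real x) = wave (of_int (snd km) / p * x)"
      by (simp add: wave_def cis_conv_exp mult_ac)
    show "gabor (dilate \<gamma> f) \<alpha> (1 / p) km x = wave (of_int (snd km) / p * x) *
      (\<integral>w. (K (w / \<gamma>) * of_real (1 / sqrt \<gamma>)) * wave (w * (x - \<alpha> * of_int (fst km))) \<partial>lborel)"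
      unfolding gabor_def case_prod_unfold dilate_def w int[symmetric] using eq unfolding arg by simp
  qed
qed

text \<open>Inner products and norms depend only on the classes of functions modulo null sets,
  and every class has a Borel representative.\<close>
lemma frame_L2_ae_borel:
  fixes E e :: "'i::countable \<Rightarrow> real \<Rightarrow> complex"
  assumes inf: "infinite (UNIV :: 'i set)"
    and em: "\<And>i. e i \<in> borel_measurable borel" and ei: "\<And>i. integrable lborel (\<lambda>x. (cmod (e i x))\<^sup>2)"
    and eq: "\<And>i. AE x in lborel. E i x = e i x"
    and bounds: "borel_frame e"
  shows "frame_L2 E"
proof -
  note [measurable] = em
  have EL: "E i \<in> L2" for i
  proof -
    have "AE x in lborel. (cmod (E i x))\<^sup>2 = (cmod (e i x))\<^sup>2" using eq[of i] by eventually_elim simp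
    then have "integrable lebesgue (\<lambda>x. (cmod (E i x))\<^sup>2)"
      using ei[of i] by (subst lebesgue_integrable_ae_borel[where f' = "\<lambda>x. (cmod (e i x))\<^sup>2"]) auto
    then show ?thesis using lebesgue_measurable_ae_borel[OF em eq] by (simp add: L2_def)
  qed
  obtain A B where AB: "A > 0" "B > 0"
    and bd: "\<And>f. f \<in> borel_measurable borel \<Longrightarrow> integrable lborel (\<lambda>x. (cmod (f x))\<^sup>2) \<Longrightarrow>
       ennreal (A * (\<integral>x. (cmod (f x))\<^sup>2 \<partial>lborel)) \<le>
         frame_sum e f \<and>
       frame_sum e f
         \<le> ennreal (B * (\<integral>x. (cmod (f x))\<^sup>2 \<partial>lborel))"
    using bounds unfolding borel_frame_def by blast
  show ?thesis unfolding frame_L2_def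
  proof (rule conjI[OF allI[OF EL]], rule exI[of _ A], rule exI[of _ B], intro conjI ballI AB)
    fix f assume "f \<in> L2"
    then have fL: "f \<in> borel_measurable lebesgue" "integrable lebesgue (\<lambda>x. (cmod (f x))\<^sup>2)" by (auto simp: L2_def)
    obtain f' where f'[measurable]: "f' \<in> borel_measurable borel" and ff': "AE x in lborel. f x = f' x"
      using lebesgue_measurable_imp_ae_borel[OF fL(1)] by blast
    have sq: "AE x in lborel. (cmod (f x))\<^sup>2 = (cmod (f' x))\<^sup>2" using ff' by eventually_elim simp
    have i: "integrable lborel (\<lambda>x. (cmod (f' x))\<^sup>2)"
      using fL(2) sq by (subst (asm) lebesgue_integrable_ae_borel[where f' = "\<lambda>x. (cmod (f' x))\<^sup>2"]) auto
    have "(LINT x|lebesgue. (cmod (f x))\<^sup>2) = (\<integral>x. (cmod (f' x))\<^sup>2 \<partial>lborel)"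
      by (rule lebesgue_integral_ae_borel[OF _ sq]) measurable
    then have n: "(L2_norm f)\<^sup>2 = (\<integral>x. (cmod (f' x))\<^sup>2 \<partial>lborel)" by (simp add: L2_norm_def)
    have ip: "L2_inner f (E i) = (\<integral>x. f' x * cnj (e i x) \<partial>lborel)" for i
      unfolding L2_inner_def
    proof (rule lebesgue_integral_ae_borel)
      show "AE x in lborel. f x * cnj (E i x) = f' x * cnj (e i x)"
        using ff' eq[of i] by eventually_elim simp
    qed measurable
    show "ennreal (A * (L2_norm f)\<^sup>2) \<le> (\<Sum>\<^sub>\<infinity>i\<in>UNIV. sq_norm (L2_inner f (E i)))"
      "(\<Sum>\<^sub>\<infinity>i\<in>UNIV. sq_norm (L2_inner f (E i))) \<le> ennreal (B * (L2_norm f)\<^sup>2)"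
      unfolding infsum_ennreal_eq_nn_integral[OF inf] n ip using bd[OF f' i] by blast+
  qed
qed

section \<open>Type-II functions\<close>

theorem theorem5p1:
  fixes \<phi> :: "real \<Rightarrow> complex"
  assumes "type_II \<phi>"
  shows "(\<forall>\<alpha>>0. ((\<lambda>\<gamma>. M_const (dilate \<gamma> \<phi>) (1 / \<alpha>)) \<longlongrightarrow> ennreal (\<alpha>\<^sup>2 / 4)) (at_right 0)) \<and>
         (\<forall>\<alpha> \<beta>. 0 < \<alpha> \<longrightarrow> 0 < \<beta> \<longrightarrow> \<alpha> * \<beta> < 1 \<longrightarrow>
            (\<exists>\<gamma>>0. frame_L2 (gabor (dilate \<gamma> \<phi>) \<alpha> \<beta>)))"
proof -
  from assms obtain v :: "nat \<Rightarrow> real" where \<phi>i: "integrable lebesgue \<phi>" and v: "summable (\<lambda>j. (v j)\<^sup>2)"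
    and prod: "\<And>w. fourier \<phi> w = of_real (exp (- \<bar>w\<bar>)) *
           (\<Prod>j. inverse (1 + 2 * of_real pi * \<i> * of_real (v j) * of_real w) *
                exp (2 * of_real pi * \<i> * of_real (v j) * of_real w))"
    unfolding type_II_def by blast
  have steep: "steep 1 (fourier \<phi>)" by (rule steep_typeII_product[OF v prod])
  obtain \<phi>' where \<phi>': "\<phi>' \<in> borel_measurable borel" "AE x in lborel. \<phi> x = \<phi>' x"
    using lebesgue_measurable_imp_ae_borel[OF borel_measurable_integrable[OF \<phi>i]] by blast
  have \<phi>'i: "integrable lborel \<phi>'" using \<phi>i lebesgue_integrable_ae_borel[OF \<phi>'] by simp
  define \<psi> where "\<psi> = fourier \<phi>"
  have \<psi>m: "\<psi> \<in> borel_measurable borel" unfolding \<psi>_def by (rule borel_measurable_fourier[OF \<phi>'])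
  have \<psi>i: "integrable lborel \<psi>"
    by (rule steep_integrable[OF steep[folded \<psi>_def] \<psi>m]) simp
  have \<psi>eq: "\<psi> = (\<lambda>w. \<integral>x. \<phi>' x * wave (- w * x) \<partial>lborel)"
    unfolding \<psi>_def fourier_eq_lborel[OF \<phi>'] fourier_kernel_eq_wave ..
  have inv': "AE x in lborel. \<phi>' x = inv_fourier \<psi> x"
    using fourier_inversion[OF \<phi>'i \<psi>i[unfolded \<psi>eq]] unfolding \<psi>eq .
  then have inv: "AE x in lborel. \<phi> x = inv_fourier \<psi> x"
    using \<phi>'(2) by eventually_elim simp
  have "frame_L2 (gabor (dilate \<gamma> \<phi>) \<alpha> \<beta>)"
    if \<alpha>: "\<alpha> > 0" and \<beta>: "\<beta> > 0" and \<alpha>\<beta>: "\<alpha> * \<beta> < 1" and \<gamma>: "\<gamma> = (1 / \<alpha> - \<beta>) / 2" for \<alpha> \<beta> \<gamma>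
  proof -
    define p where "p = 1 / \<beta>"
    have p: "p > 0" "\<beta> = 1 / p" using \<beta> by (simp_all add: p_def)
    have \<alpha>p: "\<alpha> < p" using \<alpha>\<beta> \<beta> by (simp add: p_def field_simps)
    have "\<beta> < 1 / \<alpha>" using \<alpha> \<alpha>\<beta> by (simp add: field_simps)
    then have \<gamma>0: "\<gamma> > 0" using \<gamma> by simp
    define K where "K w = \<psi> (w / \<gamma>) * of_real (1 / sqrt \<gamma>)" for w
    have K: "steep (1 / \<gamma>) K"
      unfolding K_def using steep_dilate[OF steep[folded \<psi>_def] \<gamma>0, of "1 / sqrt \<gamma>"] \<gamma>0 by simp
    have Km: "K \<in> borel_measurable borel" unfolding K_def[abs_def] using \<psi>m by measurable
    \<comment> \<open>The choice of \<open>\<gamma>\<close> makes the exponent equal to \<open>- 2\<close>, and \<open>exp 2 \<ge> 1 + 2 + 2\<close>.\<close>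
    have small: "exp (- (1 / \<gamma>) * (1 / \<alpha> - 1 / p)) \<le> 1 / 5"
    proof -
      have "1 / \<alpha> - 1 / p = 2 * \<gamma>" using \<gamma> p(2) by simp
      then have "- (1 / \<gamma>) * (1 / \<alpha> - 1 / p) = - 2" using \<gamma>0 by simp
      moreover have "exp (2 :: real) \<ge> 5" using exp_lower_Taylor_quadratic[of "2 :: real"] by simp
      ultimately show ?thesis by (simp add: exp_minus field_simps)
    qed
    define g where "g y = inv_fourier K y" for y
    have gae: "AE x in lborel. gabor (dilate \<gamma> \<phi>) \<alpha> \<beta> km x =
        wave (of_int (snd km) / p * x) * g (x - \<alpha> * of_int (fst km))" for km
      unfolding p(2) g_def K_def using dilate_gabor_ae_eq[OF inv \<gamma>0 p(1)] .
    \<comment> \<open>Integrability of \<open>g\<close> comes from \<open>\<phi>\<close>; the integral that defines \<open>g\<close> only shows that it is bounded.\<close>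
    have gi: "integrable lborel g"
    proof -
      have ae: "AE x in lborel. of_real (sqrt \<gamma>) * \<phi>' (0 + \<gamma> * x) = g x"
      proof -
        have "AE x in lborel. \<phi> (0 + \<gamma> * x) = \<phi>' (0 + \<gamma> * x)"
          by (rule AE_lborel_affine[OF \<phi>'(2)]) (use \<gamma>0 in simp)
        with gae[of "(0, 0)"] show ?thesis
          by eventually_elim (simp add: gabor_def dilate_def wave_simps)
      qed
      have int: "integrable lborel (\<lambda>x. of_real (sqrt \<gamma>) * \<phi>' (0 + \<gamma> * x))"
        using lborel_integrable_real_affine[OF \<phi>'i, of \<gamma> 0] \<gamma>0 by simp
      have "g \<in> borel_measurable lborel"
        unfolding g_def[abs_def] by (rule lborel.borel_measurable_lebesgue_integral) (use Km in measurable)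
      from integrable_cong_AE_imp[OF int this] ae show ?thesis by (simp add: eq_commute)
    qed
    have s: "1 / \<gamma> > 0" using \<gamma>0 by simp
    note fb = gabor_frame_bounds[where g = g, OF K Km s \<alpha> \<alpha>p small g_def gi]
    show ?thesis
    proof (rule frame_L2_ae_borel)
      show "infinite (UNIV :: (int \<times> int) set)" by (simp add: finite_prod)
    qed (fact fb(1) fb(2) fb(3) gae)+
  qed
  then have "\<exists>\<gamma>>0. frame_L2 (gabor (dilate \<gamma> \<phi>) \<alpha> \<beta>)" if "\<alpha> > 0" "\<beta> > 0" "\<alpha> * \<beta> < 1" for \<alpha> \<beta>
    using that by (intro exI[of _ "(1 / \<alpha> - \<beta>) / 2"]) (simp add: field_simps)
  with M_const_dilate_limit[OF \<phi>' steep] show ?thesis by simp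
qed

end
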